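(* Let $\sim$ be an equivalence relation on $U$, and let $(S,U,A,C)$ be an instance of WSP in which every constraint is either of the form $(s_1,s_2,\sim)$, of the form $(s_1,s_2,\not\sim)$, or user-independent. Then the instance can be solved in time $O^*(2^{k\log k+k})$, where $k=|S|$.
   Context: An instance of WSP is a tuple $(S,U,A,C)$: $S$ a finite set of tasks ($k=|S|$), $U$ a finite set of users ($n=|U|$), $A(s)\subseteq U$ the authorization list of $s\in S$ (arbitrary), $C$ a set of constraints ($m=|C|$); a constraint is a pair $(L,\Theta)$ with $L\subseteq S$ and $\Theta$ a set of functions $L\to U$. A plan $\pi:T\to X$ ($T\subseteq S$, $X\subseteq U$) satisfies $(L,\Theta)$ if $L\setminus T\neq\emptyset$ or $\pi|_L\in\Theta$; it is eligible if it satisfies all constraints, authorized if $\pi(s)\in A(s)$ for all $s\in T$, valid if both, complete if it is a plan $S\to U$. Solving WSP means outputting a valid complete plan if one exists and reporting that none exists otherwise. For a binary relation $\rho$ on $U$, $(s,s',\rho)$ is the constraint with scope $\{s,s'\}$ satisfied exactly when $\pi(s)\mathrel\rho\pi(s')$; $\not\sim$ is the complement of $\sim$. A constraint $(L,\Theta)$ is user-independent if $\psi\circ\theta\in\Theta$ for all $\theta\in\Theta$ and all permutations $\psi$ of $U$. It is assumed each constraint and authorization can be checked in time polynomial in $n,k,m$; $O^*(h)$ means $O(q(n,k,m)h)$ for a polynomial $q$; $\log$ is base 2. *)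

theory Defs
  imports Complex_Main "HOL-Combinatorics.Permutations"
begin

section \<open>The workflow satisfiability problem\<close>

text \<open>A function from \<open>L\<close> to \<open>U\<close> is a partial map with domain \<open>L\<close> and range inside \<open>U\<close>;
  a plan is a partial map from tasks to users.\<close>

type_synonym ('s, 'u) constraint = "'s set \<times> ('s \<rightharpoonup> 'u) set"

type_synonym ('s, 'u) wsp =
  "'s set \<times> 'u set \<times> ('s \<Rightarrow> 'u set) \<times> ('s, 'u) constraint set"

definition wsp_instance :: "('s, 'u) wsp \<Rightarrow> bool" where
  "wsp_instance W \<longleftrightarrow> (case W of (S, U, A, C) \<Rightarrow>
     finite S \<and> finite U \<and> (\<forall>s\<in>S. A s \<subseteq> U) \<and>
     (\<forall>(L, \<Theta>)\<in>C. L \<subseteq> S \<and> (\<forall>\<theta>\<in>\<Theta>. dom \<theta> = L \<and> ran \<theta> \<subseteq> U)))"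

definition plan :: "'s set \<Rightarrow> 'u set \<Rightarrow> ('s \<rightharpoonup> 'u) \<Rightarrow> bool" where
  "plan S U \<pi> \<longleftrightarrow> dom \<pi> \<subseteq> S \<and> ran \<pi> \<subseteq> U"

definition satisfies :: "('s \<rightharpoonup> 'u) \<Rightarrow> ('s, 'u) constraint \<Rightarrow> bool" where
  "satisfies \<pi> c \<longleftrightarrow> fst c - dom \<pi> \<noteq> {} \<or> \<pi> |` fst c \<in> snd c"

definition eligible :: "('s, 'u) constraint set \<Rightarrow> ('s \<rightharpoonup> 'u) \<Rightarrow> bool" where
  "eligible C \<pi> \<longleftrightarrow> (\<forall>c\<in>C. satisfies \<pi> c)"

definition authorized :: "('s \<Rightarrow> 'u set) \<Rightarrow> ('s \<rightharpoonup> 'u) \<Rightarrow> bool" where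
  "authorized A \<pi> \<longleftrightarrow> (\<forall>s\<in>dom \<pi>. the (\<pi> s) \<in> A s)"

definition valid_complete_plan :: "('s, 'u) wsp \<Rightarrow> ('s \<rightharpoonup> 'u) \<Rightarrow> bool" where
  "valid_complete_plan W \<pi> \<longleftrightarrow> (case W of (S, U, A, C) \<Rightarrow>
     plan S U \<pi> \<and> dom \<pi> = S \<and> eligible C \<pi> \<and> authorized A \<pi>)"

definition rel_constraint :: "'u set \<Rightarrow> 's \<Rightarrow> 's \<Rightarrow> ('u \<times> 'u) set \<Rightarrow> ('s, 'u) constraint" where
  "rel_constraint U s s' \<rho> =
     ({s, s'}, {\<theta>. dom \<theta> = {s, s'} \<and> ran \<theta> \<subseteq> U \<and> (the (\<theta> s), the (\<theta> s')) \<in> \<rho>})"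

definition user_independent :: "'u set \<Rightarrow> ('s, 'u) constraint \<Rightarrow> bool" where
  "user_independent U c \<longleftrightarrow>
     (\<forall>\<theta>\<in>snd c. \<forall>\<psi>. \<psi> permutes U \<longrightarrow> map_option \<psi> \<circ> \<theta> \<in> snd c)"

section \<open>Model of computation\<close>

text \<open>A unit-cost random access machine in structured form. A program works on
  registers and on arrays of natural numbers, with addition and truncated subtraction
  as its only arithmetic (there is no unit-cost multiplication). Every node of an evaluated
  expression and every executed command costs one time unit. The authorization lists and
  the constraints are accessible only through queries, each of which costs
  \<open>query_time\<close> additional units.\<close>

datatype exp = Const nat | Reg nat | Cell nat exp | Add exp exp | Sub exp exp

text \<open>The first argument of the three query commands is the register that receives the
  answer. The last argument of \<open>CheckQ\<close> is the array that holds the queried plan.\<close>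

datatype com =
    Skip
  | Assign nat exp
  | Store nat exp exp
  | Seq com com
  | If exp com com
  | While exp com
  | AuthQ nat exp exp
  | ScopeQ nat exp exp
  | CheckQ nat exp nat

type_synonym state = "(nat \<Rightarrow> nat) \<times> (nat \<Rightarrow> nat \<Rightarrow> nat)"

record queries =
  auth_query :: "nat \<Rightarrow> nat \<Rightarrow> bool"
  scope_query :: "nat \<Rightarrow> nat \<Rightarrow> bool"
  check_query :: "nat \<Rightarrow> (nat \<Rightarrow> nat) \<Rightarrow> bool"
  query_time :: nat

primrec eval_exp :: "exp \<Rightarrow> state \<Rightarrow> nat" where
  "eval_exp (Const v) \<sigma> = v"
| "eval_exp (Reg x) \<sigma> = fst \<sigma> x"
| "eval_exp (Cell a e) \<sigma> = snd \<sigma> a (eval_exp e \<sigma>)"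
| "eval_exp (Add e e') \<sigma> = eval_exp e \<sigma> + eval_exp e' \<sigma>"
| "eval_exp (Sub e e') \<sigma> = eval_exp e \<sigma> - eval_exp e' \<sigma>"

primrec exp_time :: "exp \<Rightarrow> nat" where
  "exp_time (Const v) = 1"
| "exp_time (Reg x) = 1"
| "exp_time (Cell a e) = 1 + exp_time e"
| "exp_time (Add e e') = 1 + exp_time e + exp_time e'"
| "exp_time (Sub e e') = 1 + exp_time e + exp_time e'"

definition set_reg :: "nat \<Rightarrow> nat \<Rightarrow> state \<Rightarrow> state" where
  "set_reg x v \<sigma> = ((fst \<sigma>)(x := v), snd \<sigma>)"

definition set_cell :: "nat \<Rightarrow> nat \<Rightarrow> nat \<Rightarrow> state \<Rightarrow> state" where
  "set_cell a i v \<sigma> = (fst \<sigma>, (snd \<sigma>)(a := (snd \<sigma> a)(i := v)))"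

text \<open>\<open>exec Q c \<sigma> t \<sigma>'\<close>: started in state \<open>\<sigma>\<close>, command \<open>c\<close> halts in state \<open>\<sigma>'\<close> after time \<open>t\<close>.\<close>

inductive exec :: "queries \<Rightarrow> com \<Rightarrow> state \<Rightarrow> nat \<Rightarrow> state \<Rightarrow> bool" for Q :: queries where
  Skip: "exec Q Skip \<sigma> 1 \<sigma>"
| Assign: "exec Q (Assign x e) \<sigma> (1 + exp_time e) (set_reg x (eval_exp e \<sigma>) \<sigma>)"
| Store: "exec Q (Store a e e') \<sigma> (1 + exp_time e + exp_time e')
    (set_cell a (eval_exp e \<sigma>) (eval_exp e' \<sigma>) \<sigma>)"
| Seq: "exec Q c \<sigma> t \<sigma>' \<Longrightarrow> exec Q c' \<sigma>' t' \<sigma>'' \<Longrightarrow> exec Q (Seq c c') \<sigma> (1 + t + t') \<sigma>''"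
| If_True: "eval_exp e \<sigma> \<noteq> 0 \<Longrightarrow> exec Q c \<sigma> t \<sigma>' \<Longrightarrow>
    exec Q (If e c c') \<sigma> (1 + exp_time e + t) \<sigma>'"
| If_False: "eval_exp e \<sigma> = 0 \<Longrightarrow> exec Q c' \<sigma> t \<sigma>' \<Longrightarrow>
    exec Q (If e c c') \<sigma> (1 + exp_time e + t) \<sigma>'"
| While_False: "eval_exp e \<sigma> = 0 \<Longrightarrow> exec Q (While e c) \<sigma> (1 + exp_time e) \<sigma>"
| While_True: "eval_exp e \<sigma> \<noteq> 0 \<Longrightarrow> exec Q c \<sigma> t \<sigma>' \<Longrightarrow> exec Q (While e c) \<sigma>' t' \<sigma>'' \<Longrightarrow>
    exec Q (While e c) \<sigma> (1 + exp_time e + t + t') \<sigma>''"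
| AuthQ: "exec Q (AuthQ x e e') \<sigma> (1 + exp_time e + exp_time e' + query_time Q)
    (set_reg x (of_bool (auth_query Q (eval_exp e \<sigma>) (eval_exp e' \<sigma>))) \<sigma>)"
| ScopeQ: "exec Q (ScopeQ x e e') \<sigma> (1 + exp_time e + exp_time e' + query_time Q)
    (set_reg x (of_bool (scope_query Q (eval_exp e \<sigma>) (eval_exp e' \<sigma>))) \<sigma>)"
| CheckQ: "exec Q (CheckQ x e a) \<sigma> (1 + exp_time e + query_time Q)
    (set_reg x (of_bool (check_query Q (eval_exp e \<sigma>) (snd \<sigma> a))) \<sigma>)"

inductive_cases exec_SkipE: "exec Q Skip \<sigma> t \<sigma>'"
inductive_cases exec_AssignE: "exec Q (Assign x e) \<sigma> t \<sigma>'"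
inductive_cases exec_StoreE: "exec Q (Store a e e') \<sigma> t \<sigma>'"
inductive_cases exec_SeqE: "exec Q (Seq c c') \<sigma> t \<sigma>'"
inductive_cases exec_IfE: "exec Q (If e c c') \<sigma> t \<sigma>'"
inductive_cases exec_WhileE: "exec Q (While e c) \<sigma> t \<sigma>'"
inductive_cases exec_AuthQE: "exec Q (AuthQ x e e') \<sigma> t \<sigma>'"
inductive_cases exec_ScopeQE: "exec Q (ScopeQ x e e') \<sigma> t \<sigma>'"
inductive_cases exec_CheckQE: "exec Q (CheckQ x e a) \<sigma> t \<sigma>'"

lemma exec_deterministic:
  "exec Q c \<sigma> t \<sigma>' \<Longrightarrow> exec Q c \<sigma> u \<sigma>'' \<Longrightarrow> u = t \<and> \<sigma>'' = \<sigma>'"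
proof (induction arbitrary: u \<sigma>'' rule: exec.induct)
  case (Skip \<sigma>)
  then show ?case by (elim exec_SkipE) simp
next
  case (Assign x e \<sigma>)
  then show ?case by (elim exec_AssignE) simp
next
  case (Store a e e' \<sigma>)
  then show ?case by (elim exec_StoreE) simp
next
  case (Seq c \<sigma> t \<sigma>' c' t' \<tau>)
  from Seq.prems obtain v \<rho> v'
    where u: "u = 1 + v + v'" and "exec Q c \<sigma> v \<rho>" and second: "exec Q c' \<rho> v' \<sigma>''"
    by (rule exec_SeqE) simp
  then have "v = t \<and> \<rho> = \<sigma>'" by (intro Seq.IH(1))
  with u Seq.IH(2)[of v' \<sigma>''] second show ?case by simp
next
  case (If_True e \<sigma> c t \<sigma>' c')
  from If_True.prems show ?case
    by (rule exec_IfE) (use If_True.hyps(1) in \<open>auto dest!: If_True.IH\<close>)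
next
  case (If_False e \<sigma> c t \<sigma>' c')
  from If_False.prems show ?case
    by (rule exec_IfE) (use If_False.hyps(1) in \<open>auto dest!: If_False.IH\<close>)
next
  case (While_False e \<sigma> c)
  from While_False.prems show ?case
    by (rule exec_WhileE) (use While_False.hyps in force)+
next
  case (While_True e \<sigma> c t \<sigma>' t' \<tau>)
  from While_True.prems obtain v \<rho> v'
    where u: "u = 1 + exp_time e + v + v'" and "exec Q c \<sigma> v \<rho>"
      and loop: "exec Q (While e c) \<rho> v' \<sigma>''"
    by (rule exec_WhileE) (use While_True.hyps(1) in simp_all)
  then have "v = t \<and> \<rho> = \<sigma>'" by (intro While_True.IH(1))
  with u While_True.IH(2)[of v' \<sigma>''] loop show ?case by simp
next
  case (AuthQ x e e' \<sigma>)
  then show ?case by (elim exec_AuthQE) simp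
next
  case (ScopeQ x e e' \<sigma>)
  then show ?case by (elim exec_ScopeQE) simp
next
  case (CheckQ x e a \<sigma>)
  then show ?case by (elim exec_CheckQE) simp
qed

section \<open>Solving instances of the problem on the machine\<close>

text \<open>An instance is presented by arbitrary enumerations of its tasks, users and constraints,
  and the machine refers to these by their positions. An array \<open>a\<close> stands for the plan that
  assigns to the \<open>i\<close>-th task the user at position \<open>a i\<close>, and leaves the task unassigned
  if \<open>a i\<close> is not a position of a user.\<close>

definition enumerates :: "'s list \<Rightarrow> 'u list \<Rightarrow> ('s, 'u) constraint list \<Rightarrow> ('s, 'u) wsp \<Rightarrow> bool" where
  "enumerates ss us cs W \<longleftrightarrow> (case W of (S, U, A, C) \<Rightarrow>
     distinct ss \<and> set ss = S \<and> distinct us \<and> set us = U \<and> distinct cs \<and> set cs = C)"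

definition plan_of_array :: "'s list \<Rightarrow> 'u list \<Rightarrow> (nat \<Rightarrow> nat) \<Rightarrow> 's \<rightharpoonup> 'u" where
  "plan_of_array ss us a =
     map_of (map (\<lambda>i. (ss ! i, us ! a i)) (filter (\<lambda>i. a i < length us) [0..<length ss]))"

definition wsp_queries ::
  "'s list \<Rightarrow> 'u list \<Rightarrow> ('s, 'u) constraint list \<Rightarrow> ('s, 'u) wsp \<Rightarrow> nat \<Rightarrow> queries" where
  "wsp_queries ss us cs W \<tau> = (case W of (S, U, A, C) \<Rightarrow>
     \<lparr>auth_query = (\<lambda>i j. i < length ss \<and> j < length us \<and> us ! j \<in> A (ss ! i)),
      scope_query = (\<lambda>l i. l < length cs \<and> i < length ss \<and> ss ! i \<in> fst (cs ! l)),
      check_query = (\<lambda>l a. l < length cs \<and> satisfies (plan_of_array ss us a) (cs ! l)),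
      query_time = \<tau>\<rparr>)"

definition input_state :: "nat \<Rightarrow> nat \<Rightarrow> nat \<Rightarrow> state" where
  "input_state n k m = ((\<lambda>_. 0)(0 := n, 1 := k, 2 := m), \<lambda>_ _. 0)"

text \<open>Register 0 finally tells whether a plan was found; if so, array 0 holds it.\<close>

definition solution_state :: "'s list \<Rightarrow> 'u list \<Rightarrow> ('s, 'u) wsp \<Rightarrow> state \<Rightarrow> bool" where
  "solution_state ss us W \<sigma> \<longleftrightarrow>
     (if \<exists>\<pi>. valid_complete_plan W \<pi>
      then fst \<sigma> 0 \<noteq> 0 \<and> valid_complete_plan W (plan_of_array ss us (snd \<sigma> 0))
      else fst \<sigma> 0 = 0)"

inductive polynomial3 :: "(nat \<Rightarrow> nat \<Rightarrow> nat \<Rightarrow> real) \<Rightarrow> bool" where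
  const: "polynomial3 (\<lambda>n k m. r)"
| var1: "polynomial3 (\<lambda>n k m. real n)"
| var2: "polynomial3 (\<lambda>n k m. real k)"
| var3: "polynomial3 (\<lambda>n k m. real m)"
| add: "polynomial3 p \<Longrightarrow> polynomial3 q \<Longrightarrow> polynomial3 (\<lambda>n k m. p n k m + q n k m)"
| mult: "polynomial3 p \<Longrightarrow> polynomial3 q \<Longrightarrow> polynomial3 (\<lambda>n k m. p n k m * q n k m)"

text \<open>The instances in the class \<open>K\<close> are solved in time \<open>O\<^sup>*(h k)\<close> by one program \<open>P\<close>, provided
  that each query is answered in time \<open>\<tau>\<close> bounded by a polynomial \<open>p\<close> in \<open>n\<close>, \<open>k\<close>, \<open>m\<close>. The
  constant hidden in the \<open>O\<close> is part of the polynomial \<open>q\<close>.\<close>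

definition solvable_in_O_star :: "('s, 'u) wsp set \<Rightarrow> (nat \<Rightarrow> real) \<Rightarrow> bool" where
  "solvable_in_O_star K h \<longleftrightarrow>
     (\<exists>P. \<forall>p. polynomial3 p \<longrightarrow> (\<exists>q. polynomial3 q \<and>
        (\<forall>W\<in>K. \<forall>ss us cs \<tau>. wsp_instance W \<longrightarrow> enumerates ss us cs W \<longrightarrow>
           (let n = length us; k = length ss; m = length cs in
              real \<tau> \<le> p n k m \<longrightarrow>
              (\<exists>t \<sigma>. exec (wsp_queries ss us cs W \<tau>) P (input_state n k m) t \<sigma> \<and>
                 solution_state ss us W \<sigma> \<and> real t \<le> q n k m * h k)))))"

end

theory Submission
  imports Defs
begin

text \<open>Two plans with the same pattern, that is, which agree on which tasks get equal users and
  which get equivalent users, satisfy the same constraints, since an injection between sets of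
  users extends to a permutation of \<open>U\<close>. A pattern is coded by one digit below \<open>2k\<close> per task,
  so there are at most \<open>(2k)\<^sup>k\<close> of them, and the solver tries them all. A given pattern is realized
  in polynomial time by two nested bipartite matchings: an outer one of classes of tasks with
  equivalence classes of users, and, deciding adjacency in the outer one, an inner one
  of groups of tasks with the users of one equivalence class that are authorized for the group.
  Both are computed by an auction. Every plan found is verified by queries before it is
  output, so soundness is immediate.\<close>

section \<open>Loop programs\<close>

text \<open>\<open>(2 * k) ^ k\<close> equals \<open>2 powr (k * log 2 k + k)\<close> exactly, so
  the whole budget is spent on enumerating patterns, and everything done for one pattern, the choice
  of users included, must be polynomial. The obstacle is that the relation is hidden: only yes-no
  answers are available, and nothing tells which constraints are relational. Hence every triple of a
  constraint and two tasks is tried as a source of the relation, and a constant class map is tried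
  for instances in which no constraint depends on it. Wrong guesses are harmless because of the
  final verification, so completeness is the real work: for the pattern of a valid plan and a
  faithful class map, every realization must pass, whichever one the matchings happen to produce. An
  auction suits this setting because it consists of a fixed number, \<open>n * k\<close>, of
  identical rounds and needs no search for augmenting paths; prices carry all the information
  between rounds.\<close>

text \<open>The only loops are counting loops whose bound is one of the input registers 0, 1, 2. Hence
  every such program denotes a total state transformer, and its running time is bounded by a
  polynomial that can be read off the syntax.\<close>

datatype prog =
    PSkip
  | PAssign nat exp
  | PStore nat exp exp
  | PSeq prog prog (infixr ";;" 60)
  | PIf exp prog prog
  | PFor nat nat prog
  | PAuth nat exp exp
  | PCheck nat exp nat

primrec compile :: "prog \<Rightarrow> com" where
  "compile PSkip = Skip"
| "compile (PAssign x e) = Assign x e"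
| "compile (PStore a e e') = Store a e e'"
| "compile (p ;; q) = Seq (compile p) (compile q)"
| "compile (PIf e p q) = If e (compile p) (compile q)"
| "compile (PFor x r p) = Seq (Assign x (Const 0))
     (While (Sub (Reg r) (Reg x)) (Seq (compile p) (Assign x (Add (Reg x) (Const 1)))))"
| "compile (PAuth x e e') = AuthQ x e e'"
| "compile (PCheck x e a) = CheckQ x e a"

primrec den :: "queries \<Rightarrow> prog \<Rightarrow> state \<Rightarrow> state" where
  "den Q PSkip = (\<lambda>\<sigma>. \<sigma>)"
| "den Q (PAssign x e) = (\<lambda>\<sigma>. set_reg x (eval_exp e \<sigma>) \<sigma>)"
| "den Q (PStore a e e') = (\<lambda>\<sigma>. set_cell a (eval_exp e \<sigma>) (eval_exp e' \<sigma>) \<sigma>)"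
| "den Q (p ;; q) = (\<lambda>\<sigma>. den Q q (den Q p \<sigma>))"
| "den Q (PIf e p q) = (\<lambda>\<sigma>. if eval_exp e \<sigma> \<noteq> 0 then den Q p \<sigma> else den Q q \<sigma>)"
| "den Q (PFor x r p) = (\<lambda>\<sigma>.
     ((\<lambda>\<sigma>. set_reg x (Suc (fst (den Q p \<sigma>) x)) (den Q p \<sigma>)) ^^ fst \<sigma> r) (set_reg x 0 \<sigma>))"
| "den Q (PAuth x e e') = (\<lambda>\<sigma>.
     set_reg x (of_bool (auth_query Q (eval_exp e \<sigma>) (eval_exp e' \<sigma>))) \<sigma>)"
| "den Q (PCheck x e a) = (\<lambda>\<sigma>.
     set_reg x (of_bool (check_query Q (eval_exp e \<sigma>) (snd \<sigma> a))) \<sigma>)"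

primrec wregs :: "prog \<Rightarrow> nat set" where
  "wregs PSkip = {}"
| "wregs (PAssign x e) = {x}"
| "wregs (PStore a e e') = {}"
| "wregs (p ;; q) = wregs p \<union> wregs q"
| "wregs (PIf e p q) = wregs p \<union> wregs q"
| "wregs (PFor x r p) = insert x (wregs p)"
| "wregs (PAuth x e e') = {x}"
| "wregs (PCheck x e a) = {x}"

primrec warrs :: "prog \<Rightarrow> nat set" where
  "warrs PSkip = {}"
| "warrs (PAssign x e) = {}"
| "warrs (PStore a e e') = {a}"
| "warrs (p ;; q) = warrs p \<union> warrs q"
| "warrs (PIf e p q) = warrs p \<union> warrs q"
| "warrs (PFor x r p) = warrs p"
| "warrs (PAuth x e e') = {}"
| "warrs (PCheck x e a) = {}"

text \<open>Registers 0, 1, 2 and the counters of enclosing loops are write-protected. Hence the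
  \<open>While\<close> of a compiled loop, which rereads its bound in each round, makes as many
  rounds as \<open>den\<close>, which reads it once, and \<open>cost\<close> may be evaluated at the
  initial dimensions throughout.\<close>

primrec wf_prog :: "prog \<Rightarrow> bool" where
  "wf_prog PSkip = True"
| "wf_prog (PAssign x e) = (2 < x)"
| "wf_prog (PStore a e e') = True"
| "wf_prog (p ;; q) = (wf_prog p \<and> wf_prog q)"
| "wf_prog (PIf e p q) = (wf_prog p \<and> wf_prog q)"
| "wf_prog (PFor x r p) = (wf_prog p \<and> 2 < x \<and> x \<notin> wregs p \<and> r \<le> 2)"
| "wf_prog (PAuth x e e') = (2 < x)"
| "wf_prog (PCheck x e a) = (2 < x)"

lemma wf_prog_wregs: "wf_prog p \<Longrightarrow> x \<in> wregs p \<Longrightarrow> 2 < x"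
  by (induction p) auto

section \<open>Frame conditions and the invariant rule for loops\<close>

definition agree_off :: "nat set \<Rightarrow> nat set \<Rightarrow> state \<Rightarrow> state \<Rightarrow> bool" where
  "agree_off X Y \<sigma> \<sigma>' \<longleftrightarrow>
     (\<forall>x. x \<notin> X \<longrightarrow> fst \<sigma>' x = fst \<sigma> x) \<and> (\<forall>a. a \<notin> Y \<longrightarrow> snd \<sigma>' a = snd \<sigma> a)"

lemma agree_off_refl [simp]: "agree_off X Y \<sigma> \<sigma>"
  by (simp add: agree_off_def)

lemma agree_off_trans:
  "agree_off X Y \<sigma> \<sigma>' \<Longrightarrow> agree_off X' Y' \<sigma>' \<sigma>'' \<Longrightarrow> X \<subseteq> Z \<Longrightarrow> X' \<subseteq> Z \<Longrightarrow> Y \<subseteq> V \<Longrightarrow> Y' \<subseteq> V \<Longrightarrow>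
   agree_off Z V \<sigma> \<sigma>''"
  unfolding agree_off_def by (metis subsetD)

lemma agree_off_mono: "agree_off X Y \<sigma> \<sigma>' \<Longrightarrow> X \<subseteq> Z \<Longrightarrow> Y \<subseteq> V \<Longrightarrow> agree_off Z V \<sigma> \<sigma>'"
  unfolding agree_off_def by blast

lemma agree_off_set_reg: "agree_off {x} {} \<sigma> (set_reg x v \<sigma>)"
  by (simp add: agree_off_def set_reg_def)

lemma agree_off_den: "agree_off (wregs p) (warrs p) \<sigma> (den Q p \<sigma>)"
proof (induction p arbitrary: \<sigma>)
  case (PSeq p q)
  show ?case
    by (simp, rule agree_off_trans[OF PSeq.IH(1) PSeq.IH(2)]) auto
next
  case (PIf e p q)
  show ?case
    using agree_off_mono[OF PIf.IH(1)[of \<sigma>]] agree_off_mono[OF PIf.IH(2)[of \<sigma>]] by simp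
next
  case (PFor x r p)
  let ?f = "\<lambda>\<sigma>. set_reg x (Suc (fst (den Q p \<sigma>) x)) (den Q p \<sigma>)"
  have "agree_off (insert x (wregs p)) (warrs p) \<sigma> ((?f ^^ i) (set_reg x 0 \<sigma>))" for i
  proof (induction i)
    case 0
    show ?case by (simp add: agree_off_def set_reg_def)
  next
    case (Suc i)
    have "agree_off (insert x (wregs p)) (warrs p) \<tau> (?f \<tau>)" for \<tau>
      by (rule agree_off_trans[OF PFor.IH agree_off_set_reg]) auto
    from agree_off_trans[OF Suc.IH this order_refl order_refl order_refl order_refl]
    show ?case by simp
  qed
  then show ?case by simp
qed (auto simp: agree_off_def set_reg_def set_cell_def)

lemma den_reg: "x \<notin> wregs p \<Longrightarrow> fst (den Q p \<sigma>) x = fst \<sigma> x"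
  using agree_off_den[of p \<sigma> Q] by (simp add: agree_off_def)

lemma den_dims: "wf_prog p \<Longrightarrow> r \<le> 2 \<Longrightarrow> fst (den Q p \<sigma>) r = fst \<sigma> r"
  using wf_prog_wregs by (intro den_reg) force

lemma den_arr: "a \<notin> warrs p \<Longrightarrow> snd (den Q p \<sigma>) a = snd \<sigma> a"
  using agree_off_den[of p \<sigma> Q] by (simp add: agree_off_def)

lemma set_reg_simps [simp]:
  "fst (set_reg x v \<sigma>) = (fst \<sigma>)(x := v)" "snd (set_reg x v \<sigma>) = snd \<sigma>"
  "fst (set_cell a i v \<sigma>) = fst \<sigma>" "snd (set_cell a i v \<sigma>) = (snd \<sigma>)(a := (snd \<sigma> a)(i := v))"
  by (simp_all add: set_reg_def set_cell_def)

text \<open>The step case also receives the frame fact relative to the state before the loop, so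
  that invariants need to mention only data that change.\<close>

lemma den_for:
  assumes "x \<notin> wregs p" "r \<notin> insert x (wregs p)"
    and start: "I 0 (set_reg x 0 \<sigma>)"
    and step: "\<And>i \<sigma>'. i < fst \<sigma> r \<Longrightarrow> I i \<sigma>' \<Longrightarrow> fst \<sigma>' x = i \<Longrightarrow>
      agree_off (insert x (wregs p)) (warrs p) \<sigma> \<sigma>' \<Longrightarrow> I (Suc i) (set_reg x (Suc i) (den Q p \<sigma>'))"
  shows "I (fst \<sigma> r) (den Q (PFor x r p) \<sigma>)"
proof -
  let ?f = "\<lambda>\<sigma>. set_reg x (Suc (fst (den Q p \<sigma>) x)) (den Q p \<sigma>)"
  have "i \<le> fst \<sigma> r \<Longrightarrow> (let \<sigma>' = (?f ^^ i) (set_reg x 0 \<sigma>) in I i \<sigma>' \<and> fst \<sigma>' x = i \<and>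
      agree_off (insert x (wregs p)) (warrs p) \<sigma> \<sigma>')" for i
  proof (induction i)
    case 0
    then show ?case using start by (simp add: agree_off_def)
  next
    case (Suc i)
    define \<tau> where "\<tau> = (?f ^^ i) (set_reg x 0 \<sigma>)"
    have \<tau>: "I i \<tau>" "fst \<tau> x = i" "agree_off (insert x (wregs p)) (warrs p) \<sigma> \<tau>"
      using Suc by (simp_all add: \<tau>_def Let_def)
    have eq: "?f \<tau> = set_reg x (Suc i) (den Q p \<tau>)"
      using \<tau>(2) assms(1) by (simp add: den_reg)
    have "agree_off (insert x (wregs p)) (warrs p) \<tau> (?f \<tau>)"
      by (rule agree_off_trans[OF agree_off_den agree_off_set_reg]) auto
    then have "agree_off (insert x (wregs p)) (warrs p) \<sigma> (?f \<tau>)"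
      by (auto intro: agree_off_trans[OF \<tau>(3)])
    moreover have "I (Suc i) (?f \<tau>)"
      unfolding eq by (rule step) (use \<tau> Suc.prems in simp_all)
    ultimately show ?case
      using eq by (simp add: \<tau>_def Let_def)
  qed
  from this[of "fst \<sigma> r"] show ?thesis by (simp add: Let_def)
qed

section \<open>Running time of loop programs\<close>

primrec cost :: "prog \<Rightarrow> (nat \<Rightarrow> real) \<Rightarrow> real \<Rightarrow> real" where
  "cost PSkip N \<tau> = 1"
| "cost (PAssign x e) N \<tau> = 1 + real (exp_time e)"
| "cost (PStore a e e') N \<tau> = 1 + real (exp_time e) + real (exp_time e')"
| "cost (p ;; q) N \<tau> = 1 + cost p N \<tau> + cost q N \<tau>"
| "cost (PIf e p q) N \<tau> = 1 + real (exp_time e) + (cost p N \<tau> + cost q N \<tau>)"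
| "cost (PFor x r p) N \<tau> = 7 + N r * (9 + cost p N \<tau>)"
| "cost (PAuth x e e') N \<tau> = 1 + real (exp_time e) + real (exp_time e') + \<tau>"
| "cost (PCheck x e a) N \<tau> = 1 + real (exp_time e) + \<tau>"

lemma cost_nonneg: "(\<And>r. 0 \<le> N r) \<Longrightarrow> 0 \<le> \<tau> \<Longrightarrow> 0 \<le> cost p N \<tau>"
  by (induction p) auto

lemma cost_mono: "(\<And>r. 0 \<le> N r) \<Longrightarrow> \<tau> \<le> \<tau>' \<Longrightarrow> cost p N \<tau> \<le> cost p N \<tau>'"
  by (induction p) (auto intro: mult_left_mono add_mono)

lemma cost_cong: "wf_prog p \<Longrightarrow> (\<And>r. r \<le> 2 \<Longrightarrow> N r = N' r) \<Longrightarrow> cost p N \<tau> = cost p N' \<tau>"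
  by (induction p) auto

definition dims :: "nat \<Rightarrow> nat \<Rightarrow> nat \<Rightarrow> nat \<Rightarrow> real" where
  "dims n k m r = (if r = 0 then real n else if r = 1 then real k else real m)"

lemma dims_nonneg: "0 \<le> dims n k m r"
  by (simp add: dims_def)

text \<open>\<open>cost\<close> adds the two branches of a conditional instead of taking their
  maximum, so it is built from sums and products only; nested loops contribute products of
  dimensions.\<close>

lemma polynomial3_cost:
  assumes "polynomial3 f"
  shows "polynomial3 (\<lambda>n k m. cost p (dims n k m) (f n k m))"
proof (induction p)
  case (PFor x r p)
  have "polynomial3 (\<lambda>n k m. dims n k m r)"
    by (cases "r = 0"; cases "r = 1") (simp_all add: dims_def polynomial3.intros)
  then show ?case using PFor by (simp add: polynomial3.intros)
qed (use assms in \<open>simp_all add: polynomial3.intros\<close>)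

text \<open>The constants of \<open>cost\<close> for a loop: 7 is resetting the counter (2),
  sequencing (1) and the last, failing test (4); 9 is a successful test (4), sequencing (1) and the
  increment (4).\<close>

lemma exec_compile:
  "wf_prog p \<Longrightarrow> \<exists>t. exec Q (compile p) \<sigma> t (den Q p \<sigma>) \<and>
     real t \<le> cost p (\<lambda>r. real (fst \<sigma> r)) (real (query_time Q))"
proof (induction p arbitrary: \<sigma>)
  case PSkip
  show ?case using exec.Skip[of Q \<sigma>] by force
next
  case (PAssign x e)
  show ?case using exec.Assign[of Q x e \<sigma>] by force
next
  case (PStore a e e')
  show ?case using exec.Store[of Q a e e' \<sigma>] by force
next
  case (PAuth x e e')
  show ?case using exec.AuthQ[of Q x e e' \<sigma>] by force
next
  case (PCheck x e a)
  show ?case using exec.CheckQ[of Q x e a \<sigma>] by force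
next
  case (PSeq p q)
  let ?N = "\<lambda>\<sigma>::state. \<lambda>r. real (fst \<sigma> r)"
  obtain t where t: "exec Q (compile p) \<sigma> t (den Q p \<sigma>)"
      "real t \<le> cost p (?N \<sigma>) (real (query_time Q))"
    using PSeq.IH(1)[of \<sigma>] PSeq.prems by auto
  obtain t' where t': "exec Q (compile q) (den Q p \<sigma>) t' (den Q q (den Q p \<sigma>))"
      "real t' \<le> cost q (?N (den Q p \<sigma>)) (real (query_time Q))"
    using PSeq.IH(2)[of "den Q p \<sigma>"] PSeq.prems by auto
  have "cost q (?N (den Q p \<sigma>)) (real (query_time Q)) = cost q (?N \<sigma>) (real (query_time Q))"
    by (rule cost_cong) (use PSeq.prems in \<open>simp_all add: den_dims\<close>)
  then show ?case using exec.Seq[OF t(1) t'(1)] t(2) t'(2) by force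
next
  case (PIf e p q)
  let ?c = "\<lambda>p. cost p (\<lambda>r. real (fst \<sigma> r)) (real (query_time Q))"
  have nn: "0 \<le> ?c p" "0 \<le> ?c q" by (auto intro: cost_nonneg)
  show ?case
  proof (cases "eval_exp e \<sigma> = 0")
    case True
    obtain t where t: "exec Q (compile q) \<sigma> t (den Q q \<sigma>)" "real t \<le> ?c q"
      using PIf.IH(2)[of \<sigma>] PIf.prems by auto
    show ?thesis using exec.If_False[OF True t(1), of "compile p"] t(2) nn True by force
  next
    case False
    obtain t where t: "exec Q (compile p) \<sigma> t (den Q p \<sigma>)" "real t \<le> ?c p"
      using PIf.IH(1)[of \<sigma>] PIf.prems by auto
    show ?thesis using exec.If_True[OF False t(1), of "compile q"] t(2) nn False by force
  qed
next
  case (PFor x r p)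
  let ?f = "\<lambda>\<sigma>. set_reg x (Suc (fst (den Q p \<sigma>) x)) (den Q p \<sigma>)"
  let ?w = "While (Sub (Reg r) (Reg x)) (Seq (compile p) (Assign x (Add (Reg x) (Const 1))))"
  let ?c = "cost p (\<lambda>r. real (fst \<sigma> r)) (real (query_time Q))"
  have wf: "wf_prog p" "2 < x" "x \<notin> wregs p" "r \<le> 2" using PFor.prems by auto
  \<comment> \<open>Induction on the number \<open>j\<close> of rounds still to come, from an
    arbitrary state, because \<open>While_True\<close> peels off the first round and not the
    last.\<close>
  have loop: "\<lbrakk>\<forall>y\<le>2. fst \<tau> y = fst \<sigma> y; fst \<tau> x + j = fst \<sigma> r\<rbrakk> \<Longrightarrow>
     \<exists>t. exec Q ?w \<tau> t ((?f ^^ j) \<tau>) \<and> real t \<le> 4 + real j * (9 + ?c)" for j \<tau>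
  proof (induction j arbitrary: \<tau>)
    case 0
    then have "eval_exp (Sub (Reg r) (Reg x)) \<tau> = 0" using wf by simp
    from exec.While_False[OF this] show ?case by force
  next
    case (Suc j)
    have ne: "eval_exp (Sub (Reg r) (Reg x)) \<tau> \<noteq> 0" using wf Suc.prems by simp
    obtain t where t: "exec Q (compile p) \<tau> t (den Q p \<tau>)"
        "real t \<le> cost p (\<lambda>r. real (fst \<tau> r)) (real (query_time Q))"
      using PFor.IH wf by blast
    have eq: "cost p (\<lambda>r. real (fst \<tau> r)) (real (query_time Q)) = ?c"
      by (rule cost_cong) (use wf Suc.prems in simp_all)
    have b: "exec Q (Seq (compile p) (Assign x (Add (Reg x) (Const 1)))) \<tau> (1 + t + 4) (?f \<tau>)"
      using exec.Seq[OF t(1) exec.Assign[of Q x "Add (Reg x) (Const 1)"]]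
      by (simp add: eval_nat_numeral)
    have "\<forall>y\<le>2. fst (?f \<tau>) y = fst \<sigma> y"
      using wf Suc.prems(1) by (auto simp: den_dims)
    moreover have "fst (?f \<tau>) x + j = fst \<sigma> r" using wf Suc.prems by (simp add: den_reg)
    ultimately obtain t' where t': "exec Q ?w (?f \<tau>) t' ((?f ^^ j) (?f \<tau>))"
        "real t' \<le> 4 + real j * (9 + ?c)"
      using Suc.IH by blast
    have "(?f ^^ Suc j) \<tau> = (?f ^^ j) (?f \<tau>)" by (simp only: funpow_Suc_right o_apply)
    then have "exec Q ?w \<tau> (9 + t + t') ((?f ^^ Suc j) \<tau>)"
      using exec.While_True[OF ne b t'(1)] by (simp add: add.commute add.left_commute)
    moreover have "real (9 + t + t') \<le> 4 + real (Suc j) * (9 + ?c)"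
      using t(2) t'(2) eq by (simp add: algebra_simps)
    ultimately show ?case by blast
  qed
  obtain t where t: "exec Q ?w (set_reg x 0 \<sigma>) t ((?f ^^ fst \<sigma> r) (set_reg x 0 \<sigma>))"
      "real t \<le> 4 + real (fst \<sigma> r) * (9 + ?c)"
    using loop[of "set_reg x 0 \<sigma>" "fst \<sigma> r"] wf by auto
  have "exec Q (compile (PFor x r p)) \<sigma> (3 + t) (den Q (PFor x r p) \<sigma>)"
    using exec.Seq[OF exec.Assign[of Q x "Const 0" \<sigma>], unfolded eval_exp.simps, OF t(1)]
    by (simp add: eval_nat_numeral)
  then show ?case using t(2) by force
qed

text \<open>At least one of the truncated differences is 0, so the sum is the distance of the two
  values; nonzero means true.\<close>

definition neq_exp :: "exp \<Rightarrow> exp \<Rightarrow> exp" where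
  "neq_exp e e' = Add (Sub e e') (Sub e' e)"

definition eq_exp :: "exp \<Rightarrow> exp \<Rightarrow> exp" where
  "eq_exp e e' = Sub (Const 1) (neq_exp e e')"

text \<open>This computes the minimum of the two values.\<close>

definition conj_exp :: "exp \<Rightarrow> exp \<Rightarrow> exp" where
  "conj_exp e e' = Sub e (Sub e e')"

lemma test_exp_simps [simp]:
  "(eval_exp (neq_exp e e') \<sigma> = 0) = (eval_exp e \<sigma> = eval_exp e' \<sigma>)"
  "(eval_exp (eq_exp e e') \<sigma> = 0) = (eval_exp e \<sigma> \<noteq> eval_exp e' \<sigma>)"
  "(eval_exp (conj_exp e e') \<sigma> = 0) = (eval_exp e \<sigma> = 0 \<or> eval_exp e' \<sigma> = 0)"
  by (auto simp: neq_exp_def eq_exp_def conj_exp_def)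

section \<open>Bipartite matching by an auction\<close>

definition matching :: "(nat \<Rightarrow> nat \<Rightarrow> bool) \<Rightarrow> nat set \<Rightarrow> nat \<Rightarrow> (nat \<Rightarrow> nat) \<Rightarrow> bool" where
  "matching E L n f \<longleftrightarrow> inj_on f L \<and> (\<forall>a\<in>L. f a < n \<and> E a (f a))"

text \<open>An unmatched bidder has mate \<open>n\<close>; the numbers outside \<open>L\<close> are marked by mate \<open>n + 1\<close>.\<close>

definition auction_inv ::
  "(nat \<Rightarrow> nat \<Rightarrow> bool) \<Rightarrow> nat set \<Rightarrow> nat \<Rightarrow> nat \<Rightarrow> (nat \<Rightarrow> nat) \<Rightarrow> (nat \<Rightarrow> nat) \<Rightarrow> bool" where
  "auction_inv E L n k mate price \<longleftrightarrow>
     (\<forall>a<k. if a \<in> L then mate a \<le> n else mate a = Suc n) \<and>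
     (\<forall>a<k. mate a < n \<longrightarrow> E a (mate a)) \<and>
     inj_on mate {a. a < k \<and> mate a < n} \<and>
     (\<forall>b<n. 0 < price b \<longrightarrow> (\<exists>a<k. mate a = b)) \<and>
     (\<forall>a<k. \<forall>b<n. mate a < n \<longrightarrow> E a b \<longrightarrow> price (mate a) \<le> price b + 1)"

text \<open>Otherwise some price \<open>v\<close> between 1 and \<open>k\<close> is not taken, and the bidders holding an item of
  price above \<open>v\<close>, together with \<open>a\<close>, only like the items of price above \<open>v\<close>, which are
  one too few.\<close>

lemma auction_cheap_item:
  assumes inv: "auction_inv E L n k mate price" and M: "matching E L n M"
    and L: "L \<subseteq> {..<k}" and a: "a \<in> L" "mate a = n"
  shows "\<exists>b<n. E a b \<and> price b < k"
proof (rule ccontr)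
  assume "\<not> ?thesis"
  then have high: "k \<le> price b" if "b < n" "E a b" for b using that by force
  define X where "X = {x \<in> L. mate x < n}"
  have fin: "finite L" using L finite_subset by blast
  \<comment> \<open>Pigeonhole for the missing price: \<open>a\<close> is unmatched, so fewer than
    \<open>k\<close> bidders hold an item and the held items cannot show all prices from 1 to
    \<open>k\<close>.\<close>
  have "card (mate ` X) \<le> card X" by (rule card_image_le) (simp add: X_def fin)
  also have "card X < card L" using a fin by (intro psubset_card_mono) (auto simp: X_def)
  also have "card L \<le> k" using card_mono[OF _ L] by simp
  finally have "card (price ` mate ` X) < k"
    using card_image_le[of "mate ` X" price] fin by (simp add: X_def)
  then have "\<not> {1..k} \<subseteq> price ` mate ` X"
    using card_mono[of "price ` mate ` X" "{1..k}"] fin by (auto simp: X_def)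
  then obtain v where "v \<in> {1..k}" and v3: "v \<notin> price ` mate ` X" by blast
  then have v: "1 \<le> v" "v \<le> k" by simp_all
  define A where "A = {x \<in> X. v < price (mate x)}"
  have notin: "a \<notin> A" using a by (simp add: A_def X_def)
  have finA: "finite A" using fin by (simp add: A_def X_def)
  \<comment> \<open>The slack of 1 in the invariant only gives that \<open>M x\<close> costs at
    least \<open>v\<close>. But then its price is positive, so it is held, and \<open>v\<close> is
    not the price of a held item; hence the price exceeds \<open>v\<close> and the holder lies in
    \<open>A\<close>.\<close>
  have "M x \<in> mate ` A" if x: "x \<in> insert a A" for x
  proof -
    have xL: "x \<in> L" using x a by (auto simp: A_def X_def)
    have Mx: "M x < n" "E x (M x)" using M xL by (auto simp: matching_def)
    have "v \<le> price (M x)"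
    proof (cases "x = a")
      case True
      then show ?thesis using high Mx v by force
    next
      case False
      then have "mate x < n" "v < price (mate x)" "x < k" using x xL L by (auto simp: A_def X_def)
      moreover have "price (mate x) \<le> price (M x) + 1"
        using inv Mx calculation unfolding auction_inv_def by blast
      ultimately show ?thesis by simp
    qed
    moreover from this v have "0 < price (M x)" by simp
    then obtain y where y: "y < k" "mate y = M x" using inv Mx unfolding auction_inv_def by blast
    then have "y \<in> X" using inv Mx unfolding auction_inv_def X_def by (auto split: if_splits)
    moreover have "v \<noteq> price (M x)" using v3 y \<open>y \<in> X\<close> by force
    ultimately show ?thesis using y by (force simp: A_def)
  qed
  then have "M ` insert a A \<subseteq> mate ` A" by blast
  moreover have "inj_on M (insert a A)"
    by (rule inj_on_subset[of M L]) (use M a in \<open>auto simp: matching_def A_def X_def\<close>)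
  ultimately have "card (insert a A) \<le> card (mate ` A)"
    using finA by (metis card_image card_mono finite_imageI)
  also have "\<dots> \<le> card A" using finA by (rule card_image_le)
  finally show False using notin finA by simp
qed

text \<open>The last clause of \<open>auction_inv\<close> is the slackness condition of auctions
  with increment 1. It holds for the winner because \<open>b\<close> was its cheapest item, and for
  the others because prices on the right-hand side only rise. The evicted bidder becomes unmatched,
  but \<open>b\<close> remains held. \<open>mate'\<close> and \<open>price'\<close> are constrained
  only in range, since they will be machine arrays.\<close>

lemma auction_bid:
  assumes inv: "auction_inv E L n k mate price"
    and a: "a < k" "mate a = n" and b: "b < n" "E a b"
    and cheapest: "\<And>c. c < n \<Longrightarrow> E a c \<Longrightarrow> price b \<le> price c"
    and mate': "\<And>x. x < k \<Longrightarrow> mate' x = (if x = a then b else if mate x = b then n else mate x)"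
    and price': "\<And>x. x < n \<Longrightarrow> price' x = (if x = b then Suc (price b) else price x)"
  shows "auction_inv E L n k mate' price'"
proof -
  have d1: "if x \<in> L then mate x \<le> n else mate x = Suc n" if "x < k" for x
    using inv that unfolding auction_inv_def by blast
  have d2: "E x (mate x)" if "x < k" "mate x < n" for x
    using inv that unfolding auction_inv_def by blast
  have d3: "x = y" if "x < k" "y < k" "mate x < n" "mate x = mate y" for x y
    using inv that unfolding auction_inv_def inj_on_def by force
  have d4: "\<exists>y<k. mate y = x" if "x < n" "0 < price x" for x
    using inv that unfolding auction_inv_def by blast
  have d5: "price (mate x) \<le> price c + 1" if "x < k" "c < n" "mate x < n" "E x c" for x c
    using inv that unfolding auction_inv_def by blast
  have 1: "\<forall>x<k. if x \<in> L then mate' x \<le> n else mate' x = Suc n"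
  proof (intro allI impI)
    fix x assume x: "x < k"
    show "if x \<in> L then mate' x \<le> n else mate' x = Suc n"
      using mate'[OF x] a b d1[OF x] by (auto split: if_splits)
  qed
  have 2: "\<forall>x<k. mate' x < n \<longrightarrow> E x (mate' x)"
  proof (intro allI impI)
    fix x assume "x < k" "mate' x < n"
    then show "E x (mate' x)" using mate'[of x] d2[of x] b by (auto split: if_splits)
  qed
  have 3: "inj_on mate' {x. x < k \<and> mate' x < n}"
  proof (rule inj_onI)
    fix x y assume "x \<in> {x. x < k \<and> mate' x < n}" "y \<in> {x. x < k \<and> mate' x < n}" "mate' x = mate' y"
    then show "x = y" using mate'[of x] mate'[of y] d3[of x y] by (auto split: if_splits)
  qed
  have 4: "\<forall>x<n. 0 < price' x \<longrightarrow> (\<exists>y<k. mate' y = x)"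
  proof (intro allI impI)
    fix x assume x: "x < n" "0 < price' x"
    show "\<exists>y<k. mate' y = x"
    proof (cases "x = b")
      case True
      then show ?thesis using a mate'[of a] by (intro exI[of _ a]) simp
    next
      case False
      then have "0 < price x" using x price'[of x] by simp
      then obtain y where "y < k" "mate y = x" using d4 x by blast
      then show ?thesis using x False a mate'[of y] by (intro exI[of _ y]) auto
    qed
  qed
  have 5: "\<forall>x<k. \<forall>c<n. mate' x < n \<longrightarrow> E x c \<longrightarrow> price' (mate' x) \<le> price' c + 1"
  proof (intro allI impI)
    fix x c assume x: "x < k" "c < n" "mate' x < n" "E x c"
    have pc: "price c \<le> price' c" using price' x by auto
    show "price' (mate' x) \<le> price' c + 1"
    proof (cases "x = a")
      case True
      then show ?thesis using cheapest[of c] x pc mate'[of x] price'[of b] b by auto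
    next
      case False
      then have m: "mate' x = mate x" "mate x \<noteq> b" using mate' x by (auto split: if_splits)
      then have "price (mate x) \<le> price c + 1" using d5 x by simp
      then show ?thesis using m price'[of "mate x"] x pc by simp
    qed
  qed
  show ?thesis unfolding auction_inv_def using 1 2 3 4 5 by blast
qed

text \<open>While a bidder is unmatched, each of the \<open>t\<close> bids has raised the sum of the prices by one.\<close>

definition auction_progress ::
  "(nat \<Rightarrow> nat \<Rightarrow> bool) \<Rightarrow> nat set \<Rightarrow> nat \<Rightarrow> nat \<Rightarrow> nat \<Rightarrow> (nat \<Rightarrow> nat) \<Rightarrow> (nat \<Rightarrow> nat) \<Rightarrow> bool" where
  "auction_progress E L n k t mate price \<longleftrightarrow> auction_inv E L n k mate price \<and>
     ((\<exists>M. matching E L n M) \<longrightarrow>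
        (\<forall>b<n. price b \<le> k) \<and> ((\<exists>a<k. mate a = n) \<longrightarrow> t \<le> sum price {..<n}))"

lemma auction_progress_init:
  assumes "\<And>a. a < k \<Longrightarrow> mate a = (if a \<in> L then n else Suc n)" "\<And>b. b < n \<Longrightarrow> price b = 0"
  shows "auction_progress E L n k 0 mate price"
  using assms unfolding auction_progress_def auction_inv_def inj_on_def by auto

lemma auction_progress_matched:
  assumes "auction_progress E L n k t mate price" "\<And>a. a < k \<Longrightarrow> mate a \<noteq> n"
  shows "auction_progress E L n k (Suc t) mate price"
  using assms unfolding auction_progress_def by blast

lemma auction_bidder_in:
  assumes "auction_inv E L n k mate price" "a < k" "mate a = n"
  shows "a \<in> L"
proof (rule ccontr)
  assume "a \<notin> L"
  then have "mate a = Suc n" using assms(1,2) unfolding auction_inv_def by metis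
  then show False using assms(3) by simp
qed

text \<open>A bidder that likes no item rules out a matching, so the conditional part of
  \<open>auction_progress\<close> is vacuous from then on and idle rounds do no harm.\<close>

lemma auction_progress_stuck:
  assumes "auction_progress E L n k t mate price" "L \<subseteq> {..<k}" "a < k" "mate a = n"
    "\<And>b. b < n \<Longrightarrow> \<not> E a b"
  shows "auction_progress E L n k (Suc t) mate price"
proof -
  have inv: "auction_inv E L n k mate price" using assms(1) by (simp add: auction_progress_def)
  have "\<not> matching E L n M" for M
    using auction_cheap_item[OF inv _ assms(2) auction_bidder_in[OF inv assms(3,4)] assms(4)] assms(5)
    by blast
  then show ?thesis using inv by (simp add: auction_progress_def)
qed

text \<open>If a matching exists, \<open>auction_cheap_item\<close> provides a liked item of price
  below \<open>k\<close>; the cheapest one is no dearer, so its raised price is still at most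
  \<open>k\<close>, and the sum of the prices grows by exactly one.\<close>

lemma auction_progress_bid:
  assumes prog: "auction_progress E L n k t mate price" and L: "L \<subseteq> {..<k}"
    and a: "a < k" "mate a = n" and b: "b < n" "E a b"
    and cheapest: "\<And>c. c < n \<Longrightarrow> E a c \<Longrightarrow> price b \<le> price c"
    and mate': "\<And>x. x < k \<Longrightarrow> mate' x = (if x = a then b else if mate x = b then n else mate x)"
    and price': "\<And>x. x < n \<Longrightarrow> price' x = (if x = b then Suc (price b) else price x)"
  shows "auction_progress E L n k (Suc t) mate' price'"
proof -
  have inv: "auction_inv E L n k mate price" using prog by (simp add: auction_progress_def)
  have inv': "auction_inv E L n k mate' price'"
    by (rule auction_bid[OF inv a b cheapest mate' price'])
  have "(\<forall>c<n. price' c \<le> k) \<and> Suc t \<le> sum price' {..<n}" if M: "matching E L n M" for M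
  proof
    obtain c where "c < n" "E a c" "price c < k"
      using auction_cheap_item[OF inv M L auction_bidder_in[OF inv a] a(2)] by blast
    then have "price b < k" using cheapest[of c] by simp
    then show "\<forall>c<n. price' c \<le> k" using prog M price' by (auto simp: auction_progress_def)
    have "sum price' {..<n} = Suc (price b) + sum price ({..<n} - {b})"
      using b price' by (subst sum.remove[of _ b]) (auto intro!: sum.cong)
    also have "\<dots> = Suc (sum price {..<n})"
      using b by (subst sum.remove[of "{..<n}" b price]) auto
    finally show "Suc t \<le> sum price' {..<n}"
      using prog M a by (auto simp: auction_progress_def)
  qed
  then show ?thesis using inv' by (auto simp: auction_progress_def)
qed

text \<open>This fixes the number of rounds: were a bidder still unmatched after
  \<open>n * k\<close> rounds although a matching exists, then \<open>n\<close> prices, each at most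
  \<open>k\<close>, would sum to at least \<open>n * k\<close>, while
  \<open>auction_cheap_item\<close> yields one below \<open>k\<close>.\<close>

lemma auction_finished:
  assumes prog: "auction_progress E L n k (n * k) mate price" and L: "L \<subseteq> {..<k}"
  shows "(\<forall>a<k. mate a \<noteq> n) \<longleftrightarrow> (\<exists>M. matching E L n M)"
    and "(\<forall>a<k. mate a \<noteq> n) \<Longrightarrow> matching E L n mate"
proof -
  have inv: "auction_inv E L n k mate price" using prog by (simp add: auction_progress_def)
  show matched: "matching E L n mate" if all: "\<forall>a<k. mate a \<noteq> n"
  proof -
    have lt: "mate a < n \<and> a < k" if aL: "a \<in> L" for a
    proof -
      have ak: "a < k" using aL L by auto
      then have "if a \<in> L then mate a \<le> n else mate a = Suc n"
        using inv unfolding auction_inv_def by blast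
      moreover have "mate a \<noteq> n" using all ak by blast
      ultimately show ?thesis using aL ak by simp
    qed
    have "L \<subseteq> {a. a < k \<and> mate a < n}" using lt by blast
    then have "inj_on mate L" using inv inj_on_subset unfolding auction_inv_def by blast
    moreover have "E a (mate a)" if "a \<in> L" for a
      using inv lt[OF that] unfolding auction_inv_def by blast
    ultimately show ?thesis using lt by (simp add: matching_def)
  qed
  have "mate a \<noteq> n" if M: "matching E L n M" and a: "a < k" for M a
  proof
    assume n: "mate a = n"
    obtain b where b: "b < n" "price b < k"
      using auction_cheap_item[OF inv M L auction_bidder_in[OF inv a n] n] by blast
    have le: "\<forall>b<n. price b \<le> k" "n * k \<le> sum price {..<n}"
      using prog M a n unfolding auction_progress_def by blast+
    have "sum price {..<n} < sum (\<lambda>_. k) {..<n}"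
      by (rule sum_strict_mono_ex1) (use b le(1) in auto)
    then show False using le by simp
  qed
  then show "(\<forall>a<k. mate a \<noteq> n) \<longleftrightarrow> (\<exists>M. matching E L n M)" using matched by blast
qed

section \<open>The auction as a loop program\<close>

text \<open>Registers: \<open>z + 2\<close> and \<open>z + 3\<close> scan bidders and items, \<open>z + 4\<close> is the current bidder, \<open>z + 5\<close>
  its best item, \<open>z + 6\<close> the verdict. Arrays: \<open>z\<close> holds the mates and \<open>z + 1\<close> the prices. The
  command \<open>adj\<close> decides in register \<open>e\<close> whether bidder \<open>z + 4\<close> likes item \<open>z + 3\<close>.\<close>

definition auction_init :: "nat \<Rightarrow> exp \<Rightarrow> prog" where
  "auction_init z left =
     PFor (z + 3) 0 (PStore (z + 1) (Reg (z + 3)) (Const 0)) ;;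
     PFor (z + 2) 1 (PIf left (PStore z (Reg (z + 2)) (Reg 0))
                               (PStore z (Reg (z + 2)) (Add (Reg 0) (Const 1))))"

text \<open>The value \<open>k\<close> in register \<open>z + 4\<close>, like the value
  \<open>n\<close> in register \<open>z + 5\<close> of \<open>auction_choose\<close>, means that
  none was found. Bidders outside \<open>L\<close> carry mate \<open>n + 1\<close> and are never
  selected.\<close>

definition auction_select :: "nat \<Rightarrow> prog" where
  "auction_select z =
     PAssign (z + 4) (Reg 1) ;;
     PFor (z + 2) 1 (PIf (neq_exp (Cell z (Reg (z + 2))) (Reg 0)) PSkip
                       (PAssign (z + 4) (Reg (z + 2))))"

definition auction_choose :: "nat \<Rightarrow> prog \<Rightarrow> nat \<Rightarrow> prog" where
  "auction_choose z adj e =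
     PAssign (z + 5) (Reg 0) ;;
     PFor (z + 3) 0 (adj ;;
       PIf (Reg e)
         (PIf (Sub (Reg 0) (Reg (z + 5)))
            (PIf (Sub (Cell (z + 1) (Reg (z + 5))) (Cell (z + 1) (Reg (z + 3))))
               (PAssign (z + 5) (Reg (z + 3))) PSkip)
            (PAssign (z + 5) (Reg (z + 3))))
         PSkip)"

text \<open>The old holder has to be evicted before the winner is entered, otherwise the scan would
  evict the winner too.\<close>

definition auction_assign :: "nat \<Rightarrow> prog" where
  "auction_assign z =
     PFor (z + 2) 1 (PIf (neq_exp (Cell z (Reg (z + 2))) (Reg (z + 5))) PSkip
                       (PStore z (Reg (z + 2)) (Reg 0))) ;;
     PStore z (Reg (z + 4)) (Reg (z + 5)) ;;
     PStore (z + 1) (Reg (z + 5)) (Add (Cell (z + 1) (Reg (z + 5))) (Const 1))"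

definition auction_round :: "nat \<Rightarrow> prog \<Rightarrow> nat \<Rightarrow> prog" where
  "auction_round z adj e =
     auction_select z ;;
     PIf (Sub (Reg 1) (Reg (z + 4)))
       (auction_choose z adj e ;; PIf (Sub (Reg 0) (Reg (z + 5))) (auction_assign z) PSkip)
       PSkip"

definition auction_verdict :: "nat \<Rightarrow> prog" where
  "auction_verdict z =
     PAssign (z + 6) (Const 1) ;;
     PFor (z + 2) 1 (PIf (neq_exp (Cell z (Reg (z + 2))) (Reg 0)) PSkip
                       (PAssign (z + 6) (Const 0)))"

text \<open>The machine has no multiplication, so the \<open>n * k\<close> rounds are two nested
  loops over input registers.\<close>

definition auction :: "nat \<Rightarrow> exp \<Rightarrow> prog \<Rightarrow> nat \<Rightarrow> prog" where
  "auction z left adj e =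
     auction_init z left ;; PFor z 0 (PFor (z + 1) 1 (auction_round z adj e)) ;; auction_verdict z"

lemmas auction_defs = auction_def auction_init_def auction_select_def auction_choose_def
  auction_assign_def auction_round_def auction_verdict_def

lemma wregs_auction: "wregs (auction z left adj e) =
    {z, z + 1, z + 2, z + 3, z + 4, z + 5, z + 6} \<union> wregs adj"
  by (auto simp: auction_defs)

lemma warrs_auction: "warrs (auction z left adj e) = {z, z + 1} \<union> warrs adj"
  by (auto simp: auction_defs)

lemma wf_auction:
  "wf_prog adj \<Longrightarrow> 2 < z \<Longrightarrow> wregs adj \<inter> {z..z + 6} = {} \<Longrightarrow> wf_prog (auction z left adj e)"
  by (auto simp: auction_defs)

text \<open>\<open>left\<close> and \<open>adj\<close> have to be right only in states that differ
  from \<open>\<sigma>0\<close> in the scratch space of the auction and of \<open>adj\<close>. Thus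
  \<open>adj\<close> may itself be an auction with registers and arrays of its own, which is how the
  two matchings are nested.\<close>

locale auction_run =
  fixes Q :: queries and z :: nat and left :: exp and adj :: prog and e :: nat
    and E :: "nat \<Rightarrow> nat \<Rightarrow> bool" and L :: "nat set" and \<sigma>0 :: state and n k :: nat
  assumes z: "2 < z" and adj_regs: "wregs adj \<inter> {z..z + 6} = {}"
    and adj_arrs: "warrs adj \<inter> {z, z + 1} = {}"
    and adj_wf: "wf_prog adj"
    and n: "fst \<sigma>0 0 = n" and k: "fst \<sigma>0 1 = k"
    and L: "L \<subseteq> {..<k}"
    and left: "\<And>\<sigma>. agree_off ({z..z + 6} \<union> wregs adj) ({z, z + 1} \<union> warrs adj) \<sigma>0 \<sigma> \<Longrightarrow>
      fst \<sigma> (z + 2) < k \<Longrightarrow> eval_exp left \<sigma> \<noteq> 0 \<longleftrightarrow> fst \<sigma> (z + 2) \<in> L"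
    and adj: "\<And>\<sigma>. agree_off ({z..z + 6} \<union> wregs adj) ({z, z + 1} \<union> warrs adj) \<sigma>0 \<sigma> \<Longrightarrow>
      fst \<sigma> (z + 4) < k \<Longrightarrow> fst \<sigma> (z + 3) < n \<Longrightarrow>
      fst (den Q adj \<sigma>) e \<noteq> 0 \<longleftrightarrow> E (fst \<sigma> (z + 4)) (fst \<sigma> (z + 3))"
begin

definition fr :: "state \<Rightarrow> bool" where
  "fr \<sigma> \<longleftrightarrow> agree_off ({z..z + 6} \<union> wregs adj) ({z, z + 1} \<union> warrs adj) \<sigma>0 \<sigma>"

lemma small_regs: "0 \<notin> wregs adj" "Suc 0 \<notin> wregs adj"
  using wf_prog_wregs[OF adj_wf] by force+

lemma frD: "fr \<sigma> \<Longrightarrow> fst \<sigma> 0 = n" "fr \<sigma> \<Longrightarrow> fst \<sigma> 1 = k" "fr \<sigma> \<Longrightarrow> fst \<sigma> (Suc 0) = k"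
  using z n k small_regs by (auto simp: fr_def agree_off_def)

lemma fr_trans:
  "fr \<sigma> \<Longrightarrow> agree_off X Y \<sigma> \<sigma>' \<Longrightarrow> X \<subseteq> {z..z + 6} \<union> wregs adj \<Longrightarrow> Y \<subseteq> {z, z + 1} \<union> warrs adj \<Longrightarrow> fr \<sigma>'"
  unfolding fr_def by (erule agree_off_trans) auto

lemma fr_den:
  "fr \<sigma> \<Longrightarrow> wregs p \<subseteq> {z..z + 6} \<union> wregs adj \<Longrightarrow> warrs p \<subseteq> {z, z + 1} \<union> warrs adj \<Longrightarrow> fr (den Q p \<sigma>)"
  by (rule fr_trans[OF _ agree_off_den])

lemma fr_set_reg: "fr \<sigma> \<Longrightarrow> x \<in> {z..z + 6} \<Longrightarrow> fr (set_reg x v \<sigma>)"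
  by (rule fr_trans[OF _ agree_off_set_reg]) auto

lemma init_spec:
  assumes "fr \<sigma>"
  defines "\<sigma>' \<equiv> den Q (auction_init z left) \<sigma>"
  shows "fr \<sigma>'" "auction_progress E L n k 0 (snd \<sigma>' z) (snd \<sigma>' (z + 1))"
proof -
  define p where "p = PFor (z + 3) 0 (PStore (z + 1) (Reg (z + 3)) (Const 0))"
  define q where "q = PFor (z + 2) 1 (PIf left (PStore z (Reg (z + 2)) (Reg 0))
                               (PStore z (Reg (z + 2)) (Add (Reg 0) (Const 1))))"
  define \<tau> where "\<tau> = den Q p \<sigma>"
  have \<sigma>': "\<sigma>' = den Q q \<tau>" by (simp add: \<sigma>'_def auction_init_def p_def q_def \<tau>_def)
  show "fr \<sigma>'" unfolding \<sigma>'_def by (rule fr_den[OF assms(1)]) (auto simp: auction_init_def)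
  have fr\<tau>: "fr \<tau>" unfolding \<tau>_def by (rule fr_den[OF assms(1)]) (auto simp: p_def)
  have price: "\<forall>b<fst \<sigma> 0. snd \<tau> (z + 1) b = 0"
    unfolding \<tau>_def p_def
    by (rule den_for[where I = "\<lambda>i \<sigma>. \<forall>b<i. snd \<sigma> (z + 1) b = 0"])
       (use z in \<open>auto simp: less_Suc_eq\<close>)
  have mate: "\<forall>a<fst \<tau> 1. snd \<sigma>' z a = (if a \<in> L then n else Suc n)"
    unfolding \<sigma>' q_def
  proof (rule den_for[where I = "\<lambda>i \<sigma>. \<forall>a<i. snd \<sigma> z a = (if a \<in> L then n else Suc n)"], goal_cases)
    case (4 i \<rho>)
    have "fr \<rho>" using 4(4) by (rule fr_trans[OF fr\<tau>]) auto
    moreover from this have "eval_exp left \<rho> \<noteq> 0 \<longleftrightarrow> i \<in> L"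
      using left[of \<rho>] 4 frD[OF fr\<tau>] by (simp add: fr_def)
    ultimately show ?case using 4 frD[of \<rho>] by (auto simp: less_Suc_eq)
  qed (use z in auto)
  have "snd \<sigma>' (z + 1) = snd \<tau> (z + 1)" unfolding \<sigma>' by (rule den_arr) (simp add: q_def)
  then show "auction_progress E L n k 0 (snd \<sigma>' z) (snd \<sigma>' (z + 1))"
    using price mate frD[OF assms(1)] frD[OF fr\<tau>] by (intro auction_progress_init) auto
qed

lemma select_spec:
  assumes "fr \<sigma>"
  defines "\<sigma>' \<equiv> den Q (auction_select z) \<sigma>"
  shows "fr \<sigma>'" "snd \<sigma>' = snd \<sigma>"
    "if fst \<sigma>' (z + 4) < k then snd \<sigma> z (fst \<sigma>' (z + 4)) = n
     else (\<forall>a<k. snd \<sigma> z a \<noteq> n)"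
proof -
  show "fr \<sigma>'" unfolding \<sigma>'_def by (rule fr_den[OF assms(1)]) (auto simp: auction_select_def)
  show "snd \<sigma>' = snd \<sigma>" unfolding \<sigma>'_def by (rule ext, rule den_arr) (simp add: auction_select_def)
  define I where "I = (\<lambda>i (\<tau>::state). snd \<tau> = snd \<sigma> \<and> fst \<tau> 0 = n \<and>
     (if fst \<tau> (z + 4) < k then snd \<sigma> z (fst \<tau> (z + 4)) = n else (\<forall>a<i. snd \<sigma> z a \<noteq> n)))"
  let ?\<tau> = "set_reg (z + 4) (fst \<sigma> 1) \<sigma>"
  have "I (fst ?\<tau> 1) \<sigma>'"
    unfolding \<sigma>'_def auction_select_def den.simps(2,4) eval_exp.simps(1,2)
    by (rule den_for[where I = I])
       (use z frD[OF assms(1)] in \<open>auto simp: I_def less_Suc_eq split: if_splits\<close>)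
  then show "if fst \<sigma>' (z + 4) < k then snd \<sigma> z (fst \<sigma>' (z + 4)) = n
     else (\<forall>a<k. snd \<sigma> z a \<noteq> n)"
    using frD[OF assms(1)] z by (simp add: I_def)
qed

lemma choose_spec:
  assumes "fr \<sigma>" "fst \<sigma> (z + 4) < k"
  defines "\<sigma>' \<equiv> den Q (auction_choose z adj e) \<sigma>" and "a \<equiv> fst \<sigma> (z + 4)"
    and "price \<equiv> snd \<sigma> (z + 1)"
  shows "fr \<sigma>'" "fst \<sigma>' (z + 4) = a" "snd \<sigma>' z = snd \<sigma> z" "snd \<sigma>' (z + 1) = price"
    "if fst \<sigma>' (z + 5) < n
     then E a (fst \<sigma>' (z + 5)) \<and> (\<forall>b<n. E a b \<longrightarrow> price (fst \<sigma>' (z + 5)) \<le> price b)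
     else (\<forall>b<n. \<not> E a b)"
proof -
  show "fr \<sigma>'" unfolding \<sigma>'_def by (rule fr_den[OF assms(1)]) (auto simp: auction_choose_def)
  have out: "z + 4 \<notin> wregs adj" "z + 5 \<notin> wregs adj" "z + 3 \<notin> wregs adj" "z \<notin> warrs adj" "z + 1 \<notin> warrs adj"
    using adj_regs adj_arrs by auto
  show "fst \<sigma>' (z + 4) = a" unfolding \<sigma>'_def a_def
    by (rule den_reg) (use out in \<open>simp add: auction_choose_def\<close>)
  show "snd \<sigma>' z = snd \<sigma> z" unfolding \<sigma>'_def
    by (rule den_arr) (use out in \<open>simp add: auction_choose_def\<close>)
  show "snd \<sigma>' (z + 1) = price" unfolding \<sigma>'_def price_def
    by (rule den_arr) (use out in \<open>simp add: auction_choose_def\<close>)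
  define I where "I = (\<lambda>i (\<tau>::state). fst \<tau> (z + 5) \<le> n \<and>
     (if fst \<tau> (z + 5) < n
      then E a (fst \<tau> (z + 5)) \<and> (\<forall>b<i. E a b \<longrightarrow> price (fst \<tau> (z + 5)) \<le> price b)
      else (\<forall>b<i. \<not> E a b)))"
  let ?\<tau> = "set_reg (z + 5) (fst \<sigma> 0) \<sigma>"
  have fr\<tau>: "fr ?\<tau>" by (rule fr_set_reg[OF assms(1)]) simp
  have "I (fst ?\<tau> 0) \<sigma>'"
    unfolding \<sigma>'_def auction_choose_def
    unfolding den.simps(2,4) eval_exp.simps(2)
  proof (rule den_for[where I = I], goal_cases)
    case (4 i \<rho>)
    have fr\<rho>: "fr \<rho>" using 4(4) by (rule fr_trans[OF fr\<tau>]) auto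
    have a\<rho>: "fst \<rho> (z + 4) = a" using 4(4) out by (simp add: agree_off_def a_def)
    have p\<rho>: "snd \<rho> (z + 1) = price" using 4(4) out by (simp add: agree_off_def price_def)
    have i: "i < n" using 4(1) z frD[OF assms(1)] by simp
    let ?\<mu> = "den Q adj \<rho>"
    have \<mu>: "fst ?\<mu> 0 = n" "fst ?\<mu> (z + 5) = fst \<rho> (z + 5)" "fst ?\<mu> (z + 3) = i"
        "snd ?\<mu> (z + 1) = price"
      using frD[OF fr\<rho>] 4(3) p\<rho> small_regs out by (simp_all add: den_reg den_arr)
    have E: "fst ?\<mu> e \<noteq> 0 \<longleftrightarrow> E a i"
      using adj[of \<rho>] fr\<rho> a\<rho> 4(3) i assms(2) by (simp add: fr_def a_def)
    show ?case
      using 4(2) E \<mu> i unfolding I_def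
      by (auto simp: less_Suc_eq split: if_splits)
  qed (use z out small_regs frD[OF assms(1)] in \<open>auto simp: I_def\<close>)
  then show "if fst \<sigma>' (z + 5) < n
     then E a (fst \<sigma>' (z + 5)) \<and> (\<forall>b<n. E a b \<longrightarrow> price (fst \<sigma>' (z + 5)) \<le> price b)
     else (\<forall>b<n. \<not> E a b)"
    using frD[OF assms(1)] z by (simp add: I_def)
qed

lemma assign_spec:
  assumes "fr \<sigma>" "fst \<sigma> (z + 4) < k" "fst \<sigma> (z + 5) < n"
  defines "\<sigma>' \<equiv> den Q (auction_assign z) \<sigma>" and "a \<equiv> fst \<sigma> (z + 4)" and "b \<equiv> fst \<sigma> (z + 5)"
  shows "fr \<sigma>'"
    "\<forall>x<k. snd \<sigma>' z x = (if x = a then b else if snd \<sigma> z x = b then n else snd \<sigma> z x)"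
    "snd \<sigma>' (z + 1) = (snd \<sigma> (z + 1))(b := Suc (snd \<sigma> (z + 1) b))"
proof -
  show "fr \<sigma>'" unfolding \<sigma>'_def by (rule fr_den[OF assms(1)]) (auto simp: auction_assign_def)
  let ?p = "PFor (z + 2) 1 (PIf (neq_exp (Cell z (Reg (z + 2))) (Reg (z + 5))) PSkip
                       (PStore z (Reg (z + 2)) (Reg 0)))"
  define \<tau> where "\<tau> = den Q ?p \<sigma>"
  have \<tau>: "fst \<tau> (z + 4) = a" "fst \<tau> (z + 5) = b" "snd \<tau> (z + 1) = snd \<sigma> (z + 1)"
    unfolding \<tau>_def a_def b_def by (auto simp: den_reg den_arr simp del: den.simps)
  have \<sigma>': "snd \<sigma>' z = (snd \<tau> z)(a := b)"
     "snd \<sigma>' (z + 1) = (snd \<tau> (z + 1))(b := Suc (snd \<tau> (z + 1) b))"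
    unfolding \<sigma>'_def auction_assign_def den.simps(4) \<tau>_def[symmetric]
    using \<tau> by auto
  show "snd \<sigma>' (z + 1) = (snd \<sigma> (z + 1))(b := Suc (snd \<sigma> (z + 1) b))"
    using \<sigma>' \<tau> by simp
  define I where "I = (\<lambda>i (\<tau>::state). \<forall>x. snd \<tau> z x =
     (if x < i \<and> snd \<sigma> z x = b then n else snd \<sigma> z x))"
  have "I (fst \<sigma> 1) \<tau>" unfolding \<tau>_def
  proof (rule den_for[where I = I], goal_cases)
    case (4 i \<rho>)
    have "fst \<rho> (z + 5) = b" "fst \<rho> 0 = n" using 4(4) z frD[OF assms(1)] 
      by (simp_all add: agree_off_def b_def)
    then show ?case using 4(2,3) by (auto simp: I_def less_Suc_eq split: if_splits)
  qed (use z in \<open>auto simp: I_def\<close>)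
  then show "\<forall>x<k. snd \<sigma>' z x = (if x = a then b else if snd \<sigma> z x = b then n else snd \<sigma> z x)"
    using \<sigma>' frD[OF assms(1)] by (simp add: I_def)
qed

lemma round_spec:
  assumes "fr \<sigma>" "auction_progress E L n k t (snd \<sigma> z) (snd \<sigma> (z + 1))"
  defines "\<sigma>' \<equiv> den Q (auction_round z adj e) \<sigma>"
  shows "fr \<sigma>'" "auction_progress E L n k (Suc t) (snd \<sigma>' z) (snd \<sigma>' (z + 1))"
proof -
  show "fr \<sigma>'" unfolding \<sigma>'_def by (rule fr_den[OF assms(1)]) (auto simp: auction_defs)
  define \<tau> where "\<tau> = den Q (auction_select z) \<sigma>"
  define \<rho> where "\<rho> = den Q (auction_choose z adj e) \<tau>"
  define \<mu> where "\<mu> = den Q (auction_assign z) \<rho>"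
  note \<tau> = select_spec[OF assms(1), folded \<tau>_def]
  have \<sigma>': "\<sigma>' = (if fst \<tau> (z + 4) < k then if fst \<rho> (z + 5) < n then \<mu> else \<rho> else \<tau>)"
    unfolding \<sigma>'_def auction_round_def den.simps \<tau>_def[symmetric] \<rho>_def[symmetric] \<mu>_def[symmetric]
    using frD[OF \<tau>(1)] frD[OF choose_spec(1)[OF \<tau>(1)], folded \<rho>_def] by auto
  show "auction_progress E L n k (Suc t) (snd \<sigma>' z) (snd \<sigma>' (z + 1))"
  proof (cases "fst \<tau> (z + 4) < k")
    case False
    then show ?thesis using \<sigma>' \<tau> assms(2) by (auto intro: auction_progress_matched)
  next
    case True
    note \<rho> = choose_spec[OF \<tau>(1) True, folded \<rho>_def]
    have a: "snd \<sigma> z (fst \<tau> (z + 4)) = n" using True \<tau>(3) by simp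
    show ?thesis
    proof (cases "fst \<rho> (z + 5) < n")
      case False
      then have "\<forall>b<n. \<not> E (fst \<tau> (z + 4)) b" using \<rho>(5) by simp
      moreover have "\<sigma>' = \<rho>" using \<sigma>' True False by simp
      ultimately show ?thesis
        using \<rho>(3,4) \<tau>(2) auction_progress_stuck[OF assms(2) L True a] by simp
    next
      case b: True
      have \<mu>: "\<sigma>' = \<mu>" using \<sigma>' True b by simp
      have lt: "fst \<rho> (z + 4) < k" using \<rho>(2) True by simp
      note as = assign_spec[OF \<rho>(1) lt b, folded \<mu>_def]
      show ?thesis unfolding \<mu>
        by (rule auction_progress_bid[OF assms(2) L True a b])
           (use as \<rho> \<tau>(2) b in \<open>auto simp: \<open>snd \<tau> = snd \<sigma>\<close>\<close>)
    qed
  qed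
qed

lemma verdict_spec:
  assumes "fr \<sigma>"
  defines "\<sigma>' \<equiv> den Q (auction_verdict z) \<sigma>"
  shows "snd \<sigma>' = snd \<sigma>" "fst \<sigma>' (z + 6) \<noteq> 0 \<longleftrightarrow> (\<forall>a<k. snd \<sigma> z a \<noteq> n)"
proof -
  show "snd \<sigma>' = snd \<sigma>" unfolding \<sigma>'_def by (rule ext, rule den_arr) (simp add: auction_verdict_def)
  define I where "I = (\<lambda>i (\<tau>::state). snd \<tau> = snd \<sigma> \<and> fst \<tau> 0 = n \<and>
     (fst \<tau> (z + 6) \<noteq> 0 \<longleftrightarrow> (\<forall>a<i. snd \<sigma> z a \<noteq> n)))"
  let ?\<tau> = "set_reg (z + 6) 1 \<sigma>"
  have "I (fst ?\<tau> 1) \<sigma>'"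
    unfolding \<sigma>'_def auction_verdict_def den.simps(2,4) eval_exp.simps(1,2)
    by (rule den_for[where I = I])
       (use z frD[OF assms(1)] in \<open>auto simp: I_def less_Suc_eq split: if_splits\<close>)
  then show "fst \<sigma>' (z + 6) \<noteq> 0 \<longleftrightarrow> (\<forall>a<k. snd \<sigma> z a \<noteq> n)"
    using frD[OF assms(1)] z by (simp add: I_def)
qed

lemma auction_spec:
  defines "\<sigma>' \<equiv> den Q (auction z left adj e) \<sigma>0"
  shows "fst \<sigma>' (z + 6) \<noteq> 0 \<longleftrightarrow> (\<exists>M. matching E L n M)"
    and "fst \<sigma>' (z + 6) \<noteq> 0 \<Longrightarrow> matching E L n (snd \<sigma>' z)"
proof -
  have fr0: "fr \<sigma>0" by (simp add: fr_def)
  define \<tau> where "\<tau> = den Q (auction_init z left) \<sigma>0"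
  define \<rho> where "\<rho> = den Q (PFor z 0 (PFor (z + 1) 1 (auction_round z adj e))) \<tau>"
  define P where "P = (\<lambda>t \<sigma>. fr \<sigma> \<and> auction_progress E L n k t (snd \<sigma> z) (snd \<sigma> (z + 1)))"
  have P_reg: "P t (set_reg x v \<sigma>)" if "P t \<sigma>" "x \<in> {z..z + 6}" for t x v \<sigma>
    using that fr_set_reg by (auto simp: P_def)
  have out: "z \<notin> wregs adj" "z + 1 \<notin> wregs adj" using adj_regs by auto
  have \<tau>: "P 0 \<tau>" unfolding P_def \<tau>_def using init_spec[OF fr0] by blast
  have n\<tau>: "fst \<tau> 0 = n" using \<tau> frD by (simp add: P_def)
  have "P (fst \<tau> 0 * k) \<rho>" unfolding \<rho>_def
  proof (rule den_for[where I = "\<lambda>i. P (i * k)"], goal_cases)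
    case (4 i \<sigma>)
    have k\<sigma>: "fst \<sigma> 1 = k" using 4(2) frD by (simp add: P_def)
    have "P (i * k + fst \<sigma> 1) (den Q (PFor (z + 1) 1 (auction_round z adj e)) \<sigma>)"
    proof (rule den_for[where I = "\<lambda>j. P (i * k + j)"], goal_cases)
      case 3
      then show ?case using 4(2) by (auto intro: P_reg)
    next
      case (4 j \<sigma>')
      then show ?case using round_spec[of \<sigma>'] by (auto intro!: P_reg simp: P_def fr_set_reg)
    qed (use out small_regs z in \<open>auto simp: auction_defs\<close>)
    then show ?case using k\<sigma> by (auto intro!: P_reg simp: add.commute)
  qed (use out small_regs z \<tau> in \<open>auto simp: auction_defs intro!: P_reg\<close>)
  then have \<rho>: "fr \<rho>" "auction_progress E L n k (n * k) (snd \<rho> z) (snd \<rho> (z + 1))"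
    using n\<tau> by (auto simp: P_def)
  have \<sigma>': "\<sigma>' = den Q (auction_verdict z) \<rho>"
    unfolding \<sigma>'_def auction_def den.simps(4) \<tau>_def \<rho>_def ..
  note v = verdict_spec[OF \<rho>(1), folded \<sigma>']
  show "fst \<sigma>' (z + 6) \<noteq> 0 \<longleftrightarrow> (\<exists>M. matching E L n M)"
    using v(2) auction_finished(1)[OF \<rho>(2) L] by blast
  show "fst \<sigma>' (z + 6) \<noteq> 0 \<Longrightarrow> matching E L n (snd \<sigma>' z)"
    using v auction_finished(2)[OF \<rho>(2) L] by simp
qed

end

section \<open>Realizing a pattern\<close>

text \<open>A digit array \<open>D\<close> describes a pattern: \<open>D i < k\<close> says that task \<open>i\<close> has the same user as
  task \<open>D i\<close>, and \<open>D i = c + k\<close> that \<open>i\<close> leads the tasks of its user, which lies in the same class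
  as the user of task \<open>c\<close>, the leader of that class.\<close>

definition leaders :: "nat \<Rightarrow> (nat \<Rightarrow> nat) \<Rightarrow> nat \<Rightarrow> nat set" where
  "leaders k D c = {a. a < k \<and> D a = c + k}"

definition class_leaders :: "nat \<Rightarrow> (nat \<Rightarrow> nat) \<Rightarrow> nat set" where
  "class_leaders k D = {c. c < k \<and> D c = c + k}"

definition fits :: "queries \<Rightarrow> nat \<Rightarrow> (nat \<Rightarrow> nat) \<Rightarrow> (nat \<Rightarrow> nat) \<Rightarrow> nat \<Rightarrow> nat \<Rightarrow> nat \<Rightarrow> bool" where
  "fits Q k D cls e a u \<longleftrightarrow> cls u = e \<and> (\<forall>i<k. i = a \<or> D i = a \<longrightarrow> auth_query Q i u)"

definition class_fits :: "queries \<Rightarrow> nat \<Rightarrow> nat \<Rightarrow> (nat \<Rightarrow> nat) \<Rightarrow> (nat \<Rightarrow> nat) \<Rightarrow> nat \<Rightarrow> nat \<Rightarrow> bool" where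
  "class_fits Q n k D cls c e \<longleftrightarrow> (\<exists>M. matching (fits Q k D cls e) (leaders k D c) n M)"

text \<open>Digit arrays are arbitrary, so a follower may point to another follower. Equal users are
  demanded only where the digit points to a leader, which is always the case in the pattern of a
  plan.\<close>

definition realizes ::
  "queries \<Rightarrow> nat \<Rightarrow> nat \<Rightarrow> (nat \<Rightarrow> nat) \<Rightarrow> (nat \<Rightarrow> nat) \<Rightarrow> (nat \<Rightarrow> nat) \<Rightarrow> (nat \<Rightarrow> nat) \<Rightarrow> bool" where
  "realizes Q n k D cls g P \<longleftrightarrow> inj_on g (class_leaders k D) \<and>
     (\<forall>c\<in>class_leaders k D. matching (fits Q k D cls (g c)) (leaders k D c) n P) \<and>
     (\<forall>i<k. D i < k \<longrightarrow> k \<le> D (D i) \<longrightarrow> P i = P (D i))"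

definition accepted :: "queries \<Rightarrow> nat \<Rightarrow> nat \<Rightarrow> (nat \<Rightarrow> nat) \<Rightarrow> bool" where
  "accepted Q k m P \<longleftrightarrow> (\<forall>i<k. auth_query Q i (P i)) \<and> (\<forall>l<m. check_query Q l P)"

text \<open>All realizations must be accepted, since nothing is known about which matchings the
  auctions return.\<close>

definition succeeds :: "queries \<Rightarrow> nat \<Rightarrow> nat \<Rightarrow> nat \<Rightarrow> (nat \<Rightarrow> nat) \<Rightarrow> (nat \<Rightarrow> nat) \<Rightarrow> bool" where
  "succeeds Q n k m D cls \<longleftrightarrow> (\<exists>M. matching (class_fits Q n k D cls) (class_leaders k D) n M) \<and>
     (\<forall>g P. realizes Q n k D cls g P \<longrightarrow> accepted Q k m P)"

text \<open>Arrays: 0 the plan, 1 the digits \<open>D\<close>, 2 the class map. Registers 12 and 13 hold the class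
  leader and the class of the inner auction, whose verdict is register 36.\<close>

definition inner_adj :: prog where
  "inner_adj =
     PAssign 14 (eq_exp (Cell 2 (Reg 33)) (Reg 13)) ;;
     PFor 15 1 (PIf (conj_exp (neq_exp (Reg 15) (Reg 34)) (neq_exp (Cell 1 (Reg 15)) (Reg 34)))
       PSkip
       (PAuth 16 (Reg 15) (Reg 33) ;; PIf (Reg 16) PSkip (PAssign 14 (Const 0))))"

definition inner :: prog where
  "inner = auction 30 (eq_exp (Cell 1 (Reg 32)) (Add (Reg 12) (Reg 1))) inner_adj 14"

definition outer_adj :: prog where
  "outer_adj = PAssign 12 (Reg 54) ;; PAssign 13 (Reg 53) ;; inner"

definition outer :: prog where
  "outer = auction 50 (eq_exp (Cell 1 (Reg 52)) (Add (Reg 52) (Reg 1))) outer_adj 36"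

definition copy_leaders :: prog where
  "copy_leaders = PFor 19 1 (PIf (eq_exp (Cell 1 (Reg 19)) (Add (Reg 12) (Reg 1)))
     (PStore 0 (Reg 19) (Cell 30 (Reg 19))) PSkip)"

text \<open>The inner auction is run again for each chosen pair of classes, because every adjacency
  test of the outer auction has overwritten its array 30.\<close>

definition assign_leaders :: prog where
  "assign_leaders = PFor 18 1 (PIf (eq_exp (Cell 1 (Reg 18)) (Add (Reg 18) (Reg 1)))
     (PAssign 12 (Reg 18) ;; PAssign 13 (Cell 50 (Reg 18)) ;; inner ;; copy_leaders) PSkip)"

definition assign_followers :: prog where
  "assign_followers = PFor 18 1 (PIf (Sub (Reg 1) (Cell 1 (Reg 18)))
     (PStore 0 (Reg 18) (Cell 0 (Cell 1 (Reg 18)))) PSkip)"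

definition verify :: prog where
  "verify =
     PAssign 4 (Const 1) ;;
     PFor 18 1 (PAuth 16 (Reg 18) (Cell 0 (Reg 18)) ;; PIf (Reg 16) PSkip (PAssign 4 (Const 0))) ;;
     PFor 18 2 (PCheck 16 (Reg 18) 0 ;; PIf (Reg 16) PSkip (PAssign 4 (Const 0)))"

text \<open>The surrounding loops are never left early, so a plan that has been accepted must be
  protected from later attempts.\<close>

definition realize :: prog where
  "realize = PIf (Reg 4) PSkip (outer ;; assign_leaders ;; assign_followers ;; verify)"

lemma inner_writes: "wregs inner = {30, 31, 32, 33, 34, 35, 36, 14, 15, 16}" "warrs inner = {30, 31}"
  by (auto simp: inner_def wregs_auction warrs_auction inner_adj_def)

lemma outer_writes:
  "wregs outer = {50, 51, 52, 53, 54, 55, 56, 12, 13} \<union> wregs inner" "warrs outer = {50, 51} \<union> warrs inner"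
  by (auto simp: outer_def wregs_auction warrs_auction outer_adj_def)

lemma wf_inner_adj: "wf_prog inner_adj"
  by (simp add: inner_adj_def)

lemma wf_inner: "wf_prog inner"
  unfolding inner_def by (rule wf_auction) (auto simp: wf_inner_adj inner_adj_def)

lemma wf_outer_adj: "wf_prog outer_adj"
  by (simp add: outer_adj_def wf_inner)

lemma wf_outer: "wf_prog outer"
  unfolding outer_def by (rule wf_auction) (auto simp: wf_outer_adj, auto simp: outer_adj_def inner_writes)

lemma realize_writes:
  "wregs realize = {4, 12, 13, 16, 18, 19} \<union> wregs outer" "warrs realize = {0} \<union> warrs outer"
  by (auto simp: realize_def assign_leaders_def copy_leaders_def assign_followers_def verify_def
      outer_writes inner_writes)

lemma wf_realize: "wf_prog realize"
  by (simp add: realize_def assign_leaders_def copy_leaders_def assign_followers_def verify_def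
      wf_outer wf_inner inner_writes)

section \<open>Correctness of the realization of one pattern\<close>

lemma inner_adj_spec:
  "fst (den Q inner_adj \<sigma>) 14 \<noteq> 0 \<longleftrightarrow>
     fits Q (fst \<sigma> 1) (snd \<sigma> 1) (snd \<sigma> 2) (fst \<sigma> 13) (fst \<sigma> 34) (fst \<sigma> 33)"
proof -
  define I where "I = (\<lambda>i (\<tau>::state). fst \<tau> 14 \<noteq> 0 \<longleftrightarrow> snd \<sigma> 2 (fst \<sigma> 33) = fst \<sigma> 13 \<and>
     (\<forall>x<i. x = fst \<sigma> 34 \<or> snd \<sigma> 1 x = fst \<sigma> 34 \<longrightarrow> auth_query Q x (fst \<sigma> 33)))"
  let ?\<tau> = "set_reg 14 (eval_exp (eq_exp (Cell 2 (Reg 33)) (Reg 13)) \<sigma>) \<sigma>"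
  have "I (fst ?\<tau> 1) (den Q inner_adj \<sigma>)"
    unfolding inner_adj_def den.simps(2,4)
  proof (rule den_for[where I = I], goal_cases)
    case (4 i \<rho>)
    have "fst \<rho> 33 = fst \<sigma> 33" "fst \<rho> 34 = fst \<sigma> 34" "snd \<rho> = snd \<sigma>"
      using 4(4) by (auto simp: agree_off_def)
    then show ?case using 4(2,3) by (auto simp: I_def less_Suc_eq)
  qed (auto simp: I_def eq_exp_def neq_exp_def)
  then show ?thesis by (simp add: I_def fits_def)
qed

lemma inner_spec:
  fixes \<sigma> :: state and Q :: queries
  defines "n \<equiv> fst \<sigma> 0" and "k \<equiv> fst \<sigma> 1" and "D \<equiv> snd \<sigma> 1" and "cls \<equiv> snd \<sigma> 2"
    and "c \<equiv> fst \<sigma> 12" and "e \<equiv> fst \<sigma> 13" and "\<sigma>' \<equiv> den Q inner \<sigma>"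
  shows "fst \<sigma>' 36 \<noteq> 0 \<longleftrightarrow> class_fits Q n k D cls c e"
    and "class_fits Q n k D cls c e \<Longrightarrow> matching (fits Q k D cls e) (leaders k D c) n (snd \<sigma>' 30)"
proof -
  interpret auction_run Q 30 "eq_exp (Cell 1 (Reg 32)) (Add (Reg 12) (Reg 1))" inner_adj 14
    "fits Q k D cls e" "leaders k D c" \<sigma> n k
  proof (unfold_locales, goal_cases)
    case (8 \<tau>)
    then have "fst \<tau> 12 = c" "fst \<tau> 1 = k" "snd \<tau> 1 = D"
      by (auto simp: agree_off_def inner_adj_def c_def k_def D_def)
    with 8(2) show ?case by (auto simp: leaders_def)
  next
    case (9 \<tau>)
    then have "fst \<tau> 13 = e" "fst \<tau> 1 = k" "snd \<tau> 1 = D" "snd \<tau> 2 = cls"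
      by (auto simp: agree_off_def inner_adj_def e_def k_def D_def cls_def)
    then show ?case using inner_adj_spec[of Q \<tau>] by simp
  qed (auto simp: wf_inner_adj n_def k_def leaders_def, auto simp: inner_adj_def)
  show 1: "fst \<sigma>' 36 \<noteq> 0 \<longleftrightarrow> class_fits Q n k D cls c e"
    using auction_spec(1) unfolding inner_def[symmetric] \<sigma>'_def class_fits_def by simp
  show "class_fits Q n k D cls c e \<Longrightarrow> matching (fits Q k D cls e) (leaders k D c) n (snd \<sigma>' 30)"
    using auction_spec(2) 1 unfolding inner_def[symmetric] \<sigma>'_def by simp
qed

lemma outer_spec:
  fixes \<sigma> :: state and Q :: queries
  defines "n \<equiv> fst \<sigma> 0" and "k \<equiv> fst \<sigma> 1" and "D \<equiv> snd \<sigma> 1" and "cls \<equiv> snd \<sigma> 2"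
    and "\<sigma>' \<equiv> den Q outer \<sigma>"
  assumes "matching (class_fits Q n k D cls) (class_leaders k D) n M"
  shows "matching (class_fits Q n k D cls) (class_leaders k D) n (snd \<sigma>' 50)"
proof -
  interpret auction_run Q 50 "eq_exp (Cell 1 (Reg 52)) (Add (Reg 52) (Reg 1))" outer_adj 36
    "class_fits Q n k D cls" "class_leaders k D" \<sigma> n k
  proof (unfold_locales, goal_cases)
    case (8 \<tau>)
    then have "fst \<tau> 1 = k" "snd \<tau> 1 = D"
      by (auto simp: agree_off_def outer_adj_def inner_writes k_def D_def)
    with 8(2) show ?case by (auto simp: class_leaders_def)
  next
    case (9 \<tau>)
    then have "fst \<tau> 0 = n" "fst \<tau> 1 = k" "snd \<tau> 1 = D" "snd \<tau> 2 = cls"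
      by (auto simp: agree_off_def outer_adj_def inner_writes n_def k_def D_def cls_def)
    then show ?case
      using inner_spec(1)[of Q "set_reg 13 (fst \<tau> 53) (set_reg 12 (fst \<tau> 54) \<tau>)"]
      by (simp add: outer_adj_def)
  qed (auto simp: wf_outer_adj n_def k_def class_leaders_def, auto simp: outer_adj_def inner_writes)
  show ?thesis
    using auction_spec assms(6) unfolding outer_def[symmetric] \<sigma>'_def by auto
qed

lemma copy_leaders_spec:
  "snd (den Q copy_leaders \<sigma>) 0 x =
     (if x \<in> leaders (fst \<sigma> 1) (snd \<sigma> 1) (fst \<sigma> 12) then snd \<sigma> 30 x else snd \<sigma> 0 x)"
proof -
  define I where "I = (\<lambda>i (\<tau>::state). \<forall>x. snd \<tau> 0 x =
     (if x < i \<and> snd \<sigma> 1 x = fst \<sigma> 12 + fst \<sigma> 1 then snd \<sigma> 30 x else snd \<sigma> 0 x))"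
  have "I (fst \<sigma> 1) (den Q copy_leaders \<sigma>)"
    unfolding copy_leaders_def
  proof (rule den_for[where I = I], goal_cases)
    case (4 i \<rho>)
    have "fst \<rho> 12 = fst \<sigma> 12" "fst \<rho> 1 = fst \<sigma> 1" "snd \<rho> 1 = snd \<sigma> 1" "snd \<rho> 30 = snd \<sigma> 30"
      using 4(4) by (auto simp: agree_off_def)
    then show ?case using 4(2,3) by (auto simp: I_def less_Suc_eq)
  qed (auto simp: I_def)
  then show ?thesis by (simp add: I_def leaders_def)
qed

lemma matching_cong: "(\<And>a. a \<in> L \<Longrightarrow> f a = g a) \<Longrightarrow> matching E L n f = matching E L n g"
  unfolding matching_def by (simp cong: inj_on_cong)

lemma leaders_disjoint: "x \<in> leaders k D c \<Longrightarrow> x \<in> leaders k D c' \<Longrightarrow> c = c'"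
  by (simp add: leaders_def)

text \<open>Leader sets of distinct classes are disjoint, so copying the matching of one class into
  array 0 leaves those of the earlier classes intact.\<close>

lemma assign_leaders_spec:
  fixes \<sigma> :: state and Q :: queries
  defines "n \<equiv> fst \<sigma> 0" and "k \<equiv> fst \<sigma> 1" and "D \<equiv> snd \<sigma> 1" and "cls \<equiv> snd \<sigma> 2"
    and "g \<equiv> snd \<sigma> 50" and "\<sigma>' \<equiv> den Q assign_leaders \<sigma>"
  assumes "\<And>c. c \<in> class_leaders k D \<Longrightarrow> class_fits Q n k D cls c (g c)"
  shows "\<forall>c\<in>class_leaders k D. matching (fits Q k D cls (g c)) (leaders k D c) n (snd \<sigma>' 0)"
proof -
  define I where "I = (\<lambda>i (\<tau>::state). \<forall>c\<in>class_leaders k D. c < i \<longrightarrow>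
     matching (fits Q k D cls (g c)) (leaders k D c) n (snd \<tau> 0))"
  have "I (fst \<sigma> 1) \<sigma>'"
    unfolding \<sigma>'_def assign_leaders_def
  proof (rule den_for[where I = I], goal_cases)
    case (4 i \<rho>)
    have \<rho>: "fst \<rho> 0 = n" "fst \<rho> 1 = k" "snd \<rho> 1 = D" "snd \<rho> 2 = cls" "snd \<rho> 50 = g" "fst \<rho> 18 = i"
      using 4(3,4) by (auto simp: agree_off_def inner_writes copy_leaders_def n_def k_def D_def cls_def g_def)
    show ?case
    proof (cases "i \<in> class_leaders k D")
      case False
      then have "D i \<noteq> i + k" using 4(1) by (simp add: class_leaders_def k_def)
      moreover have "I (Suc i) \<rho>" using 4(2) False by (auto simp: I_def less_Suc_eq)
      ultimately show ?thesis using \<rho> by (simp add: I_def)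
    next
      case True
      define \<tau> where "\<tau> = set_reg 13 (g i) (set_reg 12 i \<rho>)"
      define \<mu> where "\<mu> = den Q inner \<tau>"
      have \<tau>: "fst \<tau> 0 = n" "fst \<tau> 1 = k" "snd \<tau> 1 = D" "snd \<tau> 2 = cls" "fst \<tau> 12 = i" "fst \<tau> 13 = g i"
        "snd \<tau> 0 = snd \<rho> 0"
        using \<rho> by (simp_all add: \<tau>_def)
      have \<mu>: "fst \<mu> 1 = k" "fst \<mu> 12 = i" "snd \<mu> 1 = D" "snd \<mu> 0 = snd \<rho> 0"
        using \<tau> by (simp_all add: \<mu>_def den_reg den_arr inner_writes)
      have m: "matching (fits Q k D cls (g i)) (leaders k D i) n (snd \<mu> 30)"
        using inner_spec(2)[of Q \<tau>] assms(7)[OF True] \<tau> by (simp add: \<mu>_def)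
      define P where "P = snd (den Q copy_leaders \<mu>) 0"
      have P: "P x = (if x \<in> leaders k D i then snd \<mu> 30 x else snd \<rho> 0 x)" for x
        using copy_leaders_spec[of Q \<mu> x] \<mu> by (simp add: P_def)
      have "matching (fits Q k D cls (g c)) (leaders k D c) n P"
        if c: "c \<in> class_leaders k D" "c < Suc i" for c
      proof (cases "c = i")
        case True
        then show ?thesis using m P matching_cong[of "leaders k D i" P "snd \<mu> 30"] by simp
      next
        case False
        then have "matching (fits Q k D cls (g c)) (leaders k D c) n (snd \<rho> 0)"
          using 4(2) c by (auto simp: I_def)
        moreover have "P x = snd \<rho> 0 x" if "x \<in> leaders k D c" for x
          using P that False leaders_disjoint by metis
        ultimately show ?thesis using matching_cong[of "leaders k D c" P "snd \<rho> 0"] by simp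
      qed
      moreover have "D i = i + k" using True by (simp add: class_leaders_def)
      ultimately show ?thesis using \<rho> by (simp add: I_def P_def \<mu>_def \<tau>_def)
    qed
  qed (auto simp: I_def inner_writes copy_leaders_def)
  then show ?thesis by (auto simp: I_def class_leaders_def k_def)
qed

text \<open>One pass suffices although array 0 is read and written at once: a cell whose digit is at
  least \<open>k\<close> is never written, and followers of leaders read only such cells.\<close>

lemma assign_followers_spec:
  fixes \<sigma> :: state and Q :: queries
  defines "k \<equiv> fst \<sigma> 1" and "D \<equiv> snd \<sigma> 1" and "P \<equiv> snd \<sigma> 0" and "P' \<equiv> snd (den Q assign_followers \<sigma>) 0"
  shows "k \<le> D x \<Longrightarrow> P' x = P x"
    and "x < k \<Longrightarrow> D x < k \<Longrightarrow> k \<le> D (D x) \<Longrightarrow> P' x = P' (D x)"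
proof -
  define I where "I = (\<lambda>i (\<tau>::state). \<forall>x. (k \<le> D x \<longrightarrow> snd \<tau> 0 x = P x) \<and>
    (x < i \<and> D x < k \<and> k \<le> D (D x) \<longrightarrow> snd \<tau> 0 x = P (D x)))"
  have "I (fst \<sigma> 1) (den Q assign_followers \<sigma>)"
    unfolding assign_followers_def
  proof (rule den_for[where I = I], goal_cases)
    case (4 i \<rho>)
    have "fst \<rho> 1 = k" "snd \<rho> 1 = D"
      using 4(4) by (auto simp: agree_off_def k_def D_def)
    then show ?case using 4(2,3) by (auto simp: I_def less_Suc_eq)
  qed (auto simp: I_def P_def)
  then have I: "I k (den Q assign_followers \<sigma>)" by (simp add: k_def)
  then show "k \<le> D x \<Longrightarrow> P' x = P x" by (simp add: I_def P'_def)
  show "x < k \<Longrightarrow> D x < k \<Longrightarrow> k \<le> D (D x) \<Longrightarrow> P' x = P' (D x)"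
    using I by (simp add: I_def P'_def)
qed

lemma verify_spec:
  fixes \<sigma> :: state and Q :: queries
  defines "\<sigma>' \<equiv> den Q verify \<sigma>"
  shows "snd \<sigma>' = snd \<sigma>" "fst \<sigma>' 4 \<noteq> 0 \<longleftrightarrow> accepted Q (fst \<sigma> 1) (fst \<sigma> 2) (snd \<sigma> 0)"
proof -
  show "snd \<sigma>' = snd \<sigma>" unfolding \<sigma>'_def by (rule ext, rule den_arr) (simp add: verify_def)
  define p where "p = PFor 18 1 (PAuth 16 (Reg 18) (Cell 0 (Reg 18)) ;; PIf (Reg 16) PSkip (PAssign 4 (Const 0)))"
  define q where "q = PFor 18 2 (PCheck 16 (Reg 18) 0 ;; PIf (Reg 16) PSkip (PAssign 4 (Const 0)))"
  define \<tau> where "\<tau> = set_reg 4 1 \<sigma>"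
  define \<rho> where "\<rho> = den Q p \<tau>"
  define I where "I = (\<lambda>i (\<tau>::state). snd \<tau> = snd \<sigma> \<and>
    (fst \<tau> 4 \<noteq> 0 \<longleftrightarrow> (\<forall>x<i. auth_query Q x (snd \<sigma> 0 x))))"
  define J where "J = (\<lambda>i (\<tau>::state). snd \<tau> = snd \<sigma> \<and>
    (fst \<tau> 4 \<noteq> 0 \<longleftrightarrow> (\<forall>x<fst \<sigma> 1. auth_query Q x (snd \<sigma> 0 x)) \<and> (\<forall>l<i. check_query Q l (snd \<sigma> 0))))"
  have "I (fst \<tau> 1) \<rho>" unfolding \<rho>_def p_def
    by (rule den_for[where I = I]) (auto simp: I_def less_Suc_eq \<tau>_def)
  then have \<rho>: "I (fst \<sigma> 1) \<rho>" by (simp add: \<tau>_def)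
  have \<rho>2: "fst \<rho> 2 = fst \<sigma> 2" by (simp add: \<rho>_def p_def \<tau>_def den_reg del: den.simps)
  have "J (fst \<rho> 2) (den Q q \<rho>)" unfolding q_def
    by (rule den_for[where I = J]) (use \<rho> in \<open>auto simp: I_def J_def less_Suc_eq\<close>)
  moreover have "\<sigma>' = den Q q \<rho>"
    unfolding \<sigma>'_def verify_def p_def[symmetric] q_def[symmetric] \<rho>_def \<tau>_def by simp
  ultimately show "fst \<sigma>' 4 \<noteq> 0 \<longleftrightarrow> accepted Q (fst \<sigma> 1) (fst \<sigma> 2) (snd \<sigma> 0)"
    by (simp add: J_def accepted_def \<rho>2)
qed

text \<open>The second claim rests on \<open>verify\<close> alone and so holds for malformed digits
  and false class maps as well; only the third one needs the two auctions.\<close>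

lemma realize_spec:
  fixes \<sigma> :: state and Q :: queries
  defines "n \<equiv> fst \<sigma> 0" and "k \<equiv> fst \<sigma> 1" and "m \<equiv> fst \<sigma> 2" and "\<sigma>' \<equiv> den Q realize \<sigma>"
  shows "fst \<sigma> 4 \<noteq> 0 \<Longrightarrow> \<sigma>' = \<sigma>"
    and "fst \<sigma> 4 = 0 \<Longrightarrow> fst \<sigma>' 4 \<noteq> 0 \<Longrightarrow> accepted Q k m (snd \<sigma>' 0)"
    and "succeeds Q n k m (snd \<sigma> 1) (snd \<sigma> 2) \<Longrightarrow> fst \<sigma>' 4 \<noteq> 0"
proof -
  show skip: "fst \<sigma> 4 \<noteq> 0 \<Longrightarrow> \<sigma>' = \<sigma>" by (simp add: \<sigma>'_def realize_def)
  define \<tau> where "\<tau> = den Q outer \<sigma>"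
  define \<rho> where "\<rho> = den Q assign_leaders \<tau>"
  define \<mu> where "\<mu> = den Q assign_followers \<rho>"
  have \<sigma>': "\<sigma>' = den Q verify \<mu>" if "fst \<sigma> 4 = 0"
    using that by (simp add: \<sigma>'_def realize_def \<tau>_def \<rho>_def \<mu>_def)
  define D where "D = snd \<sigma> 1"
  define cls where "cls = snd \<sigma> 2"
  have \<tau>: "fst \<tau> 0 = n" "fst \<tau> 1 = k" "fst \<tau> 2 = m" "snd \<tau> 1 = D" "snd \<tau> 2 = cls"
    by (simp_all add: \<tau>_def den_reg den_arr outer_writes inner_writes n_def k_def m_def D_def cls_def)
  have \<rho>: "fst \<rho> 1 = k" "fst \<rho> 2 = m" "snd \<rho> 1 = D"
    using \<tau> by (simp_all add: \<rho>_def den_reg den_arr assign_leaders_def copy_leaders_def inner_writes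
        del: den.simps)
  have \<mu>: "fst \<mu> 1 = k" "fst \<mu> 2 = m"
    using \<rho> by (simp_all add: \<mu>_def den_reg den_arr assign_followers_def del: den.simps)
  have verdict: "fst \<sigma>' 4 \<noteq> 0 \<longleftrightarrow> accepted Q k m (snd \<mu> 0)" "snd \<sigma>' 0 = snd \<mu> 0" if "fst \<sigma> 4 = 0"
    using verify_spec[of Q \<mu>] \<mu> \<sigma>'[OF that] by simp_all
  then show "fst \<sigma> 4 = 0 \<Longrightarrow> fst \<sigma>' 4 \<noteq> 0 \<Longrightarrow> accepted Q k m (snd \<sigma>' 0)" by simp
  assume s: "succeeds Q n k m (snd \<sigma> 1) (snd \<sigma> 2)"
  show "fst \<sigma>' 4 \<noteq> 0"
  proof (cases "fst \<sigma> 4 = 0")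
    case True
    define g where "g = snd \<tau> 50"
    have g: "matching (class_fits Q n k D cls) (class_leaders k D) n g"
      using s outer_spec[of Q \<sigma>] unfolding succeeds_def g_def \<tau>_def D_def cls_def n_def k_def by blast
    have "\<forall>c\<in>class_leaders k D. matching (fits Q k D cls (g c)) (leaders k D c) n (snd \<rho> 0)"
      using assign_leaders_spec[of \<tau> Q] g \<tau> unfolding \<rho>_def g_def matching_def by simp
    moreover have "snd \<mu> 0 x = snd \<rho> 0 x" if "x \<in> leaders k D c" for x c
      using assign_followers_spec(1)[of \<rho> x Q] that \<rho> by (simp add: leaders_def \<mu>_def)
    ultimately have "\<forall>c\<in>class_leaders k D. matching (fits Q k D cls (g c)) (leaders k D c) n (snd \<mu> 0)"
      using matching_cong[of _ "snd \<mu> 0" "snd \<rho> 0"] by blast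
    moreover have "\<forall>i<k. D i < k \<longrightarrow> k \<le> D (D i) \<longrightarrow> snd \<mu> 0 i = snd \<mu> 0 (D i)"
      using assign_followers_spec(2)[of _ \<rho> Q] \<rho> by (simp add: \<mu>_def)
    ultimately have "realizes Q n k D cls g (snd \<mu> 0)"
      using g by (simp add: realizes_def matching_def)
    then show ?thesis using s verdict(1)[OF True] by (auto simp: succeeds_def D_def cls_def)
  next
    case False
    then show ?thesis using skip by simp
  qed
qed

section \<open>Exhaustive search over patterns and relations\<close>

text \<open>The equivalence relation is not part of the input and is recovered from a constraint \<open>l\<close>
  with scope \<open>{i, j}\<close>: an answer that agrees with the answer for equal users means equivalent.\<close>

definition probes :: "queries \<Rightarrow> nat \<Rightarrow> nat \<Rightarrow> nat \<Rightarrow> nat \<Rightarrow> nat \<Rightarrow> (nat \<Rightarrow> nat \<Rightarrow> bool) \<Rightarrow> bool" where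
  "probes Q n k l i j M \<longleftrightarrow> (\<forall>B u v. u < n \<longrightarrow> v < n \<longrightarrow> B i = u \<longrightarrow> B j = v \<longrightarrow>
     (\<forall>x<k. x \<noteq> i \<longrightarrow> x \<noteq> j \<longrightarrow> B x = n) \<longrightarrow> check_query Q l B = M u v)"

text \<open>Each class is named by its least member, a number below \<open>n\<close> as the items of
  the outer auction must be. With \<open>M u u\<close> as reference answer the same test serves the
  relation and its complement, without knowing which one is queried.\<close>

definition least_rel :: "nat \<Rightarrow> (nat \<Rightarrow> nat \<Rightarrow> bool) \<Rightarrow> (nat \<Rightarrow> nat) \<Rightarrow> bool" where
  "least_rel n M cls \<longleftrightarrow>
     (\<forall>u<n. cls u < n \<and> M u (cls u) = M u u \<and> (\<forall>v<cls u. M u v \<noteq> M u u))"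

definition probe_row :: prog where
  "probe_row =
     PStore 2 (Reg 8) (Reg 0) ;;
     PFor 9 0 (
       PStore 3 (Reg 6) (Reg 8) ;; PStore 3 (Reg 7) (Reg 9) ;; PCheck 10 (Reg 5) 3 ;;
       PStore 3 (Reg 7) (Reg 8) ;; PCheck 11 (Reg 5) 3 ;;
       PIf (conj_exp (eq_exp (Reg 10) (Reg 11)) (eq_exp (Cell 2 (Reg 8)) (Reg 0)))
         (PStore 2 (Reg 8) (Reg 9)) PSkip)"

definition probe :: prog where
  "probe = PFor 8 1 (PStore 3 (Reg 8) (Reg 0)) ;; PFor 8 0 probe_row"

text \<open>If all constraints are user-independent, no constraint reveals the relation and none
  depends on it; a single class then suffices.\<close>

definition trivial_classes :: prog where
  "trivial_classes = PFor 8 0 (PStore 2 (Reg 8) (Const 0))"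

text \<open>Trying all triples replaces finding out which constraints are relational and on which
  tasks; the factor \<open>m * k * k\<close> is polynomial.\<close>

definition search :: prog where
  "search = (trivial_classes ;; realize) ;;
     PFor 5 2 (PFor 6 1 (PFor 7 1 (probe ;; realize)))"

text \<open>This increments a number of \<open>k\<close> digits in base \<open>2 * k\<close>.
  Register 3 is the carry; a carry out of the last digit means that all patterns have been
  visited.\<close>

definition odometer :: prog where
  "odometer =
     PAssign 3 (Const 1) ;;
     PFor 18 1 (PIf (Reg 3)
       (PIf (Sub (Sub (Add (Reg 1) (Reg 1)) (Const 1)) (Cell 1 (Reg 18)))
          (PStore 1 (Reg 18) (Add (Cell 1 (Reg 18)) (Const 1)) ;; PAssign 3 (Const 0))
          (PStore 1 (Reg 18) (Const 0)))
       PSkip)"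

text \<open>The loop over patterns cannot be a counting loop, its length being no input register;
  the carry of the odometer ends it. Register 0 is overwritten only here, after all loops that are
  bounded by it.\<close>

definition solver :: com where
  "solver = Seq (While (Sub (Const 1) (Reg 3)) (compile (search ;; odometer))) (Assign 0 (Reg 4))"

section \<open>Recovering the classes of users by probing\<close>

lemma probe_row_spec:
  fixes \<sigma> :: state and Q :: queries
  defines "n \<equiv> fst \<sigma> 0" and "k \<equiv> fst \<sigma> 1" and "u \<equiv> fst \<sigma> 8" and "\<sigma>' \<equiv> den Q probe_row \<sigma>"
    and "i \<equiv> fst \<sigma> 6" and "j \<equiv> fst \<sigma> 7"
  assumes M: "probes Q n k (fst \<sigma> 5) i j M" and ij: "i \<noteq> j" and u: "u < n"
    and B: "\<forall>x<k. x \<noteq> i \<longrightarrow> x \<noteq> j \<longrightarrow> snd \<sigma> 3 x = n"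
  shows "\<forall>x<k. x \<noteq> i \<longrightarrow> x \<noteq> j \<longrightarrow> snd \<sigma>' 3 x = n"
    "\<forall>x. x \<noteq> u \<longrightarrow> snd \<sigma>' 2 x = snd \<sigma> 2 x"
    "snd \<sigma>' 2 u < n \<and> M u (snd \<sigma>' 2 u) = M u u \<and> (\<forall>v<snd \<sigma>' 2 u. M u v \<noteq> M u u)"
proof -
  define I where "I = (\<lambda>t (\<tau>::state). (\<forall>x<k. x \<noteq> i \<longrightarrow> x \<noteq> j \<longrightarrow> snd \<tau> 3 x = n) \<and>
    (\<forall>x. x \<noteq> u \<longrightarrow> snd \<tau> 2 x = snd \<sigma> 2 x) \<and>
    (let c = snd \<tau> 2 u in if c = n then \<forall>v<t. M u v \<noteq> M u u
      else c < n \<and> c < t \<and> M u c = M u u \<and> (\<forall>v<c. M u v \<noteq> M u u)))"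
  let ?\<tau> = "set_cell 2 (fst \<sigma> 8) (fst \<sigma> 0) \<sigma>"
  have "I (fst ?\<tau> 0) \<sigma>'"
    unfolding \<sigma>'_def probe_row_def den.simps(3,4) eval_exp.simps(2)
  proof (rule den_for[where I = I], goal_cases)
    case (4 v \<rho>)
    have \<rho>: "fst \<rho> 0 = n" "fst \<rho> 5 = fst \<sigma> 5" "fst \<rho> 6 = i" "fst \<rho> 7 = j" "fst \<rho> 8 = u" "fst \<rho> 9 = v"
      using 4(3,4) by (auto simp: agree_off_def n_def i_def j_def u_def)
    have v: "v < n" using 4(1) by (simp add: n_def)
    have R: "\<forall>x<k. x \<noteq> i \<longrightarrow> x \<noteq> j \<longrightarrow> snd \<rho> 3 x = n" using 4(2) by (simp add: I_def)
    have c1: "check_query Q (fst \<sigma> 5) ((snd \<rho> 3)(i := u, j := v)) = M u v"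
      using M[unfolded probes_def, rule_format, of u v "(snd \<rho> 3)(i := u, j := v)"] u v R ij by simp
    have c2: "check_query Q (fst \<sigma> 5) ((snd \<rho> 3)(i := u, j := u)) = M u u"
      using M[unfolded probes_def, rule_format, of u u "(snd \<rho> 3)(i := u, j := u)"] u R ij by simp
    let ?body = "PStore 3 (Reg 6) (Reg 8) ;; PStore 3 (Reg 7) (Reg 9) ;; PCheck 10 (Reg 5) 3 ;;
       PStore 3 (Reg 7) (Reg 8) ;; PCheck 11 (Reg 5) 3 ;;
       PIf (conj_exp (eq_exp (Reg 10) (Reg 11)) (eq_exp (Cell 2 (Reg 8)) (Reg 0)))
         (PStore 2 (Reg 8) (Reg 9)) PSkip"
    have arr3: "snd (den Q ?body \<rho>) 3 = (snd \<rho> 3)(i := u, j := u)"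
      using \<rho> by simp
    have arr2: "snd (den Q ?body \<rho>) 2 =
        (snd \<rho> 2)(u := if M u v = M u u \<and> snd \<rho> 2 u = n then v else snd \<rho> 2 u)"
      using \<rho> c1 c2 by simp
    have c: "if snd \<rho> 2 u = n then \<forall>w<v. M u w \<noteq> M u u
      else snd \<rho> 2 u < n \<and> snd \<rho> 2 u < v \<and> M u (snd \<rho> 2 u) = M u u \<and> (\<forall>w<snd \<rho> 2 u. M u w \<noteq> M u u)"
      using 4(2) by (simp add: I_def Let_def)
    have c': "let c = snd (den Q ?body \<rho>) 2 u in if c = n then \<forall>w<Suc v. M u w \<noteq> M u u
      else c < n \<and> c < Suc v \<and> M u c = M u u \<and> (\<forall>w<c. M u w \<noteq> M u u)"
    proof (cases "snd \<rho> 2 u = n")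
      case True
      then show ?thesis using c v arr2 by (cases "M u v = M u u") (simp_all add: Let_def less_Suc_eq)
    next
      case False
      then show ?thesis using c arr2 by (simp add: Let_def less_Suc_eq)
    qed
    show ?case
      unfolding I_def set_reg_simps
    proof (intro conjI)
      show "\<forall>x<k. x \<noteq> i \<longrightarrow> x \<noteq> j \<longrightarrow> snd (den Q ?body \<rho>) 3 x = n" using R arr3 by simp
      show "\<forall>x. x \<noteq> u \<longrightarrow> snd (den Q ?body \<rho>) 2 x = snd \<sigma> 2 x" using 4(2) arr2 by (simp add: I_def)
    qed (rule c')
  qed (use B in \<open>auto simp: I_def n_def u_def\<close>)
  then have I: "I n \<sigma>'" by (simp add: n_def)
  then show "\<forall>x<k. x \<noteq> i \<longrightarrow> x \<noteq> j \<longrightarrow> snd \<sigma>' 3 x = n" "\<forall>x. x \<noteq> u \<longrightarrow> snd \<sigma>' 2 x = snd \<sigma> 2 x"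
    by (simp_all add: I_def)
  show "snd \<sigma>' 2 u < n \<and> M u (snd \<sigma>' 2 u) = M u u \<and> (\<forall>v<snd \<sigma>' 2 u. M u v \<noteq> M u u)"
  proof (cases "snd \<sigma>' 2 u = n")
    case True
    \<comment> \<open>The scan also passes \<open>u\<close> itself, where the two answers agree
      trivially, so the mark \<open>n\<close> for not found cannot survive.\<close>
    then have "\<forall>v<n. M u v \<noteq> M u u" using I by (simp add: I_def Let_def)
    then show ?thesis using u by blast
  next
    case False
    then show ?thesis using I by (simp add: I_def Let_def)
  qed
qed

lemma probe_spec:
  fixes \<sigma> :: state
  defines "n \<equiv> fst \<sigma> 0" and "k \<equiv> fst \<sigma> 1"
  assumes M: "probes Q n k (fst \<sigma> 5) (fst \<sigma> 6) (fst \<sigma> 7) M" and ij: "fst \<sigma> 6 \<noteq> fst \<sigma> 7"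
  shows "least_rel n M (snd (den Q probe \<sigma>) 2)"
proof -
  define \<tau> where "\<tau> = den Q (PFor 8 1 (PStore 3 (Reg 8) (Reg 0))) \<sigma>"
  have "\<forall>x<fst \<sigma> 1. snd \<tau> 3 x = n" unfolding \<tau>_def
  proof (rule den_for[where I = "\<lambda>i \<tau>. \<forall>x<i. snd \<tau> 3 x = n"], goal_cases)
    case (4 i \<rho>)
    then show ?case by (auto simp: less_Suc_eq agree_off_def n_def)
  qed auto
  then have B: "\<forall>x<k. snd \<tau> 3 x = n" by (simp add: k_def)
  have \<tau>: "fst \<tau> 0 = n" "fst \<tau> 1 = k" "fst \<tau> 5 = fst \<sigma> 5" "fst \<tau> 6 = fst \<sigma> 6" "fst \<tau> 7 = fst \<sigma> 7"
    by (simp_all add: \<tau>_def n_def k_def den_reg del: den.simps)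
  define I where "I = (\<lambda>t (\<rho>::state). (\<forall>x<k. x \<noteq> fst \<sigma> 6 \<longrightarrow> x \<noteq> fst \<sigma> 7 \<longrightarrow> snd \<rho> 3 x = n) \<and>
    (\<forall>u<t. snd \<rho> 2 u < n \<and> M u (snd \<rho> 2 u) = M u u \<and> (\<forall>v<snd \<rho> 2 u. M u v \<noteq> M u u)))"
  have "I (fst \<tau> 0) (den Q (PFor 8 0 probe_row) \<tau>)"
  proof (rule den_for[where I = I], goal_cases)
    case (4 t \<rho>)
    have \<rho>: "fst \<rho> 0 = n" "fst \<rho> 1 = k" "fst \<rho> 5 = fst \<sigma> 5" "fst \<rho> 6 = fst \<sigma> 6" "fst \<rho> 7 = fst \<sigma> 7"
      using \<tau> 4(4) by (auto simp: agree_off_def probe_row_def)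
    have t: "t < n" using 4(1) \<tau> by simp
    note s = probe_row_spec[of Q \<rho> M, unfolded \<rho> 4(3), OF M ij t]
    have "\<forall>x<k. x \<noteq> fst \<sigma> 6 \<longrightarrow> x \<noteq> fst \<sigma> 7 \<longrightarrow> snd \<rho> 3 x = n" using 4(2) by (simp add: I_def)
    note s = s[OF this]
    show ?case
      unfolding I_def set_reg_simps
    proof (intro conjI)
      show "\<forall>u<Suc t. snd (den Q probe_row \<rho>) 2 u < n \<and>
          M u (snd (den Q probe_row \<rho>) 2 u) = M u u \<and>
          (\<forall>v<snd (den Q probe_row \<rho>) 2 u. M u v \<noteq> M u u)"
      proof (intro allI impI)
        fix u assume "u < Suc t"
        then consider "u = t" | "u < t" "u \<noteq> t" by linarith
        then show "snd (den Q probe_row \<rho>) 2 u < n \<and>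
          M u (snd (den Q probe_row \<rho>) 2 u) = M u u \<and>
          (\<forall>v<snd (den Q probe_row \<rho>) 2 u. M u v \<noteq> M u u)"
          using s(2,3) 4(2) by cases (auto simp: I_def)
      qed
    qed (rule s(1))
  qed (use B in \<open>auto simp: I_def probe_row_def\<close>)
  then show ?thesis
    unfolding least_rel_def probe_def den.simps(4) \<tau>_def[symmetric] using \<tau> by (simp add: I_def)
qed

lemma trivial_classes_spec: "\<forall>u<fst \<sigma> 0. snd (den Q trivial_classes \<sigma>) 2 u = 0"
  unfolding trivial_classes_def
  by (rule den_for[where I = "\<lambda>i \<tau>. \<forall>u<i. snd \<tau> 2 u = 0"]) (auto simp: less_Suc_eq)

section \<open>Composing search steps\<close>

definition found_ok :: "queries \<Rightarrow> nat \<Rightarrow> nat \<Rightarrow> nat \<Rightarrow> (nat \<Rightarrow> nat) \<Rightarrow> state \<Rightarrow> bool" where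
  "found_ok Q n k m D \<sigma> \<longleftrightarrow> fst \<sigma> 0 = n \<and> fst \<sigma> 1 = k \<and> fst \<sigma> 2 = m \<and> snd \<sigma> 1 = D \<and>
     (fst \<sigma> 4 \<noteq> 0 \<longrightarrow> accepted Q k m (snd \<sigma> 0))"

text \<open>The verdict in register 4 is monotone: once set it stays set. This makes the property
  compositional, as one successful step anywhere in a sequence or loop suffices.\<close>

definition searches :: "queries \<Rightarrow> prog \<Rightarrow> (state \<Rightarrow> bool) \<Rightarrow> (state \<Rightarrow> bool) \<Rightarrow> bool" where
  "searches Q p ok goal \<longleftrightarrow> (\<forall>\<sigma>. ok \<sigma> \<longrightarrow> ok (den Q p \<sigma>) \<and>
     (fst \<sigma> 4 \<noteq> 0 \<or> goal \<sigma> \<longrightarrow> fst (den Q p \<sigma>) 4 \<noteq> 0))"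

lemma searches_seq:
  assumes "searches Q p ok goal" "searches Q q ok goal'"
    and "\<And>\<sigma>. goal'' \<sigma> \<Longrightarrow> goal \<sigma> \<or> (\<forall>\<sigma>'. agree_off (wregs p) (warrs p) \<sigma> \<sigma>' \<longrightarrow> goal' \<sigma>')"
  shows "searches Q (p ;; q) ok goal''"
  using assms agree_off_den[of p _ Q] unfolding searches_def den.simps(4) by blast

text \<open>Earlier rounds may have changed anything the body writes, so the goal of the good round
  \<open>i\<close> is required in every state that the frame allows with counter
  \<open>i\<close>.\<close>

lemma searches_for:
  assumes p: "searches Q p ok goal"
    and ok: "\<And>\<sigma> v. ok \<sigma> \<Longrightarrow> ok (set_reg x v \<sigma>)"
    and x: "x \<notin> wregs p" "r \<notin> insert x (wregs p)" "x \<noteq> 4"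
    and goal: "\<And>\<sigma>. goal' \<sigma> \<Longrightarrow> \<exists>i<fst \<sigma> r. \<forall>\<sigma>'.
       agree_off (insert x (wregs p)) (warrs p) \<sigma> \<sigma>' \<longrightarrow> fst \<sigma>' x = i \<longrightarrow> goal \<sigma>'"
  shows "searches Q (PFor x r p) ok goal'"
  unfolding searches_def
proof (intro allI impI)
  fix \<sigma> assume \<sigma>: "ok \<sigma>"
  define I where "I = (\<lambda>i (\<tau>::state). ok \<tau> \<and> (fst \<sigma> 4 \<noteq> 0 \<longrightarrow> fst \<tau> 4 \<noteq> 0) \<and>
    ((\<exists>j<i. \<forall>\<sigma>'. agree_off (insert x (wregs p)) (warrs p) \<sigma> \<sigma>' \<longrightarrow> fst \<sigma>' x = j \<longrightarrow> goal \<sigma>')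
       \<longrightarrow> fst \<tau> 4 \<noteq> 0))"
  have "I (fst \<sigma> r) (den Q (PFor x r p) \<sigma>)"
  proof (rule den_for[where I = I, OF x(1,2)])
    show "I 0 (set_reg x 0 \<sigma>)" using \<sigma> ok x by (simp add: I_def)
  next
    fix i \<rho>
    assume h: "I i \<rho>" "fst \<rho> x = i" "agree_off (insert x (wregs p)) (warrs p) \<sigma> \<rho>"
    have ok\<rho>: "ok \<rho>" using h(1) by (simp add: I_def)
    have s: "ok (den Q p \<rho>)" "fst \<rho> 4 \<noteq> 0 \<or> goal \<rho> \<Longrightarrow> fst (den Q p \<rho>) 4 \<noteq> 0"
      using p ok\<rho> unfolding searches_def by blast+
    have "fst (den Q p \<rho>) 4 \<noteq> 0"
      if "j < Suc i" "\<forall>\<sigma>'. agree_off (insert x (wregs p)) (warrs p) \<sigma> \<sigma>' \<longrightarrow> fst \<sigma>' x = j \<longrightarrow> goal \<sigma>'" for j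
    proof (cases "j = i")
      case True
      then show ?thesis using that(2) h s(2) by blast
    next
      case False
      then have "j < i" using that(1) by simp
      then have "fst \<rho> 4 \<noteq> 0" using h(1) that(2) unfolding I_def by blast
      then show ?thesis using s(2) by blast
    qed
    then show "I (Suc i) (set_reg x (Suc i) (den Q p \<rho>))"
      using s h(1) ok x(3) unfolding I_def by auto
  qed
  then show "ok (den Q (PFor x r p) \<sigma>) \<and>
     (fst \<sigma> 4 \<noteq> 0 \<or> goal' \<sigma> \<longrightarrow> fst (den Q (PFor x r p) \<sigma>) 4 \<noteq> 0)"
    unfolding I_def using goal by blast
qed

lemma realize_searches:
  "searches Q realize (found_ok Q n k m D) (\<lambda>\<sigma>. succeeds Q n k m D (snd \<sigma> 2))"
  unfolding searches_def
proof (intro allI impI)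
  fix \<sigma> assume ok: "found_ok Q n k m D \<sigma>"
  let ?\<sigma> = "den Q realize \<sigma>"
  have "fst ?\<sigma> 0 = n" "fst ?\<sigma> 1 = k" "fst ?\<sigma> 2 = m" "snd ?\<sigma> 1 = D"
    using ok by (auto simp: found_ok_def den_reg den_arr realize_writes outer_writes inner_writes)
  then show "found_ok Q n k m D ?\<sigma> \<and>
     (fst \<sigma> 4 \<noteq> 0 \<or> succeeds Q n k m D (snd \<sigma> 2) \<longrightarrow> fst ?\<sigma> 4 \<noteq> 0)"
    using ok realize_spec[where Q = Q and \<sigma> = \<sigma>] unfolding found_ok_def by (cases "fst \<sigma> 4 = 0") auto
qed

lemma probe_writes: "wregs probe = {8, 9, 10, 11}" "warrs probe = {2, 3}"
  by (auto simp: probe_def probe_row_def)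

lemma trivial_classes_writes: "wregs trivial_classes = {8}" "warrs trivial_classes = {2}"
  by (auto simp: trivial_classes_def)

text \<open>Class maps are universally quantified because the machine determines array 2 only on
  positions below \<open>n\<close>; elsewhere it may contain anything.\<close>

definition hits :: "queries \<Rightarrow> nat \<Rightarrow> nat \<Rightarrow> nat \<Rightarrow> (nat \<Rightarrow> nat) \<Rightarrow> bool" where
  "hits Q n k m D \<longleftrightarrow>
     (\<forall>cls. (\<forall>u<n. cls u = 0) \<longrightarrow> succeeds Q n k m D cls) \<or>
     (\<exists>l<m. \<exists>i<k. \<exists>j<k. i \<noteq> j \<and> (\<exists>M. probes Q n k l i j M \<and>
        (\<forall>cls. least_rel n M cls \<longrightarrow> succeeds Q n k m D cls)))"

lemma found_ok_set_reg: "found_ok Q n k m D \<sigma> \<Longrightarrow> x \<notin> {0, 1, 2, 4} \<Longrightarrow> found_ok Q n k m D (set_reg x v \<sigma>)"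
  by (auto simp: found_ok_def)

lemma search_searches:
  "searches Q search (found_ok Q n k m D) (\<lambda>\<sigma>. found_ok Q n k m D \<sigma> \<and> hits Q n k m D)"
proof -
  have re: "found_ok Q n k m D (den Q realize \<tau>) \<and>
      (fst \<tau> 4 \<noteq> 0 \<or> succeeds Q n k m D (snd \<tau> 2) \<longrightarrow> fst (den Q realize \<tau>) 4 \<noteq> 0)"
    if "found_ok Q n k m D \<tau>" for \<tau>
    using realize_searches[of Q n k m D] that unfolding searches_def by blast
  have triv: "searches Q (trivial_classes ;; realize) (found_ok Q n k m D)
      (\<lambda>_. \<forall>cls. (\<forall>u<n. cls u = 0) \<longrightarrow> succeeds Q n k m D cls)"
    unfolding searches_def
  proof (intro allI impI)
    fix \<sigma> assume ok: "found_ok Q n k m D \<sigma>"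
    let ?\<tau> = "den Q trivial_classes \<sigma>"
    have "found_ok Q n k m D ?\<tau>" "fst ?\<tau> 4 = fst \<sigma> 4"
      using ok by (simp_all add: found_ok_def den_reg den_arr trivial_classes_writes)
    moreover have "\<forall>u<n. snd ?\<tau> 2 u = 0"
      using trivial_classes_spec[of \<sigma> Q] ok by (simp add: found_ok_def)
    ultimately show "found_ok Q n k m D (den Q (trivial_classes ;; realize) \<sigma>) \<and>
        (fst \<sigma> 4 \<noteq> 0 \<or> (\<forall>cls. (\<forall>u<n. cls u = 0) \<longrightarrow> succeeds Q n k m D cls) \<longrightarrow>
          fst (den Q (trivial_classes ;; realize) \<sigma>) 4 \<noteq> 0)"
      using re[of ?\<tau>] unfolding den.simps(4) by auto
  qed
  define G where "G = (\<lambda>l i j. i \<noteq> j \<and> (\<exists>M. probes Q n k l i j M \<and>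
        (\<forall>cls. least_rel n M cls \<longrightarrow> succeeds Q n k m D cls)))"
  have pr: "searches Q (probe ;; realize) (found_ok Q n k m D) (\<lambda>\<sigma>. G (fst \<sigma> 5) (fst \<sigma> 6) (fst \<sigma> 7))"
    unfolding searches_def
  proof (intro allI impI)
    fix \<sigma> assume ok: "found_ok Q n k m D \<sigma>"
    let ?\<tau> = "den Q probe \<sigma>"
    have "found_ok Q n k m D ?\<tau>" "fst ?\<tau> 4 = fst \<sigma> 4"
      using ok by (simp_all add: found_ok_def den_reg den_arr probe_writes)
    moreover have "G (fst \<sigma> 5) (fst \<sigma> 6) (fst \<sigma> 7) \<Longrightarrow> succeeds Q n k m D (snd ?\<tau> 2)"
      using probe_spec[of Q \<sigma>] ok unfolding G_def found_ok_def by blast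
    ultimately show "found_ok Q n k m D (den Q (probe ;; realize) \<sigma>) \<and>
        (fst \<sigma> 4 \<noteq> 0 \<or> G (fst \<sigma> 5) (fst \<sigma> 6) (fst \<sigma> 7) \<longrightarrow> fst (den Q (probe ;; realize) \<sigma>) 4 \<noteq> 0)"
      using re[of ?\<tau>] unfolding den.simps(4) by auto
  qed
  note writes = probe_writes realize_writes outer_writes inner_writes
  let ?p7 = "PFor 7 1 (probe ;; realize)"
  let ?p6 = "PFor 6 1 ?p7"
  have s7: "searches Q ?p7 (found_ok Q n k m D)
      (\<lambda>\<sigma>. fst \<sigma> 1 = k \<and> (\<exists>j<k. G (fst \<sigma> 5) (fst \<sigma> 6) j))"
  proof (rule searches_for[OF pr], goal_cases)
    case (5 \<sigma>)
    then obtain j where j: "j < k" "G (fst \<sigma> 5) (fst \<sigma> 6) j" "fst \<sigma> 1 = k" by blast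
    have "fst \<sigma>' 5 = fst \<sigma> 5 \<and> fst \<sigma>' 6 = fst \<sigma> 6"
      if "agree_off (insert 7 (wregs (probe ;; realize))) (warrs (probe ;; realize)) \<sigma> \<sigma>'" for \<sigma>'
      using that by (simp add: writes agree_off_def)
    then show ?case using j by metis
  qed (simp_all add: writes found_ok_set_reg)
  have s6: "searches Q ?p6 (found_ok Q n k m D)
      (\<lambda>\<sigma>. fst \<sigma> 1 = k \<and> (\<exists>i<k. \<exists>j<k. G (fst \<sigma> 5) i j))"
  proof (rule searches_for[OF s7], goal_cases)
    case (5 \<sigma>)
    then obtain i where i: "i < k" "\<exists>j<k. G (fst \<sigma> 5) i j" "fst \<sigma> 1 = k" by blast
    have "fst \<sigma>' 5 = fst \<sigma> 5 \<and> fst \<sigma>' 1 = fst \<sigma> 1"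
      if "agree_off (insert 6 (wregs ?p7)) (warrs ?p7) \<sigma> \<sigma>'" for \<sigma>'
      using that by (simp add: writes agree_off_def)
    then show ?case using i by metis
  qed (simp_all add: writes found_ok_set_reg)
  have s5: "searches Q (PFor 5 2 ?p6) (found_ok Q n k m D)
      (\<lambda>\<sigma>. fst \<sigma> 1 = k \<and> fst \<sigma> 2 = m \<and> (\<exists>l<m. \<exists>i<k. \<exists>j<k. G l i j))"
  proof (rule searches_for[OF s6], goal_cases)
    case (5 \<sigma>)
    then obtain l where l: "l < m" "\<exists>i<k. \<exists>j<k. G l i j" "fst \<sigma> 1 = k" "fst \<sigma> 2 = m" by blast
    have "fst \<sigma>' 1 = fst \<sigma> 1"
      if "agree_off (insert 5 (wregs ?p6)) (warrs ?p6) \<sigma> \<sigma>'" for \<sigma>'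
      using that by (simp add: writes agree_off_def)
    then show ?case using l by metis
  qed (simp_all add: writes found_ok_set_reg)
  show ?thesis unfolding search_def
  proof (rule searches_seq[OF triv s5], goal_cases)
    case (1 \<sigma>)
    have "fst \<sigma>' 1 = fst \<sigma> 1 \<and> fst \<sigma>' 2 = fst \<sigma> 2"
      if "agree_off (wregs (trivial_classes ;; realize)) (warrs (trivial_classes ;; realize)) \<sigma> \<sigma>'" for \<sigma>'
      using that by (simp add: writes trivial_classes_writes agree_off_def)
    moreover have "fst \<sigma> 1 = k" "fst \<sigma> 2 = m" using 1 by (simp_all add: found_ok_def)
    moreover have "(\<forall>cls. (\<forall>u<n. cls u = 0) \<longrightarrow> succeeds Q n k m D cls) \<or> (\<exists>l<m. \<exists>i<k. \<exists>j<k. G l i j)"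
      using 1 unfolding hits_def G_def by blast
    ultimately show ?case by metis
  qed
qed

section \<open>Enumerating the digit arrays\<close>

definition digit :: "nat \<Rightarrow> nat \<Rightarrow> nat \<Rightarrow> nat" where
  "digit b t i = t div b ^ i mod b"

text \<open>Zero beyond \<open>k\<close> is what the initial array contains and what the odometer
  leaves there, so array 1 equals \<open>digits k t\<close> as a function.\<close>

definition digits :: "nat \<Rightarrow> nat \<Rightarrow> nat \<Rightarrow> nat" where
  "digits k t i = (if i < k then digit (2 * k) t i else 0)"

lemma digits_surj:
  assumes "\<And>i. i < j \<Longrightarrow> d i < b"
  shows "\<exists>t<b ^ j. \<forall>i<j. digit b t i = d i"
  using assms
proof (induction j)
  case (Suc j)
  then obtain t where t: "t < b ^ j" "\<forall>i<j. digit b t i = d i" by auto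
  have d: "d j < b" using Suc.prems by simp
  then have b: "0 < b" by simp
  let ?t = "t + d j * b ^ j"
  have "?t < b ^ j + d j * b ^ j" using t by simp
  also have "\<dots> = Suc (d j) * b ^ j" by simp
  also have "\<dots> \<le> b * b ^ j" using d by (intro mult_le_mono1) simp
  finally have "?t < b ^ Suc j" by simp
  moreover have "digit b ?t i = d i" if i: "i < Suc j" for i
  proof (cases "i = j")
    case True
    then show ?thesis using t(1) d b by (simp add: digit_def)
  next
    case False
    then have "i < j" using i by simp
    then obtain r where r: "j = i + Suc r" using less_imp_Suc_add by auto
    \<comment> \<open>After division by \<open>b ^ i\<close> the new leading term is still a
      multiple of \<open>b\<close>, so it does not affect the digit at \<open>i\<close>.\<close>
    have eq: "?t = t + (b * (d j * b ^ r)) * b ^ i" by (simp add: r power_add)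
    have "?t div b ^ i = b * (d j * b ^ r) + t div b ^ i" unfolding eq using b by simp
    then show ?thesis using t(2) \<open>i < j\<close> by (simp add: digit_def)
  qed
  ultimately show ?case by blast
qed simp

text \<open>The carry enters digit \<open>i\<close> exactly when all lower digits have wrapped to
  zero, that is, when \<open>(2 * k) ^ i\<close> divides \<open>Suc t\<close>. This is the loop
  invariant for register 3.\<close>

lemma odometer_spec:
  fixes \<sigma> :: state and Q :: queries
  defines "k \<equiv> fst \<sigma> 1" and "\<sigma>' \<equiv> den Q odometer \<sigma>"
  assumes D: "snd \<sigma> 1 = digits k t"
  shows "snd \<sigma>' 1 = digits k (Suc t)" "fst \<sigma>' 3 = of_bool ((2 * k) ^ k dvd Suc t)"
proof -
  define b where "b = 2 * k"
  define I where "I = (\<lambda>i (\<tau>::state). fst \<tau> 3 = of_bool (b ^ i dvd Suc t) \<and>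
    (\<forall>x. snd \<tau> 1 x = (if x < i then digits k (Suc t) x else digits k t x)))"
  let ?\<tau> = "set_reg 3 1 \<sigma>"
  have "I (fst ?\<tau> 1) \<sigma>'"
    unfolding \<sigma>'_def odometer_def den.simps(2,4) eval_exp.simps(1)
  proof (rule den_for[where I = I], goal_cases)
    case (4 i \<rho>)
    have ik: "i < k" using 4(1) by (simp add: k_def)
    then have b: "0 < b" by (simp add: b_def)
    have \<rho>: "fst \<rho> 1 = k" "fst \<rho> 18 = i" using 4(3,4) by (auto simp: agree_off_def k_def)
    have c: "fst \<rho> 3 = of_bool (b ^ i dvd Suc t)" using 4(2) by (simp add: I_def)
    have cell: "snd \<rho> 1 i = digit b t i" using 4(2) ik by (simp add: I_def digits_def b_def)
    have dg: "digits k s i = digit b s i" for s using ik by (simp add: digits_def b_def)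
    have lt: "digit b t i < b" using b by (simp add: digit_def)
    have dS: "digit b (Suc t) i =
       (if b ^ i dvd Suc t then if Suc (digit b t i) = b then 0 else Suc (digit b t i) else digit b t i)"
      by (simp add: digit_def div_Suc mod_Suc dvd_eq_mod_eq_0)
    have carry: "b ^ Suc i dvd Suc t \<longleftrightarrow> b ^ i dvd Suc t \<and> Suc (digit b t i) = b"
    proof (cases "b ^ i dvd Suc t")
      case True
      then obtain s where s: "Suc t = b ^ i * s" by blast
      have "b ^ Suc i dvd Suc t \<longleftrightarrow> b dvd s" unfolding s using b by (simp add: mult.commute)
      also have "\<dots> \<longleftrightarrow> digit b (Suc t) i = 0" unfolding s using b by (simp add: digit_def dvd_eq_mod_eq_0)
      finally show ?thesis using True dS by simp
    next
      case False
      then show ?thesis using dvd_mult_right by (metis power_Suc)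
    qed
    have rest: "\<forall>x. x \<noteq> i \<longrightarrow> snd \<rho> 1 x = (if x < Suc i then digits k (Suc t) x else digits k t x)"
      using 4(2) by (auto simp: I_def less_Suc_eq)
    have test: "k + k - 1 - digit b t i = 0 \<longleftrightarrow> Suc (digit b t i) = b"
      using lt by (auto simp: b_def)
    let ?body = "PIf (Reg 3)
       (PIf (Sub (Sub (Add (Reg 1) (Reg 1)) (Const 1)) (Cell 1 (Reg 18)))
          (PStore 1 (Reg 18) (Add (Cell 1 (Reg 18)) (Const 1)) ;; PAssign 3 (Const 0))
          (PStore 1 (Reg 18) (Const 0)))
       PSkip"
    have "snd (den Q ?body \<rho>) 1 = (snd \<rho> 1)(i := digit b (Suc t) i)"
      using \<rho> c cell test dS by (simp add: fun_upd_idem)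
    moreover have "fst (den Q ?body \<rho>) 3 = of_bool (b ^ Suc i dvd Suc t)"
      unfolding carry using \<rho> c cell test by simp
    ultimately show ?case
      unfolding I_def set_reg_simps using rest dg by simp
  qed (use D in \<open>auto simp: I_def\<close>)
  then have I: "I k \<sigma>'" by (simp add: k_def)
  then show "fst \<sigma>' 3 = of_bool ((2 * k) ^ k dvd Suc t)" by (simp add: I_def b_def)
  show "snd \<sigma>' 1 = digits k (Suc t)"
    using I by (auto simp: I_def digits_def)
qed

lemma wf_search: "wf_prog search"
  by (simp add: search_def probe_def probe_row_def trivial_classes_def wf_realize
     realize_writes outer_writes inner_writes)

lemma wf_odometer: "wf_prog odometer"
  by (simp add: odometer_def)

lemma solver_spec:
  fixes Q :: queries and n k m :: nat
  defines "T \<equiv> cost (search ;; odometer) (dims n k m) (real (query_time Q))"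
  shows "\<exists>t \<sigma>. exec Q solver (input_state n k m) t \<sigma> \<and>
    (fst \<sigma> 0 \<noteq> 0 \<longrightarrow> accepted Q k m (snd \<sigma> 0)) \<and>
    (\<forall>t<(2 * k) ^ k. hits Q n k m (digits k t) \<longrightarrow> fst \<sigma> 0 \<noteq> 0) \<and>
    real t \<le> (T + 12) * real ((2 * k) ^ k)"
proof -
  let ?N = "(2 * k) ^ k"
  let ?body = "search ;; odometer"
  let ?w = "While (Sub (Const 1) (Reg 3)) (compile ?body)"
  have N: "0 < ?N" by (cases "k = 0") simp_all
  have T: "0 \<le> T" unfolding T_def by (rule cost_nonneg) (auto simp: dims_def)
  have body: "\<exists>t. exec Q (compile ?body) \<sigma> t (den Q ?body \<sigma>) \<and> real t \<le> T" if "found_ok Q n k m D \<sigma>" for \<sigma> D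
  proof -
    have wf: "wf_prog ?body" by (simp add: wf_search wf_odometer)
    have "real (fst \<sigma> r) = dims n k m r" if "r \<le> 2" for r
      using that \<open>found_ok Q n k m D \<sigma>\<close> by (auto simp: dims_def found_ok_def le_Suc_eq numeral_2_eq_2)
    then have "cost ?body (\<lambda>r. real (fst \<sigma> r)) (real (query_time Q)) = T"
      unfolding T_def by (intro cost_cong[OF wf])
    then show ?thesis using exec_compile[OF wf, of Q \<sigma>] by simp
  qed
  have step: "found_ok Q n k m (digits k (Suc s)) \<sigma>' \<and> fst \<sigma>' 3 = of_bool (Suc s = ?N) \<and>
      (fst \<sigma> 4 \<noteq> 0 \<or> hits Q n k m (digits k s) \<longrightarrow> fst \<sigma>' 4 \<noteq> 0)"
    if s: "s < ?N" and ok: "found_ok Q n k m (digits k s) \<sigma>" and \<sigma>': "\<sigma>' = den Q ?body \<sigma>" for s \<sigma> \<sigma>'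
  proof -
    define \<tau> where "\<tau> = den Q search \<sigma>"
    have \<tau>: "found_ok Q n k m (digits k s) \<tau>"
        "fst \<sigma> 4 \<noteq> 0 \<or> hits Q n k m (digits k s) \<Longrightarrow> fst \<tau> 4 \<noteq> 0"
      using search_searches[of Q n k m "digits k s"] ok unfolding searches_def \<tau>_def by blast+
    have eq: "\<sigma>' = den Q odometer \<tau>" by (simp add: \<sigma>' \<tau>_def)
    have D: "snd \<tau> 1 = digits (fst \<tau> 1) s" and k: "fst \<tau> 1 = k" using \<tau>(1) by (simp_all add: found_ok_def)
    have "?N dvd Suc s \<longleftrightarrow> Suc s = ?N" using s by (auto dest: dvd_imp_le)
    moreover have "fst \<sigma>' 0 = fst \<tau> 0" "fst \<sigma>' 1 = fst \<tau> 1" "fst \<sigma>' 2 = fst \<tau> 2" "fst \<sigma>' 4 = fst \<tau> 4"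
        "snd \<sigma>' 0 = snd \<tau> 0"
      unfolding eq by (auto simp: den_reg den_arr odometer_def simp del: den.simps)
    ultimately show ?thesis
      using odometer_spec[OF D, of Q] \<tau> k unfolding eq[symmetric] found_ok_def by simp
  qed
  \<comment> \<open>\<open>j\<close> counts the rounds after the present one. The loop is left only
    when a round has produced the final carry, so one round is always due; for \<open>k = 0\<close>
    it is the only one.\<close>
  have loop: "\<lbrakk>s + Suc j = ?N; found_ok Q n k m (digits k s) \<sigma>; fst \<sigma> 3 = 0;
      \<forall>r<s. hits Q n k m (digits k r) \<longrightarrow> fst \<sigma> 4 \<noteq> 0\<rbrakk> \<Longrightarrow>
    \<exists>t \<sigma>'. exec Q ?w \<sigma> t \<sigma>' \<and> (fst \<sigma>' 4 \<noteq> 0 \<longrightarrow> accepted Q k m (snd \<sigma>' 0)) \<and>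
      (\<forall>r<?N. hits Q n k m (digits k r) \<longrightarrow> fst \<sigma>' 4 \<noteq> 0) \<and>
      real t \<le> 4 + (T + 4) * real (Suc j)" for j s \<sigma>
  proof (induction j arbitrary: s \<sigma>)
    case (0 s \<sigma>)
    then have s: "s < ?N" by simp
    define \<sigma>1 where "\<sigma>1 = den Q ?body \<sigma>"
    note st = step[OF s 0(2) \<sigma>1_def]
    obtain t where t: "exec Q (compile ?body) \<sigma> t \<sigma>1" "real t \<le> T"
      using body[OF 0(2)] unfolding \<sigma>1_def by blast
    have ne: "eval_exp (Sub (Const 1) (Reg 3)) \<sigma> \<noteq> 0" using 0(3) by simp
    have z: "eval_exp (Sub (Const 1) (Reg 3)) \<sigma>1 = 0" using st 0(1) by simp
    have "fst \<sigma>1 4 \<noteq> 0" if "r < ?N" "hits Q n k m (digits k r)" for r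
    proof (cases "r = s")
      case True
      then show ?thesis using st that by blast
    next
      case False
      then have "r < s" using that(1) 0(1) by simp
      then show ?thesis using st 0(4) that(2) by blast
    qed
    moreover have "fst \<sigma>1 4 \<noteq> 0 \<longrightarrow> accepted Q k m (snd \<sigma>1 0)" using st by (simp add: found_ok_def)
    moreover note exec.While_True[OF ne t(1) exec.While_False[OF z]]
    moreover have "real (1 + exp_time (Sub (Const 1) (Reg 3)) + t + (1 + exp_time (Sub (Const 1) (Reg 3))))
        \<le> 4 + (T + 4) * real (Suc 0)"
      using t(2) by simp
    ultimately show ?case by blast
  next
    case (Suc j s \<sigma>)
    then have s: "s < ?N" by simp
    define \<sigma>1 where "\<sigma>1 = den Q ?body \<sigma>"
    note st = step[OF s Suc.prems(2) \<sigma>1_def]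
    obtain t where t: "exec Q (compile ?body) \<sigma> t \<sigma>1" "real t \<le> T"
      using body[OF Suc.prems(2)] unfolding \<sigma>1_def by blast
    have ne: "eval_exp (Sub (Const 1) (Reg 3)) \<sigma> \<noteq> 0" using Suc.prems(3) by simp
    have "fst \<sigma>1 3 = 0" using st Suc.prems(1) by simp
    moreover have "\<forall>r<Suc s. hits Q n k m (digits k r) \<longrightarrow> fst \<sigma>1 4 \<noteq> 0"
      using st Suc.prems(4) less_Suc_eq by blast
    moreover have "Suc s + Suc j = ?N" using Suc.prems(1) by simp
    ultimately obtain t' \<sigma>' where w: "exec Q ?w \<sigma>1 t' \<sigma>'" "fst \<sigma>' 4 \<noteq> 0 \<longrightarrow> accepted Q k m (snd \<sigma>' 0)"
        "\<forall>r<?N. hits Q n k m (digits k r) \<longrightarrow> fst \<sigma>' 4 \<noteq> 0" "real t' \<le> 4 + (T + 4) * real (Suc j)"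
      using Suc.IH[of "Suc s" \<sigma>1] st by blast
    note exec.While_True[OF ne t(1) w(1)]
    moreover have "real (1 + exp_time (Sub (Const 1) (Reg 3)) + t + t') \<le> 4 + (T + 4) * real (Suc (Suc j))"
      using t(2) w(4) by (simp add: algebra_simps)
    ultimately show ?case using w(2,3) by blast
  qed
  let ?\<sigma>0 = "input_state n k m"
  have "found_ok Q n k m (digits k 0) ?\<sigma>0"
    by (auto simp: found_ok_def input_state_def digits_def digit_def)
  moreover have "fst ?\<sigma>0 3 = 0" by (simp add: input_state_def)
  moreover have sN: "Suc (?N - 1) = ?N" using N by (rule Suc_diff_1)
  then have "0 + Suc (?N - 1) = ?N" by (simp only: add_0)
  ultimately obtain t \<sigma> where w: "exec Q ?w ?\<sigma>0 t \<sigma>" "fst \<sigma> 4 \<noteq> 0 \<longrightarrow> accepted Q k m (snd \<sigma> 0)"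
      "\<forall>r<?N. hits Q n k m (digits k r) \<longrightarrow> fst \<sigma> 4 \<noteq> 0" "real t \<le> 4 + (T + 4) * real (Suc (?N - 1))"
    using loop[of 0 "?N - 1" ?\<sigma>0] by blast
  have e: "exec Q solver ?\<sigma>0 (3 + t) (set_reg 0 (fst \<sigma> 4) \<sigma>)"
    using exec.Seq[OF w(1) exec.Assign[of Q 0 "Reg 4"]]
    by (simp add: solver_def eval_nat_numeral)
  \<comment> \<open>Outside the rounds 7 units are spent: the failing test (4), sequencing (1) and
    the last assignment (2). As there is at least one round, raising the cost per round from
    \<open>T + 4\<close> to \<open>T + 12\<close> covers them.\<close>
  have "1 \<le> real ?N" using N by linarith
  moreover have "real t \<le> 4 + (T + 4) * real ?N" using w(4) unfolding sN .
  ultimately have "real (3 + t) \<le> (T + 12) * real ?N" by (simp add: algebra_simps)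
  with e show ?thesis
    by (intro exI[of _ "3 + t"] exI[of _ "set_reg 0 (fst \<sigma> 4) \<sigma>"]) (use w in auto)
qed

section \<open>The pattern of a plan\<close>

text \<open>The least index is sought among all naturals but is at most \<open>i\<close>, so for
  \<open>i < k\<close> the values of \<open>f\<close> from \<open>k\<close> on have no
  influence.\<close>

definition user_leader :: "(nat \<Rightarrow> nat) \<Rightarrow> nat \<Rightarrow> nat" where
  "user_leader f i = (LEAST j. f j = f i)"

definition class_leader :: "(nat \<Rightarrow> 'c) \<Rightarrow> (nat \<Rightarrow> nat) \<Rightarrow> nat \<Rightarrow> nat" where
  "class_leader cl f i = (LEAST j. cl (f j) = cl (f i))"

text \<open>The type of \<open>cl\<close> is left open: it will be the equivalence class of a user,
  or a constant of type \<open>unit\<close> when a single class is enough.\<close>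

definition pattern :: "nat \<Rightarrow> (nat \<Rightarrow> 'c) \<Rightarrow> (nat \<Rightarrow> nat) \<Rightarrow> nat \<Rightarrow> nat" where
  "pattern k cl f i = (if i < k then
     if user_leader f i = i then class_leader cl f i + k else user_leader f i else 0)"

lemma user_leader:
  "f (user_leader f i) = f i" "user_leader f i \<le> i" "f i = f j \<Longrightarrow> user_leader f i = user_leader f j"
  unfolding user_leader_def by (auto intro: LeastI Least_le)

lemma user_leader_eq_iff: "user_leader f i = user_leader f j \<longleftrightarrow> f i = f j"
  using user_leader(1,3) by metis

lemma class_leader:
  "cl (f (class_leader cl f i)) = cl (f i)" "class_leader cl f i \<le> i"
  "cl (f i) = cl (f j) \<Longrightarrow> class_leader cl f i = class_leader cl f j"
  unfolding class_leader_def by (rule LeastI[of _ i], auto intro: Least_le)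

lemma class_leader_eq_iff: "class_leader cl f i = class_leader cl f j \<longleftrightarrow> cl (f i) = cl (f j)"
  using class_leader(1,3) by metis

text \<open>Equal users lie in equal classes, so the earliest task of a class is also the earliest
  task of its user. This is why a class leader can be recognized by the digit \<open>c + k\<close>
  at \<open>c\<close> itself.\<close>

lemma user_leader_class_leader: "user_leader f (class_leader cl f i) = class_leader cl f i"
proof (rule antisym)
  have "cl (f (user_leader f (class_leader cl f i))) = cl (f i)"
    by (simp add: user_leader(1) class_leader(1))
  then show "class_leader cl f i \<le> user_leader f (class_leader cl f i)"
    unfolding class_leader_def[of cl f i] by (rule Least_le)
qed (rule user_leader(2))

lemma leaders_pattern:
  "leaders k (pattern k cl f) c = {a. a < k \<and> user_leader f a = a \<and> class_leader cl f a = c}"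
proof (rule set_eqI)
  fix a
  show "a \<in> leaders k (pattern k cl f) c \<longleftrightarrow>
      a \<in> {a. a < k \<and> user_leader f a = a \<and> class_leader cl f a = c}"
    using user_leader(2)[of f a] by (auto simp: leaders_def pattern_def)
qed

lemma class_leaders_pattern: "class_leaders k (pattern k cl f) = {c. c < k \<and> class_leader cl f c = c}"
proof -
  have "class_leaders k (pattern k cl f) = {c. c < k \<and> c \<in> leaders k (pattern k cl f) c}"
    by (auto simp: class_leaders_def leaders_def)
  also have "\<dots> = {c. c < k \<and> class_leader cl f c = c}"
    unfolding leaders_pattern using user_leader_class_leader[of f cl] by (auto, metis)
  finally show ?thesis .
qed

lemma pattern_digits: "if i < k then pattern k cl f i < 2 * k else pattern k cl f i = 0"
  using user_leader(2)[of f i] class_leader(2)[of cl f i] by (simp add: pattern_def)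

lemma pattern_follower:
  assumes "i < k" "a < k" "pattern k cl f i = a"
  shows "f i = f a"
  using assms user_leader(1)[of f i] by (auto simp: pattern_def split: if_splits)

text \<open>The plan itself supplies both matchings: \<open>f\<close> on the leaders of each class
  for the inner one, and the class of the user of each class leader for the outer one.\<close>

lemma pattern_matching:
  fixes f cls :: "nat \<Rightarrow> nat" and k :: nat and cl :: "nat \<Rightarrow> 'c"
  assumes f: "\<And>i. i < k \<Longrightarrow> f i < n \<and> auth_query Q i (f i) \<and> cls (f i) < n"
    and cls: "\<And>u v. u < n \<Longrightarrow> v < n \<Longrightarrow> cls u = cls v \<longleftrightarrow> cl u = cl v"
  defines "D \<equiv> pattern k cl f"
  shows "matching (class_fits Q n k D cls) (class_leaders k D) n (\<lambda>c. cls (f c))"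
proof -
  have "class_fits Q n k D cls c (cls (f c))" if c: "c \<in> class_leaders k D" for c
  proof -
    have ck: "c < k" using c by (simp add: class_leaders_def)
    have "inj_on f (leaders k D c)"
    proof (rule inj_onI)
      fix a a' assume "a \<in> leaders k D c" "a' \<in> leaders k D c" "f a = f a'"
      then show "a = a'" using user_leader(3)[of f a a'] by (simp add: D_def leaders_pattern)
    qed
    moreover have "f a < n \<and> fits Q k D cls (cls (f c)) a (f a)" if a: "a \<in> leaders k D c" for a
    proof -
      have ak: "a < k" "class_leader cl f a = c" using a by (simp_all add: D_def leaders_pattern)
      then have "cl (f c) = cl (f a)" using class_leader(1)[of cl f a] by simp
      then have "cls (f a) = cls (f c)" using cls f ak ck by simp
      moreover have "auth_query Q i (f a)" if i: "i < k" "i = a \<or> D i = a" for i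
      proof -
        have "f i = f a" using i pattern_follower[OF i(1) ak(1), of cl f] by (auto simp: D_def)
        then show ?thesis using f[OF i(1)] by simp
      qed
      ultimately show ?thesis using f[OF ak(1)] by (simp add: fits_def)
    qed
    ultimately show ?thesis unfolding class_fits_def matching_def by blast
  qed
  moreover have "inj_on (\<lambda>c. cls (f c)) (class_leaders k D)"
  proof (rule inj_onI)
    fix c c' assume h: "c \<in> class_leaders k D" "c' \<in> class_leaders k D" "cls (f c) = cls (f c')"
    then have "cl (f c) = cl (f c')" using cls f by (simp add: class_leaders_def)
    then show "c = c'" using h class_leader(3)[of cl f c c'] by (simp add: D_def class_leaders_pattern)
  qed
  ultimately show ?thesis using f by (auto simp: matching_def class_leaders_def)
qed

text \<open>Classes of users are kept apart by the injectivity of \<open>g\<close>. Equal users lie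
  in one class, so their leaders belong to the same inner matching, where \<open>P\<close> is
  injective; followers copy their leaders.\<close>

lemma pattern_realizes:
  fixes f cls P g :: "nat \<Rightarrow> nat" and k :: nat and cl :: "nat \<Rightarrow> 'c"
  defines "D \<equiv> pattern k cl f"
  assumes P: "realizes Q n k D cls g P"
    and cls: "\<And>u v. u < n \<Longrightarrow> v < n \<Longrightarrow> cls u = cls v \<longleftrightarrow> cl u = cl v"
  shows "i < k \<Longrightarrow> P i < n \<and> auth_query Q i (P i)"
    and "i < k \<Longrightarrow> j < k \<Longrightarrow> P i = P j \<longleftrightarrow> f i = f j"
    and "i < k \<Longrightarrow> j < k \<Longrightarrow> cl (P i) = cl (P j) \<longleftrightarrow> cl (f i) = cl (f j)"
proof -
  let ?u = "user_leader f" and ?c = "class_leader cl f"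
  have lead: "?u i < k" "?u i \<in> leaders k D (?c i)" "?c i \<in> class_leaders k D" if i: "i < k" for i
  proof -
    show uk: "?u i < k" using user_leader(2)[of f i] i by simp
    have "?u (?u i) = ?u i" by (rule user_leader(3)) (rule user_leader(1))
    moreover have "?c (?u i) = ?c i" using user_leader(1)[of f i] by (intro class_leader(3)) simp
    ultimately show "?u i \<in> leaders k D (?c i)" using uk by (simp add: D_def leaders_pattern)
    have "?c (?c i) = ?c i" by (rule class_leader(3)) (rule class_leader(1))
    then show "?c i \<in> class_leaders k D" using class_leader(2)[of cl f i] i
      by (simp add: D_def class_leaders_pattern)
  qed
  have m: "matching (fits Q k D cls (g (?c i))) (leaders k D (?c i)) n P" if "i < k" for i
    using P lead(3)[OF that] by (simp add: realizes_def)
  have Pu: "P i = P (?u i)" if i: "i < k" for i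
  proof (cases "?u i = i")
    case False
    then have "D i = ?u i" using i by (simp add: D_def pattern_def)
    moreover have "k \<le> D (?u i)" using lead(2)[OF i] by (simp add: leaders_def)
    ultimately show ?thesis using P i lead(1)[OF i] by (simp add: realizes_def)
  qed simp
  have spec: "P i < n \<and> auth_query Q i (P i) \<and> cls (P i) = g (?c i)" if i: "i < k" for i
  proof -
    have "P i < n" and fit: "fits Q k D cls (g (?c i)) (?u i) (P i)"
      using m[OF i] lead(2)[OF i] Pu[OF i] by (simp_all add: matching_def)
    moreover have "i = ?u i \<or> D i = ?u i" using i by (simp add: D_def pattern_def)
    ultimately show ?thesis using i fit unfolding fits_def by blast
  qed
  then show "i < k \<Longrightarrow> P i < n \<and> auth_query Q i (P i)" by blast
  have inj: "inj_on g (class_leaders k D)" using P by (simp add: realizes_def)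
  show same_class: "cl (P i) = cl (P j) \<longleftrightarrow> cl (f i) = cl (f j)" if "i < k" "j < k" for i j
  proof -
    have "cl (P i) = cl (P j) \<longleftrightarrow> g (?c i) = g (?c j)"
      using cls[of "P i" "P j"] spec[OF that(1)] spec[OF that(2)] by simp
    also have "\<dots> \<longleftrightarrow> ?c i = ?c j"
      using inj_on_eq_iff[OF inj lead(3)[OF that(1)] lead(3)[OF that(2)]] .
    finally show ?thesis by (simp add: class_leader_eq_iff)
  qed
  show "P i = P j \<longleftrightarrow> f i = f j" if ij: "i < k" "j < k" for i j
  proof
    assume e: "P i = P j"
    then have "?c i = ?c j" using same_class[OF ij] by (simp add: class_leader_eq_iff)
    then have "?u j \<in> leaders k D (?c i)" using lead(2)[OF ij(2)] by simp
    moreover have "P (?u i) = P (?u j)" using e Pu[OF ij(1)] Pu[OF ij(2)] by simp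
    moreover have "inj_on P (leaders k D (?c i))" using m[OF ij(1)] by (simp add: matching_def)
    ultimately have "?u i = ?u j" using lead(2)[OF ij(1)] by (auto dest: inj_onD)
    then show "f i = f j" by (simp add: user_leader_eq_iff)
  next
    assume "f i = f j"
    then show "P i = P j" using Pu[OF ij(1)] Pu[OF ij(2)] user_leader(3)[of f i j] by simp
  qed
qed

section \<open>Plans and constraints\<close>

lemma plan_of_array_nth:
  assumes "distinct ss" "i < length ss"
  shows "plan_of_array ss us a (ss ! i) = (if a i < length us then Some (us ! a i) else None)"
proof -
  let ?is = "filter (\<lambda>i. a i < length us) [0..<length ss]"
  let ?xs = "map (\<lambda>i. (ss ! i, us ! a i)) ?is"
  have "inj_on ((!) ss) (set ?is)" using assms(1) by (intro inj_on_nth) auto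
  then have "distinct (map ((!) ss) ?is)" unfolding distinct_map by simp
  moreover have "map fst ?xs = map ((!) ss) ?is" by simp
  ultimately have d: "distinct (map fst ?xs)" by (simp only:)
  show ?thesis
  proof (cases "a i < length us")
    case True
    then have "(ss ! i, us ! a i) \<in> set ?xs" using assms(2) by auto
    from map_of_is_SomeI[OF d this] show ?thesis using True by (simp add: plan_of_array_def)
  next
    case False
    have "ss ! i \<noteq> ss ! j" if "j < length ss" "a j < length us" for j
      using assms that False nth_eq_iff_index_eq by metis
    then have "ss ! i \<notin> fst ` set ?xs" by fastforce
    then show ?thesis using False by (simp only: plan_of_array_def map_of_eq_None_iff if_False not_False_eq_True)
  qed
qed

lemma plan_of_array_outside: "s \<notin> set ss \<Longrightarrow> plan_of_array ss us a s = None"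
  unfolding plan_of_array_def by (auto simp: map_of_eq_None_iff)

text \<open>In a finite set, \<open>X\<close> and its injective image have complements of equal
  size, and any bijection between these completes \<open>h\<close>.\<close>

lemma permutes_extend:
  assumes "finite U" "X \<subseteq> U" "inj_on h X" "h ` X \<subseteq> U"
  shows "\<exists>\<psi>. \<psi> permutes U \<and> (\<forall>x\<in>X. \<psi> x = h x)"
proof -
  have "card (U - X) = card (U - h ` X)"
    using assms by (simp add: card_Diff_subset card_image finite_subset)
  then obtain g where g: "bij_betw g (U - X) (U - h ` X)"
    using assms(1) finite_same_card_bij[of "U - X" "U - h ` X"] by auto
  define \<psi> where "\<psi> = (\<lambda>x. if x \<in> X then h x else if x \<in> U then g x else x)"
  have "bij_betw \<psi> X (h ` X)"
    using assms(3) by (auto simp: \<psi>_def bij_betw_def inj_on_def)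
  moreover have "bij_betw \<psi> (U - X) (U - h ` X)"
    using g by (rule bij_betw_cong[THEN iffD1, rotated]) (simp add: \<psi>_def)
  ultimately have "bij_betw \<psi> (X \<union> (U - X)) (h ` X \<union> (U - h ` X))"
    by (rule bij_betw_combine) auto
  moreover have "X \<union> (U - X) = U" "h ` X \<union> (U - h ` X) = U" using assms by auto
  ultimately have "\<psi> permutes U" using assms(2) by (intro bij_imp_permutes) (auto simp: \<psi>_def)
  then show ?thesis by (intro exI[of _ \<psi>]) (simp add: \<psi>_def)
qed

text \<open>Sending the user of a task under \<open>\<pi>\<close> to its user under
  \<open>\<pi>'\<close> is well defined and injective by \<open>same\<close>, whichever task of that
  user is picked. An extension of this map to a permutation carries one plan to the other.\<close>

lemma user_independent_transfer:
  assumes ui: "user_independent U c" and U: "finite U"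
    and dom: "dom \<pi> = S" "dom \<pi>' = S" and ran: "ran \<pi> \<subseteq> U" "ran \<pi>' \<subseteq> U"
    and same: "\<And>s s'. s \<in> S \<Longrightarrow> s' \<in> S \<Longrightarrow> \<pi>' s = \<pi>' s' \<longleftrightarrow> \<pi> s = \<pi> s'"
    and sat: "satisfies \<pi> c"
  shows "satisfies \<pi>' c"
proof (cases "fst c \<subseteq> S")
  case False
  then show ?thesis using dom by (auto simp: satisfies_def)
next
  case True
  define h where "h u = the (\<pi>' (SOME s. \<pi> s = Some u))" for u
  have h: "\<pi>' s = Some (h u)" if "\<pi> s = Some u" for s u
  proof -
    let ?s = "SOME s. \<pi> s = Some u"
    have s: "\<pi> ?s = Some u" using that by (rule someI)
    then have "\<pi>' ?s = \<pi>' s" using same[of ?s s] that dom by (auto simp: dom_def)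
    moreover have "s \<in> dom \<pi>'" using that dom by blast
    ultimately show ?thesis by (auto simp: h_def)
  qed
  have "inj_on h (ran \<pi>)"
  proof (rule inj_onI)
    fix u v assume "u \<in> ran \<pi>" "v \<in> ran \<pi>" and e: "h u = h v"
    then obtain s s' where s: "\<pi> s = Some u" "\<pi> s' = Some v" by (auto simp: ran_def)
    then have "\<pi>' s = \<pi>' s'" using h e by simp
    then have "\<pi> s = \<pi> s'" using same[of s s'] s dom by blast
    then show "u = v" using s by simp
  qed
  moreover have "h ` ran \<pi> \<subseteq> U"
    using h ran(2) by (fastforce simp: ran_def)
  ultimately obtain \<psi> where \<psi>: "\<psi> permutes U" "\<forall>u\<in>ran \<pi>. \<psi> u = h u"
    using permutes_extend[OF U ran(1)] by blast
  have "\<pi> |` fst c \<in> snd c" using sat True dom by (auto simp: satisfies_def)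
  then have "map_option \<psi> \<circ> (\<pi> |` fst c) \<in> snd c" using ui \<psi>(1) by (auto simp: user_independent_def)
  moreover have "map_option \<psi> \<circ> (\<pi> |` fst c) = \<pi>' |` fst c"
  proof
    fix s
    show "(map_option \<psi> \<circ> (\<pi> |` fst c)) s = (\<pi>' |` fst c) s"
    proof (cases "s \<in> fst c")
      case in_c: True
      then obtain u where u: "\<pi> s = Some u" using True dom by blast
      then show ?thesis using in_c h[OF u] \<psi>(2) by (auto simp: ran_def)
    qed simp
  qed
  ultimately show ?thesis by (simp add: satisfies_def)
qed

section \<open>Relational constraints and the relation they reveal\<close>

lemma satisfies_rel_constraint:
  assumes "s \<in> dom \<pi>" "s' \<in> dom \<pi>" "ran \<pi> \<subseteq> U"
  shows "satisfies \<pi> (rel_constraint U s s' R) \<longleftrightarrow> (the (\<pi> s), the (\<pi> s')) \<in> R"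
  using assms by (auto simp: satisfies_def rel_constraint_def ran_def restrict_map_def split: if_splits)

text \<open>On a single task the constraint is always true or always false, by reflexivity. So a
  relational constraint that is not user-independent has two distinct tasks, as probing
  requires.\<close>

lemma rel_constraint_loop_user_independent:
  assumes "R = E \<or> R = U \<times> U - E" "refl_on U E"
  shows "user_independent U (rel_constraint U s s R)"
  unfolding user_independent_def
proof (intro ballI allI impI)
  fix \<theta> \<psi> assume \<theta>: "\<theta> \<in> snd (rel_constraint U s s R)" and \<psi>: "\<psi> permutes U"
  then have d: "dom \<theta> = {s}" "ran \<theta> \<subseteq> U" "(the (\<theta> s), the (\<theta> s)) \<in> R"
    by (auto simp: rel_constraint_def)
  then obtain u where u: "\<theta> s = Some u" by blast
  then have "u \<in> U" using d(2) by (auto simp: ran_def)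
  then have "R = E" using assms d(3) u by (auto simp: refl_on_def)
  moreover have "\<psi> u \<in> U" using \<psi> \<open>u \<in> U\<close> by (simp add: permutes_in_image)
  moreover have "\<theta> = [s \<mapsto> u]" using d(1) u by (auto simp: fun_eq_iff dom_def)
  ultimately show "map_option \<psi> \<circ> \<theta> \<in> snd (rel_constraint U s s R)"
    using assms(2) by (auto simp: rel_constraint_def refl_on_def)
qed

text \<open>If \<open>u\<close> and \<open>v\<close> are equivalent, \<open>cls u\<close> and
  \<open>cls v\<close> are both equivalent to both of them, so neither can be smaller than the
  other.\<close>

lemma least_rel_iff:
  assumes "least_rel n M cls" and E: "equiv {..<n} E"
    and M: "\<And>u v. u < n \<Longrightarrow> v < n \<Longrightarrow> M u v = M u u \<longleftrightarrow> (u, v) \<in> E"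
    and uv: "u < n" "v < n"
  shows "cls u = cls v \<longleftrightarrow> (u, v) \<in> E"
proof -
  have c: "cls u < n" "(u, cls u) \<in> E" "\<And>w. w < cls u \<Longrightarrow> (u, w) \<notin> E" if "u < n" for u
  proof -
    have *: "cls u < n" "M u (cls u) = M u u" "\<And>w. w < cls u \<Longrightarrow> M u w \<noteq> M u u"
      using assms(1) that unfolding least_rel_def by blast+
    show "cls u < n" by (rule *)
    show "(u, cls u) \<in> E" using M[OF that *(1)] *(2) by blast
    show "(u, w) \<notin> E" if "w < cls u" for w
      using M[of u w] *(1,3) that \<open>u < n\<close> by (meson less_trans)
  qed
  have sym: "sym E" and trans: "trans E" using E by (auto elim: equivE)
  show ?thesis
  proof
    assume "cls u = cls v"
    then show "(u, v) \<in> E" using c(2)[OF uv(1)] c(2)[OF uv(2)] sym trans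
      by (metis symD transD)
  next
    assume "(u, v) \<in> E"
    then have "(v, cls u) \<in> E" "(u, cls v) \<in> E"
      using c(2)[OF uv(1)] c(2)[OF uv(2)] sym trans by (metis symD transD)+
    then show "cls u = cls v" using c(3)[OF uv(1)] c(3)[OF uv(2)] by (meson linorder_neqE_nat)
  qed
qed

section \<open>Correctness of the solver\<close>

locale presented_instance =
  fixes ss :: "'s list" and us :: "'u list" and cs :: "('s, 'u) constraint list"
    and S :: "'s set" and U :: "'u set" and A :: "'s \<Rightarrow> 'u set" and C :: "('s, 'u) constraint set"
    and R :: "('u \<times> 'u) set" and \<tau> :: nat
  assumes inst: "wsp_instance (S, U, A, C)" and enum: "enumerates ss us cs (S, U, A, C)"
    and R: "equiv U R"
    and C: "\<And>c. c \<in> C \<Longrightarrow> (\<exists>s1 s2. c = rel_constraint U s1 s2 R) \<or>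
      (\<exists>s1 s2. c = rel_constraint U s1 s2 (U \<times> U - R)) \<or> user_independent U c"
begin

abbreviation "n \<equiv> length us"
abbreviation "k \<equiv> length ss"
abbreviation "m \<equiv> length cs"
abbreviation "Q \<equiv> wsp_queries ss us cs (S, U, A, C) \<tau>"

lemma lists: "distinct ss" "set ss = S" "distinct us" "set us = U" "set cs = C"
  using enum by (simp_all add: enumerates_def)

lemma scope: "c \<in> C \<Longrightarrow> fst c \<subseteq> S"
  using inst by (cases c) (auto simp: wsp_instance_def)

lemma query_simps:
  "auth_query Q i j \<longleftrightarrow> i < k \<and> j < n \<and> us ! j \<in> A (ss ! i)"
  "check_query Q l a \<longleftrightarrow> l < m \<and> satisfies (plan_of_array ss us a) (cs ! l)"
  "query_time Q = \<tau>"
  by (simp_all add: wsp_queries_def)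

lemma plan_of_array_plan:
  assumes "\<forall>i<k. P i < n"
  shows "dom (plan_of_array ss us P) = S" "ran (plan_of_array ss us P) \<subseteq> U"
    "\<And>i. i < k \<Longrightarrow> plan_of_array ss us P (ss ! i) = Some (us ! P i)"
proof -
  show nth: "plan_of_array ss us P (ss ! i) = Some (us ! P i)" if "i < k" for i
    using plan_of_array_nth[OF lists(1) that, of us P] assms that by simp
  have out: "plan_of_array ss us P s = None" if "s \<notin> S" for s
    using plan_of_array_outside that lists(2) by metis
  have idx: "\<exists>i<k. s = ss ! i" if "s \<in> S" for s
    using that lists(2) by (metis in_set_conv_nth)
  show "dom (plan_of_array ss us P) = S"
  proof (intro set_eqI iffI)
    fix s assume "s \<in> S"
    then obtain i where "i < k" "s = ss ! i" using idx by blast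
    then show "s \<in> dom (plan_of_array ss us P)" using nth by blast
  next
    fix s assume "s \<in> dom (plan_of_array ss us P)"
    then show "s \<in> S" using out by (metis domIff)
  qed
  show "ran (plan_of_array ss us P) \<subseteq> U"
  proof
    fix u assume "u \<in> ran (plan_of_array ss us P)"
    then obtain s where s: "plan_of_array ss us P s = Some u" by (auto simp: ran_def)
    then have "s \<in> S" using out by force
    then obtain i where i: "i < k" "s = ss ! i" using idx by blast
    then have "u = us ! P i" using s nth by simp
    then show "u \<in> U" using assms i(1) lists(4) by auto
  qed
qed

lemma accepted_valid:
  assumes "accepted Q k m P"
  shows "valid_complete_plan (S, U, A, C) (plan_of_array ss us P)"
proof -
  \<comment> \<open>Authorization queries are answered negatively for positions that name no user,
    so acceptance forces the array to be a complete plan.\<close>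
  have lt: "\<And>i. i < k \<Longrightarrow> P i < n" and au: "\<And>i. i < k \<Longrightarrow> us ! P i \<in> A (ss ! i)"
    and ch: "\<And>l. l < m \<Longrightarrow> satisfies (plan_of_array ss us P) (cs ! l)"
    using assms by (auto simp: accepted_def query_simps)
  have "\<forall>i<k. P i < n" using lt by blast
  note p = plan_of_array_plan[OF this]
  have "eligible C (plan_of_array ss us P)"
    unfolding eligible_def using ch lists(5) by (metis in_set_conv_nth)
  moreover have "authorized A (plan_of_array ss us P)"
    unfolding authorized_def
  proof
    fix s assume "s \<in> dom (plan_of_array ss us P)"
    then obtain i where "i < k" "s = ss ! i" using p(1) lists(2) by (metis in_set_conv_nth)
    then show "the (plan_of_array ss us P s) \<in> A s" using p(3) au by simp
  qed
  ultimately show ?thesis using p by (simp add: valid_complete_plan_def plan_def)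
qed

lemma plan_index:
  assumes "valid_complete_plan (S, U, A, C) \<pi>"
  obtains f where "\<And>i. i < k \<Longrightarrow> f i < n \<and> \<pi> (ss ! i) = Some (us ! f i) \<and> auth_query Q i (f i)"
proof -
  have \<pi>: "dom \<pi> = S" "ran \<pi> \<subseteq> U" "authorized A \<pi>"
    using assms by (simp_all add: valid_complete_plan_def plan_def)
  have "\<exists>j<n. \<pi> (ss ! i) = Some (us ! j) \<and> auth_query Q i j" if i: "i < k" for i
  proof -
    have s: "ss ! i \<in> dom \<pi>" using i \<pi>(1) lists(2) by auto
    then obtain u where u: "\<pi> (ss ! i) = Some u" by blast
    then have "u \<in> set us" using \<pi>(2) lists(4) by (auto simp: ran_def)
    then obtain j where j: "j < n" "us ! j = u" by (metis in_set_conv_nth)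
    moreover have "u \<in> A (ss ! i)" using \<pi>(3) s u by (force simp: authorized_def)
    ultimately show ?thesis using u i by (auto simp: query_simps)
  qed
  then show ?thesis using that by metis
qed

text \<open>The alternative for \<open>cl\<close> covers both uses: either it separates exactly the
  classes of \<open>R\<close>, or no constraint can see \<open>R\<close> and any classification will
  do. A realization then agrees with \<open>\<pi>\<close> on all that the constraints can
  see.\<close>

lemma pattern_succeeds:
  fixes cl :: "nat \<Rightarrow> 'c"
  assumes valid: "valid_complete_plan (S, U, A, C) \<pi>"
    and f: "\<And>i. i < k \<Longrightarrow> f i < n \<and> \<pi> (ss ! i) = Some (us ! f i) \<and> auth_query Q i (f i)"
    and cls: "\<And>u v. u < n \<Longrightarrow> v < n \<Longrightarrow> cls u = cls v \<longleftrightarrow> cl u = cl v"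
    and cls_less: "\<And>u. u < n \<Longrightarrow> cls u < n"
    and cl: "(\<forall>c\<in>C. user_independent U c) \<or> (\<forall>u<n. \<forall>v<n. cl u = cl v \<longleftrightarrow> (us ! u, us ! v) \<in> R)"
  shows "succeeds Q n k m (pattern k cl f) cls"
  unfolding succeeds_def
proof (intro conjI allI impI)
  show "\<exists>M. matching (class_fits Q n k (pattern k cl f) cls) (class_leaders k (pattern k cl f)) n M"
    by (rule exI, rule pattern_matching) (use f cls cls_less in auto)
next
  fix g P assume r: "realizes Q n k (pattern k cl f) cls g P"
  have P1: "P i < n \<and> auth_query Q i (P i)" if "i < k" for i
    by (rule pattern_realizes(1)[OF r _ that]) (rule cls)
  have P2: "P i = P j \<longleftrightarrow> f i = f j" if "i < k" "j < k" for i j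
    by (rule pattern_realizes(2)[OF r _ that]) (rule cls)
  have P3: "cl (P i) = cl (P j) \<longleftrightarrow> cl (f i) = cl (f j)" if "i < k" "j < k" for i j
    by (rule pattern_realizes(3)[OF r _ that]) (rule cls)
  have lt: "P i < n" if "i < k" for i using P1 that by blast
  define \<pi>' where "\<pi>' = plan_of_array ss us P"
  have "\<forall>i<k. P i < n" using lt by blast
  note \<pi>' = plan_of_array_plan[OF this, folded \<pi>'_def]
  have \<pi>: "dom \<pi> = S" "ran \<pi> \<subseteq> U" "eligible C \<pi>"
    using valid by (simp_all add: valid_complete_plan_def plan_def)
  have idx: "\<exists>i<k. s = ss ! i" if "s \<in> S" for s
    using that lists(2) by (metis in_set_conv_nth)
  have same: "\<pi>' s = \<pi>' s' \<longleftrightarrow> \<pi> s = \<pi> s'" if "s \<in> S" "s' \<in> S" for s s'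
  proof -
    obtain i j where ij: "i < k" "s = ss ! i" "j < k" "s' = ss ! j" using idx \<open>s \<in> S\<close> \<open>s' \<in> S\<close> by blast
    then show ?thesis
      using P2[of i j] \<pi>'(3)[OF ij(1)] \<pi>'(3)[OF ij(3)] f[OF ij(1)] f[OF ij(3)] lt[OF ij(1)] lt[OF ij(3)]
        lists(3) by (simp add: nth_eq_iff_index_eq)
  qed
  have "satisfies \<pi>' c" if c: "c \<in> C" for c
  proof (cases "user_independent U c")
    case True
    have "finite U" using lists(4) by auto
    moreover have "satisfies \<pi> c" using \<pi>(3) c by (simp add: eligible_def)
    ultimately show ?thesis
      using user_independent_transfer[OF True _ \<pi>(1) \<pi>'(1) \<pi>(2) \<pi>'(2) same] by blast
  next
    case False
    then obtain s s' R' where R': "c = rel_constraint U s s' R'" "R' = R \<or> R' = U \<times> U - R"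
      using C[OF c] by blast
    have s: "s \<in> S" "s' \<in> S" using scope[OF c(1)] by (simp_all add: R'(1) rel_constraint_def)
    then obtain i j where ij: "i < k" "s = ss ! i" "j < k" "s' = ss ! j" using idx by blast
    have "(us ! P i, us ! P j) \<in> R \<longleftrightarrow> (us ! f i, us ! f j) \<in> R"
    proof -
      have "\<forall>u<n. \<forall>v<n. cl u = cl v \<longleftrightarrow> (us ! u, us ! v) \<in> R" using cl False c by blast
      then show ?thesis using P3[OF ij(1,3)] lt[OF ij(1)] lt[OF ij(3)] f[OF ij(1)] f[OF ij(3)] by blast
    qed
    moreover have "us ! P i \<in> U" "us ! P j \<in> U" "us ! f i \<in> U" "us ! f j \<in> U"
      using lt[OF ij(1)] lt[OF ij(3)] f[OF ij(1)] f[OF ij(3)] lists(4) by auto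
    ultimately have "(us ! P i, us ! P j) \<in> R' \<longleftrightarrow> (us ! f i, us ! f j) \<in> R'" using R'(2) by blast
    moreover have "satisfies \<pi> c" using \<pi>(3) c by (simp add: eligible_def)
    ultimately show ?thesis
      using s \<pi>'(1,2) \<pi>(1,2) \<pi>'(3)[OF ij(1)] \<pi>'(3)[OF ij(3)] f[OF ij(1)] f[OF ij(3)]
      unfolding R'(1) by (simp add: satisfies_rel_constraint ij(2,4))
  qed
  then have "satisfies \<pi>' (cs ! l)" if "l < m" for l
    using that lists(5) nth_mem by blast
  then show "accepted Q k m P"
    using P1 unfolding accepted_def query_simps(2) \<pi>'_def by blast
qed

text \<open>A constraint that is not user-independent is relational on two distinct tasks, so one of
  the triples tried probes it and recovers the true classes. If there is no such constraint, the
  zero class map works.\<close>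

lemma hits_pattern:
  assumes valid: "valid_complete_plan (S, U, A, C) \<pi>"
  shows "\<exists>t<(2 * k) ^ k. hits Q n k m (digits k t)"
proof -
  obtain f where f: "\<And>i. i < k \<Longrightarrow> f i < n \<and> \<pi> (ss ! i) = Some (us ! f i) \<and> auth_query Q i (f i)"
    using plan_index[OF valid] by blast
  have "\<exists>D. (\<forall>i. if i < k then D i < 2 * k else D i = 0) \<and> hits Q n k m D"
  proof (cases "\<forall>c\<in>C. user_independent U c")
    case True
    have "succeeds Q n k m (pattern k (\<lambda>_. ()) f) cls" if "\<forall>u<n. cls u = 0" for cls
      by (rule pattern_succeeds[OF valid f]) (use that True in auto)
    then have "hits Q n k m (pattern k (\<lambda>_. ()) f)" by (simp add: hits_def)
    then show ?thesis using pattern_digits by (intro exI conjI allI)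
  next
    case False
    then obtain c where c: "c \<in> C" "\<not> user_independent U c" by blast
    then obtain s s' R' where R': "c = rel_constraint U s s' R'" "R' = R \<or> R' = U \<times> U - R"
      using C by blast
    have refl: "refl_on U R" using R by (auto elim: equivE)
    have ne: "s \<noteq> s'" using rel_constraint_loop_user_independent[OF R'(2) refl, of s] c R'(1) by metis
    have s: "s \<in> S" "s' \<in> S" using scope[OF c(1)] by (simp_all add: R'(1) rel_constraint_def)
    then obtain i j where ij: "i < k" "s = ss ! i" "j < k" "s' = ss ! j"
      using lists(2) by (metis in_set_conv_nth)
    obtain l where l: "l < m" "cs ! l = c" using c lists(5) by (metis in_set_conv_nth)
    define M where "M u v \<longleftrightarrow> (us ! u, us ! v) \<in> R'" for u v
    have "probes Q n k l i j M"
      unfolding probes_def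
    proof (intro allI impI)
      fix B :: "nat \<Rightarrow> nat" and u v
      assume h: "u < n" "v < n" "B i = u" "B j = v"
      let ?\<pi> = "plan_of_array ss us B"
      have "?\<pi> s = Some (us ! u)" "?\<pi> s' = Some (us ! v)"
        using plan_of_array_nth[OF lists(1), of _ us B] ij h by simp_all
      moreover have "ran ?\<pi> \<subseteq> U"
        using lists(4) by (auto simp: plan_of_array_def ran_def dest!: map_of_SomeD)
      ultimately show "check_query Q l B = M u v"
        using l by (simp add: query_simps R'(1) satisfies_rel_constraint domI M_def)
    qed
    moreover have "succeeds Q n k m (pattern k (\<lambda>u. R `` {us ! u}) f) cls" if cls: "least_rel n M cls" for cls
    proof (rule pattern_succeeds[OF valid])
      show "f i < n \<and> \<pi> (ss ! i) = Some (us ! f i) \<and> auth_query Q i (f i)" if "i < k" for i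
        using f[OF that] .
      show "cls u < n" if "u < n" for u using cls that unfolding least_rel_def by blast
      have in_U: "us ! u \<in> U" if "u < n" for u using that lists(4) by auto
      let ?E = "{(u, v). u < n \<and> v < n \<and> (us ! u, us ! v) \<in> R}"
      have "sym R" "trans R" using R by (auto elim: equivE)
      then have "sym ?E" "trans ?E" unfolding sym_def trans_def by blast+
      then have E: "equiv {..<n} ?E"
        using refl in_U by (auto simp: equiv_def refl_on_def)
      have M: "M u v = M u u \<longleftrightarrow> (u, v) \<in> ?E" if "u < n" "v < n" for u v
        using R'(2) refl in_U[OF that(1)] in_U[OF that(2)] that unfolding M_def refl_on_def by blast
      have same: "R `` {us ! u} = R `` {us ! v} \<longleftrightarrow> (us ! u, us ! v) \<in> R" if "u < n" "v < n" for u v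
        by (rule eq_equiv_class_iff[OF R in_U[OF that(1)] in_U[OF that(2)]])
      show "cls u = cls v \<longleftrightarrow> R `` {us ! u} = R `` {us ! v}" if uv: "u < n" "v < n" for u v
      proof -
        have "cls u = cls v \<longleftrightarrow> (u, v) \<in> ?E" by (rule least_rel_iff[OF cls E _ uv]) (rule M)
        then show ?thesis using uv same[OF uv] by simp
      qed
      show "(\<forall>c\<in>C. user_independent U c) \<or>
          (\<forall>u<n. \<forall>v<n. R `` {us ! u} = R `` {us ! v} \<longleftrightarrow> (us ! u, us ! v) \<in> R)"
        using same by blast
    qed
    moreover have "i \<noteq> j" using ne ij by blast
    ultimately have "hits Q n k m (pattern k (\<lambda>u. R `` {us ! u}) f)"
      unfolding hits_def using l(1) ij(1,3) by blast
    then show ?thesis using pattern_digits by (intro exI conjI allI)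
  qed
  then obtain D where D: "\<And>i. if i < k then D i < 2 * k else D i = 0" "hits Q n k m D" by blast
  obtain t where t: "t < (2 * k) ^ k" "\<forall>i<k. digit (2 * k) t i = D i"
    using digits_surj[of k D "2 * k"] D(1) by (auto split: if_splits)
  have "digits k t = D"
  proof
    fix i show "digits k t i = D i" using t(2) D(1)[of i] by (auto simp: digits_def split: if_splits)
  qed
  then show ?thesis using t(1) D(2) by blast
qed

end

text \<open>\<open>k ^ k\<close> comes from \<open>k * log 2 k\<close> and \<open>2 ^ k\<close> from
  the summand \<open>k\<close>. For \<open>k = 0\<close> both sides are 1, as the logarithm is
  multiplied by zero.\<close>

lemma two_powr_pattern_count: "2 powr (real k * log 2 (real k) + real k) = real ((2 * k) ^ k)"
proof (cases "k = 0")
  case False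
  then have "2 powr (real k * log 2 (real k)) = real k ^ k"
    by (simp add: mult.commute[of "real k"] powr_powr[symmetric] powr_realpow)
  then show ?thesis by (simp add: powr_add powr_realpow power_mult_distrib)
qed simp

theorem theorem23:
  shows "solvable_in_O_star
    {(S :: 's set, U :: 'u set, A, C).
       \<exists>R. equiv U R \<and>
         (\<forall>c\<in>C. (\<exists>s1 s2. c = rel_constraint U s1 s2 R) \<or>
                (\<exists>s1 s2. c = rel_constraint U s1 s2 (U \<times> U - R)) \<or>
                user_independent U c)}
    (\<lambda>k. 2 powr (real k * log 2 (real k) + real k))"
  (is "solvable_in_O_star ?K _")
  unfolding solvable_in_O_star_def two_powr_pattern_count
proof (intro exI[of _ solver] allI impI)
  fix p assume p: "polynomial3 p"
  \<comment> \<open>This is the bound of \<open>solver_spec\<close> with the query time replaced by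
    its bound \<open>p\<close>; monotonicity of \<open>cost\<close> in the query time justifies the
    replacement.\<close>
  define q where "q = (\<lambda>n k m. cost (search ;; odometer) (dims n k m) (p n k m) + 12)"
  have "polynomial3 q"
    unfolding q_def by (intro polynomial3.add polynomial3.const polynomial3_cost p)
  moreover have "let n = length us; k = length ss; m = length cs in real \<tau> \<le> p n k m \<longrightarrow>
      (\<exists>t \<sigma>. exec (wsp_queries ss us cs W \<tau>) solver (input_state n k m) t \<sigma> \<and>
         solution_state ss us W \<sigma> \<and> real t \<le> q n k m * real ((2 * k) ^ k))"
    if W: "W \<in> ?K" "wsp_instance W" "enumerates ss us cs W" for W :: "('s, 'u) wsp" and ss us cs \<tau>
  proof -
    obtain S U A C where eq: "W = (S, U, A, C)" by (cases W) auto
    obtain R where R: "equiv U R" "\<And>c. c \<in> C \<Longrightarrow> (\<exists>s1 s2. c = rel_constraint U s1 s2 R) \<or>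
        (\<exists>s1 s2. c = rel_constraint U s1 s2 (U \<times> U - R)) \<or> user_independent U c"
      using W(1) unfolding eq by blast
    interpret presented_instance ss us cs S U A C R \<tau>
      using W(2,3) R unfolding eq by unfold_locales
    have "\<exists>t \<sigma>. exec Q solver (input_state n k m) t \<sigma> \<and> solution_state ss us W \<sigma> \<and>
        real t \<le> q n k m * real ((2 * k) ^ k)" if \<tau>: "real \<tau> \<le> p n k m"
    proof -
      obtain t \<sigma> where run: "exec Q solver (input_state n k m) t \<sigma>"
          "fst \<sigma> 0 \<noteq> 0 \<longrightarrow> accepted Q k m (snd \<sigma> 0)"
          "\<forall>t<(2 * k) ^ k. hits Q n k m (digits k t) \<longrightarrow> fst \<sigma> 0 \<noteq> 0"
          "real t \<le> (cost (search ;; odometer) (dims n k m) (real (query_time Q)) + 12) * real ((2 * k) ^ k)"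
        using solver_spec[of Q n k m] by blast
      have "fst \<sigma> 0 \<noteq> 0" if "valid_complete_plan W \<pi>" for \<pi>
        using hits_pattern[of \<pi>] that run(3) unfolding eq by blast
      moreover have "fst \<sigma> 0 \<noteq> 0 \<Longrightarrow> valid_complete_plan W (plan_of_array ss us (snd \<sigma> 0))"
        using accepted_valid run(2) unfolding eq by blast
      ultimately have "solution_state ss us W \<sigma>"
        unfolding solution_state_def by auto
      moreover have "cost (search ;; odometer) (dims n k m) (real (query_time Q)) + 12 \<le> q n k m"
        unfolding q_def query_simps(3) using \<tau> by (intro add_right_mono cost_mono dims_nonneg)
      then have "real t \<le> q n k m * real ((2 * k) ^ k)"
        by (rule order_trans[OF run(4) mult_right_mono]) simp
      ultimately show ?thesis using run(1) by blast
    qed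
    then show ?thesis unfolding Let_def eq by blast
  qed
  ultimately show "\<exists>q. polynomial3 q \<and> (\<forall>W\<in>?K. \<forall>ss us cs \<tau>. wsp_instance W \<longrightarrow> enumerates ss us cs W \<longrightarrow>
      (let n = length us; k = length ss; m = length cs in real \<tau> \<le> p n k m \<longrightarrow>
        (\<exists>t \<sigma>. exec (wsp_queries ss us cs W \<tau>) solver (input_state n k m) t \<sigma> \<and>
          solution_state ss us W \<sigma> \<and> real t \<le> q n k m * real ((2 * k) ^ k))))"
    by blast
qed

end
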